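(* $\mathcal{R}$ is a $C^\infty$ submanifold of $\mathcal{B}(\mathcal{H})\times\mathcal{H}$. For any $(P_0,f_0)\in\mathcal{R}$, the map $$\rho_{(P_0,f_0)}:\mathcal{U}(\mathcal{H})\to\mathcal{R}_{P_0},\qquad \rho_{(P_0,f_0)}(U)=(UP_0U^*,Uf_0),$$ is a $C^\infty$ submersion, and in fact all these manifolds and maps are real analytic.
   Context: $\mathcal{H}$ is a complex Hilbert space, $\mathcal{B}(\mathcal{H})$ the bounded operators with the operator norm, $\mathcal{U}(\mathcal{H})$ the unitary group (a real Banach-Lie group with the norm topology, with Lie algebra the anti-Hermitian operators), $\mathcal{P}(\mathcal{H})$ the set of orthogonal projections on $\mathcal{H}$. $\mathcal{R}=\{(P,f)\in\mathcal{P}(\mathcal{H})\times\mathcal{H}: Pf=f,\ \|f\|=1\}$ and $\mathcal{R}_{P_0}=\{(P,f)\in\mathcal{R}: P=WP_0W^* \text{ for some } W\in\mathcal{U}(\mathcal{H})\}$. $\mathcal{B}(\mathcal{H})\times\mathcal{H}$ is viewed as a real Banach space; a submanifold is an embedded one, carrying the relative topology, with closed complemented tangent spaces. A submersion is a smooth map whose differential at each point is surjective with complemented kernel. *)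

theory Defs
  imports "HOL-Analysis.Analysis"
begin

section \<open>Complex Hilbert spaces\<close>

class complex_inner = real_normed_vector +
  fixes scaleC :: "complex \<Rightarrow> 'a \<Rightarrow> 'a"  (infixr "*\<^sub>C" 75)
    and cinner :: "'a \<Rightarrow> 'a \<Rightarrow> complex"
  assumes scaleC_add_right: "c *\<^sub>C (x + y) = c *\<^sub>C x + c *\<^sub>C y"
    and scaleC_add_left: "(c + d) *\<^sub>C x = c *\<^sub>C x + d *\<^sub>C x"
    and scaleC_scaleC: "c *\<^sub>C d *\<^sub>C x = (c * d) *\<^sub>C x"
    and scaleC_one: "1 *\<^sub>C x = x"
    and scaleR_eq_scaleC: "r *\<^sub>R x = complex_of_real r *\<^sub>C x"
    and cinner_commute: "cinner x y = cnj (cinner y x)"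
    and cinner_add_right: "cinner x (y + z) = cinner x y + cinner x z"
    and cinner_scaleC_right: "cinner x (c *\<^sub>C y) = c * cinner x y"
    and cinner_ge_zero: "0 \<le> Re (cinner x x)"
    and norm_eq_sqrt_cinner: "norm x = sqrt (Re (cinner x x))"

class complex_hilbert = complex_inner + complete_space
begin
subclass banach ..
end


section \<open>Bounded operators on a complex Hilbert space\<close>

typedef (overloaded) ('a :: complex_inner) bdd_op =
    "{T :: 'a \<Rightarrow>\<^sub>L 'a. \<forall>c x. blinfun_apply T (c *\<^sub>C x) = c *\<^sub>C blinfun_apply T x}"
  morphisms blinfun_of Bdd_op
proof
  show "0 \<in> {T :: 'a \<Rightarrow>\<^sub>L 'a. \<forall>c x. blinfun_apply T (c *\<^sub>C x) = c *\<^sub>C blinfun_apply T x}"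
    using scaleC_add_right[of _ "0 :: 'a" 0] by simp
qed

setup_lifting type_definition_bdd_op

lemma scaleC_zero_right [simp]: "c *\<^sub>C (0 :: 'a :: complex_inner) = 0"
  using scaleC_add_right[of c "0 :: 'a" 0] by simp

lemma scaleC_minus_right: "c *\<^sub>C (- x) = - (c *\<^sub>C x)" for x :: "'a :: complex_inner"
  using scaleC_add_right[of c x "- x"] by (simp add: eq_neg_iff_add_eq_0 add.commute)

lemma scaleC_diff_right: "c *\<^sub>C (x - y) = c *\<^sub>C x - c *\<^sub>C y" for x :: "'a :: complex_inner"
  using scaleC_add_right[of c x "- y"] by (simp add: scaleC_minus_right)

lemma scaleC_scaleR_commute: "c *\<^sub>C r *\<^sub>R x = r *\<^sub>R c *\<^sub>C x" for x :: "'a :: complex_inner"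
  by (simp add: scaleR_eq_scaleC scaleC_scaleC mult.commute)

instantiation bdd_op :: (complex_inner) real_normed_vector
begin

lift_definition zero_bdd_op :: "'a bdd_op" is 0
  by simp

lift_definition plus_bdd_op :: "'a bdd_op \<Rightarrow> 'a bdd_op \<Rightarrow> 'a bdd_op" is "(+)"
  by (simp add: blinfun.add_left scaleC_add_right)

lift_definition minus_bdd_op :: "'a bdd_op \<Rightarrow> 'a bdd_op \<Rightarrow> 'a bdd_op" is "(-)"
  by (simp add: blinfun.diff_left scaleC_diff_right)

lift_definition uminus_bdd_op :: "'a bdd_op \<Rightarrow> 'a bdd_op" is uminus
  by (simp add: blinfun.minus_left scaleC_minus_right)

lift_definition scaleR_bdd_op :: "real \<Rightarrow> 'a bdd_op \<Rightarrow> 'a bdd_op" is scaleR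
  by (simp add: blinfun.scaleR_left scaleC_scaleR_commute)

lift_definition norm_bdd_op :: "'a bdd_op \<Rightarrow> real" is norm .

definition dist_bdd_op :: "'a bdd_op \<Rightarrow> 'a bdd_op \<Rightarrow> real"
  where "dist_bdd_op S T = norm (S - T)"

definition uniformity_bdd_op :: "('a bdd_op \<times> 'a bdd_op) filter"
  where "uniformity_bdd_op = (INF e\<in>{0 <..}. principal {(S, T). dist S T < e})"

definition open_bdd_op :: "'a bdd_op set \<Rightarrow> bool"
  where "open_bdd_op A = (\<forall>S\<in>A. \<forall>\<^sub>F (S', T) in uniformity. S' = S \<longrightarrow> T \<in> A)"

definition sgn_bdd_op :: "'a bdd_op \<Rightarrow> 'a bdd_op"
  where "sgn_bdd_op T = inverse (norm T) *\<^sub>R T"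

instance
  apply standard
  unfolding dist_bdd_op_def open_bdd_op_def sgn_bdd_op_def uniformity_bdd_op_def
  apply (rule refl | (transfer, force simp: norm_triangle_ineq algebra_simps))+
  done

end

lemma dist_blinfun_of: "dist (blinfun_of S) (blinfun_of T) = dist S T"
  unfolding dist_norm by transfer simp

instance bdd_op :: (complex_hilbert) banach
proof
  fix X :: "nat \<Rightarrow> 'a bdd_op"
  assume "Cauchy X"
  then have "Cauchy (\<lambda>n. blinfun_of (X n))"
    by (simp add: Cauchy_def dist_blinfun_of)
  then obtain L where L: "(\<lambda>n. blinfun_of (X n)) \<longlonglongrightarrow> L"
    using Cauchy_convergent_iff convergent_def by blast
  have sc: "bounded_linear (\<lambda>x :: 'a. c *\<^sub>C x)" for c
  proof (rule bounded_linear_intro)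
    show "norm (c *\<^sub>C x) \<le> norm x * cmod c" for x :: 'a
    proof -
      have "cinner (c *\<^sub>C x) (c *\<^sub>C x) = (c * cnj c) * cinner x x"
        by (metis cinner_commute cinner_scaleC_right complex_cnj_mult mult.assoc)
      also have "c * cnj c = complex_of_real ((cmod c)\<^sup>2)"
        by (simp add: complex_mult_cnj cmod_power2)
      finally show ?thesis
        by (simp add: norm_eq_sqrt_cinner[where 'a = 'a] real_sqrt_mult mult.commute)
    qed
  qed (simp_all add: scaleC_add_right scaleC_scaleR_commute)
  have "blinfun_apply L (c *\<^sub>C x) = c *\<^sub>C blinfun_apply L x" for c x
  proof (rule LIMSEQ_unique)
    have lim: "(\<lambda>n. blinfun_apply (blinfun_of (X n)) y) \<longlonglongrightarrow> blinfun_apply L y" for y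
      by (intro blinfun.tendsto L tendsto_const)
    show "(\<lambda>n. blinfun_apply (blinfun_of (X n)) (c *\<^sub>C x)) \<longlonglongrightarrow> blinfun_apply L (c *\<^sub>C x)"
      by (rule lim)
    show "(\<lambda>n. blinfun_apply (blinfun_of (X n)) (c *\<^sub>C x)) \<longlonglongrightarrow> c *\<^sub>C blinfun_apply L x"
    proof -
      have "blinfun_apply (blinfun_of (X n)) (c *\<^sub>C x) = c *\<^sub>C blinfun_apply (blinfun_of (X n)) x" for n
        using blinfun_of[of "X n"] by blast
      then show ?thesis
        using bounded_linear.tendsto[OF sc lim, of c x] by presburger
    qed
  qed
  then have inv: "blinfun_of (Bdd_op L) = L"
    by (simp add: Bdd_op_inverse)
  have "dist (X n) (Bdd_op L) = dist (blinfun_of (X n)) L" for n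
    by (simp only: dist_blinfun_of[symmetric] inv)
  with L have "X \<longlonglongrightarrow> Bdd_op L"
    by (simp add: lim_sequentially)
  then show "convergent X"
    by (auto simp: convergent_def)
qed

definition op_apply :: "'a :: complex_inner bdd_op \<Rightarrow> 'a \<Rightarrow> 'a"  (infixr "\<cdot>" 70)
  where "T \<cdot> x = blinfun_apply (blinfun_of T) x"

lift_definition op_id :: "'a :: complex_inner bdd_op" is id_blinfun
  by simp

lift_definition op_comp :: "'a :: complex_inner bdd_op \<Rightarrow> 'a bdd_op \<Rightarrow> 'a bdd_op"
  (infixl "\<odot>" 72) is blinfun_compose
  by simp

definition adjoint_op :: "'a :: complex_hilbert bdd_op \<Rightarrow> 'a bdd_op"
  where "adjoint_op T = (THE S. \<forall>x y. cinner (S \<cdot> x) y = cinner x (T \<cdot> y))"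

definition unitary_ops :: "'a :: complex_hilbert bdd_op set"
  where "unitary_ops = {W. adjoint_op W \<odot> W = op_id \<and> W \<odot> adjoint_op W = op_id}"

definition projections :: "'a :: complex_hilbert bdd_op set"
  where "projections = {P. P \<odot> P = P \<and> adjoint_op P = P}"

definition proj_vectors :: "('a :: complex_hilbert bdd_op \<times> 'a) set"
  where "proj_vectors = {(P, f). P \<in> projections \<and> P \<cdot> f = f \<and> norm f = 1}"

definition proj_vectors_orbit :: "'a :: complex_hilbert bdd_op \<Rightarrow> ('a bdd_op \<times> 'a) set"
  where "proj_vectors_orbit P0 =
    {(P, f) \<in> proj_vectors. \<exists>W\<in>unitary_ops. P = W \<odot> P0 \<odot> adjoint_op W}"

definition rho :: "'a :: complex_hilbert bdd_op \<times> 'a \<Rightarrow> 'a bdd_op \<Rightarrow> 'a bdd_op \<times> 'a"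
  where "rho = (\<lambda>(P0, f0) U. (U \<odot> P0 \<odot> adjoint_op U, U \<cdot> f0))"


section \<open>Smooth and real analytic maps between real Banach spaces\<close>

text \<open>
  The model space of a chart is a closed subspace of an ambient Banach space, so differentiability
  classes are defined for maps on relatively open subsets of a closed subspace \<open>S\<close>
  (\<open>S = UNIV\<close> gives open subsets of the whole space). A \<open>k\<close>-linear map on \<open>S\<close> is represented by
  a function on lists, of which only the values on lists of length \<open>k\<close> over \<open>S\<close> matter.
\<close>

definition multilinear_on :: "'a :: real_normed_vector set \<Rightarrow> nat \<Rightarrow> ('a list \<Rightarrow> 'b :: real_normed_vector) \<Rightarrow> bool"
  where "multilinear_on S k T \<longleftrightarrow>
    (\<forall>us ws x y a b. set us \<subseteq> S \<and> set ws \<subseteq> S \<and> x \<in> S \<and> y \<in> S \<and> length us + 1 + length ws = k \<longrightarrow>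
      T (us @ (a *\<^sub>R x + b *\<^sub>R y) # ws) = a *\<^sub>R T (us @ x # ws) + b *\<^sub>R T (us @ y # ws))"

definition multi_norm_le :: "'a :: real_normed_vector set \<Rightarrow> nat \<Rightarrow> ('a list \<Rightarrow> 'b :: real_normed_vector) \<Rightarrow> real \<Rightarrow> bool"
  where "multi_norm_le S k T C \<longleftrightarrow>
    (\<forall>vs. set vs \<subseteq> S \<and> length vs = k \<longrightarrow> norm (T vs) \<le> C * prod_list (map norm vs))"

text \<open>
  In \<open>smooth_on\<close>, \<open>D k\<close> is the \<open>k\<close>-th Frechet derivative, a map from \<open>U\<close> to the bounded
  \<open>k\<close>-linear maps on \<open>S\<close>; the last clause says that \<open>D k\<close> is Frechet differentiable at \<open>x\<close>
  with respect to the operator norm, with derivative \<open>h \<mapsto> D (Suc k) x (h, \<dots>)\<close>.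
\<close>

definition smooth_on :: "'a :: banach set \<Rightarrow> 'a set \<Rightarrow> ('a \<Rightarrow> 'b :: banach) \<Rightarrow> bool"
  where "smooth_on S U f \<longleftrightarrow> openin (top_of_set S) U \<and>
    (\<exists>D :: nat \<Rightarrow> 'a \<Rightarrow> 'a list \<Rightarrow> 'b. \<forall>x\<in>U.
      D 0 x [] = f x \<and>
      (\<forall>k. multilinear_on S k (D k x) \<and> (\<exists>C. multi_norm_le S k (D k x) C)) \<and>
      (\<forall>k. \<forall>e>0. \<exists>d>0. \<forall>y\<in>U. norm (y - x) < d \<longrightarrow>
        multi_norm_le S k (\<lambda>vs. D k y vs - D k x vs - D (Suc k) x ((y - x) # vs)) (e * norm (y - x))))"

text \<open>
  Locally, \<open>f\<close> is the sum of a power series \<open>\<Sum>k. a k (h, \<dots>, h)\<close> of bounded \<open>k\<close>-linear maps whose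
  norms grow at most geometrically.
\<close>

definition real_analytic_on :: "'a :: banach set \<Rightarrow> 'a set \<Rightarrow> ('a \<Rightarrow> 'b :: banach) \<Rightarrow> bool"
  where "real_analytic_on S U f \<longleftrightarrow> openin (top_of_set S) U \<and>
    (\<forall>x\<in>U. \<exists>r>0. \<exists>C. \<exists>a :: nat \<Rightarrow> 'a list \<Rightarrow> 'b.
      (\<forall>k. multilinear_on S k (a k) \<and> multi_norm_le S k (a k) (C / r ^ k)) \<and>
      (\<forall>h\<in>S. norm h < r \<longrightarrow> x + h \<in> U \<and> (\<lambda>k. a k (replicate k h)) sums f (x + h)))"

datatype regularity = Smooth | Analytic

fun of_class :: "regularity \<Rightarrow> 'a :: banach set \<Rightarrow> 'a set \<Rightarrow> ('a \<Rightarrow> 'b :: banach) \<Rightarrow> bool"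
  where
    "of_class Smooth S U f = smooth_on S U f"
  | "of_class Analytic S U f = real_analytic_on S U f"


section \<open>Embedded submanifolds and submersions\<close>

definition complemented_in :: "'a :: real_normed_vector set \<Rightarrow> 'a set \<Rightarrow> bool"
  where "complemented_in S F \<longleftrightarrow> subspace F \<and> closed F \<and> F \<subseteq> S \<and>
    (\<exists>G. subspace G \<and> closed G \<and> G \<subseteq> S \<and> F \<inter> G = {0} \<and> {x + y | x y. x \<in> F \<and> y \<in> G} = S)"

text \<open>
  A slice chart \<open>(U, \<phi>, F)\<close> of \<open>M\<close> is a diffeomorphism \<open>\<phi>\<close> between open subsets of the ambient
  space that maps \<open>U \<inter> M\<close> onto the trace of the complemented subspace \<open>F\<close>. Its restriction to
  \<open>U \<inter> M\<close> is a chart of \<open>M\<close>, in the relative topology, with model space \<open>F\<close>; the tangent space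
  of \<open>M\<close> at \<open>p\<close> is the preimage of \<open>F\<close> under the derivative of \<open>\<phi>\<close> at \<open>p\<close>.
\<close>

definition slice_chart :: "regularity \<Rightarrow> 'a :: banach set \<Rightarrow> 'a set \<Rightarrow> ('a \<Rightarrow> 'a) \<Rightarrow> 'a set \<Rightarrow> bool"
  where "slice_chart r M U \<phi> F \<longleftrightarrow>
    open U \<and> open (\<phi> ` U) \<and> inj_on \<phi> U \<and>
    of_class r UNIV U \<phi> \<and> of_class r UNIV (\<phi> ` U) (inv_into U \<phi>) \<and>
    complemented_in UNIV F \<and> \<phi> ` (U \<inter> M) = \<phi> ` U \<inter> F"

definition submanifold :: "regularity \<Rightarrow> 'a :: banach set \<Rightarrow> bool"
  where "submanifold r M \<longleftrightarrow> (\<forall>p\<in>M. \<exists>U \<phi> F. p \<in> U \<and> slice_chart r M U \<phi> F)"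

text \<open>
  Charts of \<open>M\<close> at \<open>p\<close> and of \<open>N\<close> at \<open>f p\<close> in which the map \<open>f\<close> from \<open>M\<close> to \<open>N\<close> is represented
  by a map of class \<open>r\<close> from an open subset of the model space \<open>F\<close> to the model space \<open>G\<close>.
\<close>

definition adapted_charts ::
  "regularity \<Rightarrow> 'a :: banach set \<Rightarrow> 'b :: banach set \<Rightarrow> ('a \<Rightarrow> 'b) \<Rightarrow> 'a \<Rightarrow>
    'a set \<Rightarrow> ('a \<Rightarrow> 'a) \<Rightarrow> 'a set \<Rightarrow> 'b set \<Rightarrow> ('b \<Rightarrow> 'b) \<Rightarrow> 'b set \<Rightarrow> bool"
  where "adapted_charts r M N f p U \<phi> F V \<psi> G \<longleftrightarrow>
    slice_chart r M U \<phi> F \<and> p \<in> U \<and> slice_chart r N V \<psi> G \<and> f ` (U \<inter> M) \<subseteq> V \<and>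
    of_class r F (\<phi> ` (U \<inter> M)) (\<psi> \<circ> f \<circ> inv_into U \<phi>)"

definition manifold_map :: "regularity \<Rightarrow> 'a :: banach set \<Rightarrow> 'b :: banach set \<Rightarrow> ('a \<Rightarrow> 'b) \<Rightarrow> bool"
  where "manifold_map r M N f \<longleftrightarrow> submanifold r M \<and> submanifold r N \<and> f \<in> M \<rightarrow> N \<and>
    (\<forall>p\<in>M. \<exists>U \<phi> F V \<psi> G. adapted_charts r M N f p U \<phi> F V \<psi> G)"

text \<open>
  Charts identify the tangent spaces at \<open>p\<close> and \<open>f p\<close> with the model spaces \<open>F\<close> and \<open>G\<close>, and the
  differential of \<open>f\<close> at \<open>p\<close> with the derivative \<open>L\<close> of the chart representation. Only the values
  of \<open>L\<close> on \<open>F\<close> are determined by \<open>f\<close>, and only these are used. By the chain rule the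
  condition on \<open>L\<close> does not depend on the choice of charts.
\<close>

definition submersion :: "regularity \<Rightarrow> 'a :: banach set \<Rightarrow> 'b :: banach set \<Rightarrow> ('a \<Rightarrow> 'b) \<Rightarrow> bool"
  where "submersion r M N f \<longleftrightarrow> manifold_map r M N f \<and>
    (\<forall>p\<in>M. \<exists>U \<phi> F V \<psi> G L. adapted_charts r M N f p U \<phi> F V \<psi> G \<and>
      ((\<psi> \<circ> f \<circ> inv_into U \<phi>) has_derivative L) (at (\<phi> p) within F) \<and>
      L ` F = G \<and> complemented_in F {v \<in> F. L v = 0})"

end

theory Submission
  imports Defs
begin

text \<open>
  Every chart below is a rational map with a rational inverse: both are given by formulas in operator
  products, adjoints, inverses and inner products. Having local power series is stable under these
  operations (bilinear expressions by the Cauchy product, inverses by a recursion), and a map with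
  local power series is smooth (\<open>smooth_on_analytic\<close>), so \<open>of_class_analytic\<close> settles both
  regularity classes at once. What remains is algebra.

  For the unitary group, the Cayley transform \<open>A \<mapsto> (1 + A)(1 - A)\<^sup>-\<^sup>1\<close> has the inverse
  \<open>T \<mapsto> (T - 1)(T + 1)\<^sup>-\<^sup>1\<close>, which turns the condition \<open>T\<^sup>* = T\<^sup>-\<^sup>1\<close> into the linear condition
  \<open>A\<^sup>* = - A\<close>; right translation moves this chart to any point of the group (\<open>unitary_chart\<close>).

  For a pair \<open>(P, f)\<close> near \<open>(P1, f1)\<close>, the reflection \<open>S = 2 P - 1\<close> is used in place of \<open>P\<close>; the
  conditions read \<open>S\<^sup>2 = 1\<close>, \<open>S\<^sup>* = S\<close>, \<open>S f = f\<close> and \<open>norm f = 1\<close>. The unit vector is straightened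
  first: its stereographic coordinate \<open>w\<close> determines an operator \<open>tilt f1 w\<close>, linear in \<open>w\<close> over the
  reals and skew-adjoint, whose Cayley transform \<open>V\<close> satisfies \<open>V f1 = f\<close> (\<open>rotation_apply\<close>).
  After conjugation by \<open>V\<close> the third condition is \<open>S f1 = f1\<close>, and for the Cayley coordinate \<open>X\<close> of
  \<open>S S1\<close> all conditions become linear: \<open>X\<^sup>* = - X\<close>, \<open>X S1 = - S1 X\<close>, \<open>X f1 = 0\<close>,
  \<open>Re (cinner f1 w) = 0\<close> (\<open>pv_param_mem_iff\<close>). So \<open>(P, f) \<mapsto> (X, w)\<close> is a slice chart.

  Nearby projections are unitarily equivalent: for small \<open>X\<close> the unitary operator
  \<open>(1 + X)(1 - X\<^sup>2)\<^sup>-\<^sup>1\<^sup>/\<^sup>2\<close> conjugates \<open>S1\<close> to the reflection with coordinate \<open>X\<close>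
  (\<open>anticommuting_cayley_conjugate\<close>). Hence an orbit is open in the whole manifold and has the same charts.

  Finally, by equivariance the map \<open>rho\<close> in the chart at \<open>U0\<close> is \<open>A \<mapsto> (T P1 T\<^sup>*, T f1)\<close> with \<open>T\<close> the
  Cayley transform of \<open>A\<close> and \<open>(P1, f1)\<close> the image of \<open>U0\<close>. In the chart \<open>(X, w)\<close> this map is known
  exactly along two kinds of lines: \<open>t \<mapsto> t (tilt f1 w)\<close> goes to \<open>(0, t w)\<close>, by the construction of the
  chart, and \<open>t \<mapsto> t X\<close>, for \<open>X\<close> in the model space, to \<open>(2 t X (1 + t\<^sup>2 X\<^sup>2)\<^sup>-\<^sup>1, 0)\<close>. Therefore
  \<open>(X, w) \<mapsto> X / 2 + tilt f1 w\<close> is a bounded right inverse of the differential, which proves that the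
  differential is surjective and that its kernel is complemented.
\<close>

section \<open>Locally convergent power series\<close>

text \<open>
  A single function on lists stands for the whole sequence of multilinear maps of a power series, its
  values on lists of length \<open>k\<close> being the \<open>k\<close>-linear term. Products, inverses and derivatives of
  series are then plain recursions on lists.
\<close>

definition multilinear_family ::
  "'a :: real_normed_vector set \<Rightarrow> real \<Rightarrow> real \<Rightarrow> ('a list \<Rightarrow> 'b :: real_normed_vector) \<Rightarrow> bool"
  where "multilinear_family S r C a \<longleftrightarrow>
    (\<forall>us ws x y \<alpha> \<beta>. set us \<subseteq> S \<longrightarrow> set ws \<subseteq> S \<longrightarrow> x \<in> S \<longrightarrow> y \<in> S \<longrightarrow>
      a (us @ (\<alpha> *\<^sub>R x + \<beta> *\<^sub>R y) # ws) = \<alpha> *\<^sub>R a (us @ x # ws) + \<beta> *\<^sub>R a (us @ y # ws)) \<and>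
    (\<forall>vs. set vs \<subseteq> S \<longrightarrow> norm (a vs) \<le> C * prod_list (map (\<lambda>v. norm v / r) vs))"

lemma multilinear_familyI:
  assumes "\<And>us ws x y \<alpha> \<beta>. set us \<subseteq> S \<Longrightarrow> set ws \<subseteq> S \<Longrightarrow> x \<in> S \<Longrightarrow> y \<in> S \<Longrightarrow>
      a (us @ (\<alpha> *\<^sub>R x + \<beta> *\<^sub>R y) # ws) = \<alpha> *\<^sub>R a (us @ x # ws) + \<beta> *\<^sub>R a (us @ y # ws)"
    and "\<And>vs. set vs \<subseteq> S \<Longrightarrow> norm (a vs) \<le> C * prod_list (map (\<lambda>v. norm v / r) vs)"
  shows "multilinear_family S r C a"
  using assms unfolding multilinear_family_def by blast

lemma multilinear_family_linear:
  assumes "multilinear_family S r C a" "set us \<subseteq> S" "set ws \<subseteq> S" "x \<in> S" "y \<in> S"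
  shows "a (us @ (\<alpha> *\<^sub>R x + \<beta> *\<^sub>R y) # ws) = \<alpha> *\<^sub>R a (us @ x # ws) + \<beta> *\<^sub>R a (us @ y # ws)"
  using assms unfolding multilinear_family_def by blast

lemma multilinear_family_bound:
  assumes "multilinear_family S r C a" "set vs \<subseteq> S"
  shows "norm (a vs) \<le> C * prod_list (map (\<lambda>v. norm v / r) vs)"
  using assms unfolding multilinear_family_def by blast

lemma multilinear_family_nonneg: "multilinear_family S r C a \<Longrightarrow> 0 \<le> C"
  using order_trans[OF norm_ge_zero multilinear_family_bound[of S r C a "[]"]] by simp

lemma prod_list_norm_nonneg: "r > 0 \<Longrightarrow> 0 \<le> prod_list (map (\<lambda>v. norm v / r) vs)"
  by (induction vs) auto

lemma prod_list_norm_antimono: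
  assumes "0 < r'" "r' \<le> r"
  shows "prod_list (map (\<lambda>v. norm v / r) vs) \<le> prod_list (map (\<lambda>v. norm v / r') vs)"
proof (induction vs)
  case (Cons v vs)
  have "norm v / r \<le> norm v / r'"
    using assms by (intro divide_left_mono) auto
  then show ?case
    using mult_mono[OF _ Cons.IH, of "norm v / r" "norm v / r'"] assms prod_list_norm_nonneg[of r vs]
    by simp
qed simp

lemma prod_list_norm_scale:
  assumes "r > 0" "q > 0"
  shows "prod_list (map (\<lambda>v. norm v / (q * r)) vs) =
    prod_list (map (\<lambda>v. norm v / r) vs) / q ^ length vs"
  using assms by (induction vs) (auto simp: field_simps)

lemma prod_list_norm_conv_power: "prod_list (map (\<lambda>v. norm v / r) vs) = prod_list (map norm vs) / r ^ length vs"
  by (induction vs) (auto simp: field_simps)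

lemma multilinear_family_shrink:
  assumes a: "multilinear_family S r C a" and r: "0 < r'" "r' \<le> r" and C: "C \<le> C'"
  shows "multilinear_family S r' C' a"
proof (rule multilinear_familyI)
  fix vs assume vs: "set vs \<subseteq> S"
  have "norm (a vs) \<le> C * prod_list (map (\<lambda>v. norm v / r) vs)"
    using multilinear_family_bound[OF a vs] .
  also have "\<dots> \<le> C' * prod_list (map (\<lambda>v. norm v / r') vs)"
    using r C multilinear_family_nonneg[OF a] prod_list_norm_nonneg[of r vs]
    by (intro mult_mono prod_list_norm_antimono) auto
  finally show "norm (a vs) \<le> C' * prod_list (map (\<lambda>v. norm v / r') vs)" .
qed (rule multilinear_family_linear[OF a])

lemma multilinear_family_replicate_bound:
  assumes "multilinear_family S r C a" "h \<in> S"
  shows "norm (a (replicate n h)) \<le> C * (norm h / r) ^ n"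
proof -
  have "prod_list (map (\<lambda>v. norm v / r) (replicate n h)) = (norm h / r) ^ n"
    by (simp add: prod_list_replicate)
  moreover have "set (replicate n h) \<subseteq> S" using assms(2) by (induction n) auto
  ultimately show ?thesis using multilinear_family_bound[OF assms(1)] by metis
qed

definition analytic_at :: "'a :: real_normed_vector set \<Rightarrow> 'a \<Rightarrow> ('a \<Rightarrow> 'b :: real_normed_vector) \<Rightarrow> bool"
  where "analytic_at S x f \<longleftrightarrow> (\<exists>r>0. \<exists>C a. multilinear_family S r C a \<and>
    (\<forall>h\<in>S. norm h < r \<longrightarrow> (\<lambda>n. a (replicate n h)) sums f (x + h)))"

lemma analytic_atI:
  assumes "r > 0" "multilinear_family S r C a"
    and "\<And>h. h \<in> S \<Longrightarrow> norm h < r \<Longrightarrow> (\<lambda>n. a (replicate n h)) sums f (x + h)"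
  shows "analytic_at S x f"
  using assms unfolding analytic_at_def by blast

text \<open>
  Shrinking the radius in the norm bound but not the domain of convergence allows several series to
  be brought to a common radius.
\<close>

lemma analytic_at_shrunk:
  assumes "analytic_at S x f"
  obtains r0 C a where "r0 > 0" "0 \<le> C" "\<And>r. 0 < r \<Longrightarrow> r \<le> r0 \<Longrightarrow> multilinear_family S r C a"
    "\<And>h. h \<in> S \<Longrightarrow> norm h < r0 \<Longrightarrow> (\<lambda>n. a (replicate n h)) sums f (x + h)"
proof -
  obtain r C a where *: "r > 0" "multilinear_family S r C a"
    "\<forall>h\<in>S. norm h < r \<longrightarrow> (\<lambda>n. a (replicate n h)) sums f (x + h)"
    using assms unfolding analytic_at_def by blast
  show ?thesis
    using * multilinear_family_shrink[OF *(2)]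
    by (intro that[of r C a]) (auto intro: multilinear_family_nonneg)
qed

subsection \<open>Closure properties\<close>

lemma analytic_at_cong:
  assumes f: "analytic_at S x f" and e: "e > 0"
    and eq: "\<And>h. h \<in> S \<Longrightarrow> norm h < e \<Longrightarrow> g (x + h) = f (x + h)"
  shows "analytic_at S x g"
proof -
  obtain r C a where *: "r > 0" "0 \<le> C" "\<And>s. 0 < s \<Longrightarrow> s \<le> r \<Longrightarrow> multilinear_family S s C a"
    "\<And>h. h \<in> S \<Longrightarrow> norm h < r \<Longrightarrow> (\<lambda>n. a (replicate n h)) sums f (x + h)"
    using analytic_at_shrunk[OF f] by blast
  show ?thesis
    by (rule analytic_atI[of "min r e" _ C a]) (use * e eq in auto)
qed

lemma sums_replicate_Nil:
  fixes a :: "'a list \<Rightarrow> 'b :: real_normed_vector"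
  assumes "\<And>n. n \<ge> k \<Longrightarrow> a (replicate n h) = 0"
  shows "(\<lambda>n. a (replicate n h)) sums (\<Sum>n<k. a (replicate n h))"
  using assms by (intro sums_finite) auto

lemma analytic_at_const: "analytic_at S x (\<lambda>_. c)"
proof (rule analytic_atI[of 1 _ "norm c" "\<lambda>vs. if vs = [] then c else 0"])
  show "multilinear_family S 1 (norm c) (\<lambda>vs. if vs = [] then c else 0)"
    using prod_list_norm_nonneg[of 1] by (auto intro!: multilinear_familyI mult_nonneg_nonneg)
  show "(\<lambda>n. if replicate n h = [] then c else 0) sums c" for h :: 'a
    using sums_replicate_Nil[of 1 "\<lambda>vs. if vs = [] then c else 0" h] by simp
qed simp

lemma analytic_at_ident: "analytic_at S x (\<lambda>u. u)"
proof (rule analytic_atI[of 1 _ "norm x + 1"])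
  let ?a = "\<lambda>vs. case vs of [] \<Rightarrow> x | [v] \<Rightarrow> v | _ \<Rightarrow> 0"
  show "multilinear_family S 1 (norm x + 1) ?a"
  proof (rule multilinear_familyI)
    fix vs :: "'a list"
    show "norm (?a vs) \<le> (norm x + 1) * prod_list (map (\<lambda>v. norm v / 1) vs)"
      using prod_list_norm_nonneg[of 1 "tl (tl vs)"]
      by (auto split: list.splits simp: algebra_simps)
  qed (auto split: list.splits simp: append_eq_Cons_conv Cons_eq_append_conv)
  show "(\<lambda>n. ?a (replicate n h)) sums (x + h)" for h :: 'a
  proof -
    have "?a (replicate n h) = 0" if "n \<ge> 2" for n
      using that by (cases n; cases "n - 1") (auto split: list.splits)
    then show ?thesis
      using sums_replicate_Nil[of 2 ?a h] by (simp add: numeral_2_eq_2)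
  qed
qed simp

lemma analytic_at_bounded_linear:
  assumes L: "bounded_linear L" and f: "analytic_at S x f"
  shows "analytic_at S x (\<lambda>u. L (f u))"
proof -
  interpret L: bounded_linear L by fact
  obtain K where K: "K > 0" "\<And>u. norm (L u) \<le> norm u * K" using L.pos_bounded by blast
  obtain r C a where *: "r > 0" "0 \<le> C" "\<And>s. 0 < s \<Longrightarrow> s \<le> r \<Longrightarrow> multilinear_family S s C a"
    "\<And>h. h \<in> S \<Longrightarrow> norm h < r \<Longrightarrow> (\<lambda>n. a (replicate n h)) sums f (x + h)"
    using analytic_at_shrunk[OF f] by blast
  have a: "multilinear_family S r C a" using * by simp
  show ?thesis
  proof (rule analytic_atI[of r _ "C * K" "\<lambda>vs. L (a vs)"])
    show "multilinear_family S r (C * K) (\<lambda>vs. L (a vs))"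
    proof (rule multilinear_familyI)
      fix vs assume "set vs \<subseteq> S"
      then show "norm (L (a vs)) \<le> C * K * prod_list (map (\<lambda>v. norm v / r) vs)"
        using multilinear_family_bound[OF a, of vs] K(2)[of "a vs"] K(1)
        by (smt (verit, best) mult.assoc mult.commute mult_right_mono)
    qed (simp add: multilinear_family_linear[OF a] L.add L.scale)
  qed (use * in \<open>auto intro: L.sums\<close>)
qed

lemma analytic_at_add:
  assumes f: "analytic_at S x f" and g: "analytic_at S x g"
  shows "analytic_at S x (\<lambda>u. f u + g u)"
proof -
  obtain r C a where *: "r > 0" "0 \<le> C" "\<And>s. 0 < s \<Longrightarrow> s \<le> r \<Longrightarrow> multilinear_family S s C a"
    "\<And>h. h \<in> S \<Longrightarrow> norm h < r \<Longrightarrow> (\<lambda>n. a (replicate n h)) sums f (x + h)"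
    using analytic_at_shrunk[OF f] by blast
  obtain t D b where **: "t > 0" "0 \<le> D" "\<And>s. 0 < s \<Longrightarrow> s \<le> t \<Longrightarrow> multilinear_family S s D b"
    "\<And>h. h \<in> S \<Longrightarrow> norm h < t \<Longrightarrow> (\<lambda>n. b (replicate n h)) sums g (x + h)"
    using analytic_at_shrunk[OF g] by blast
  define s where "s = min r t"
  have ab: "multilinear_family S s C a" "multilinear_family S s D b" "s > 0"
    using * ** by (auto simp: s_def)
  show ?thesis
  proof (rule analytic_atI[of s _ "C + D" "\<lambda>vs. a vs + b vs"])
    show "multilinear_family S s (C + D) (\<lambda>vs. a vs + b vs)"
    proof (rule multilinear_familyI)
      fix vs assume "set vs \<subseteq> S"
      then show "norm (a vs + b vs) \<le> (C + D) * prod_list (map (\<lambda>v. norm v / s) vs)"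
        using multilinear_family_bound[OF ab(1), of vs] multilinear_family_bound[OF ab(2), of vs]
          norm_triangle_ineq[of "a vs" "b vs"] by (simp add: algebra_simps)
    qed (simp add: multilinear_family_linear[OF ab(1)] multilinear_family_linear[OF ab(2)] algebra_simps)
  qed (use * ** ab in \<open>auto intro: sums_add simp: s_def\<close>)
qed

lemma analytic_at_diff:
  assumes f: "analytic_at S x f" and g: "analytic_at S x g"
  shows "analytic_at S x (\<lambda>u. f u - g u)"
  using analytic_at_add[OF f analytic_at_bounded_linear[OF bounded_linear_minus[OF bounded_linear_ident] g]]
  by simp

lemma analytic_at_Pair:
  assumes f: "analytic_at S x f" and g: "analytic_at S x g"
  shows "analytic_at S x (\<lambda>u. (f u, g u))"
proof -
  have "bounded_linear (\<lambda>u. (u, 0 :: 'c))" "bounded_linear (\<lambda>u. (0 :: 'b, u))"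
    by (auto intro!: bounded_linear_Pair bounded_linear_ident bounded_linear_zero)
  from analytic_at_add[OF analytic_at_bounded_linear[OF this(1) f] analytic_at_bounded_linear[OF this(2) g]]
  show ?thesis by simp
qed

lemma tendsto_square_times_geometric:
  fixes q :: real
  assumes "0 \<le> q" "q < 1"
  shows "(\<lambda>n. (real n)\<^sup>2 * q ^ n) \<longlonglongrightarrow> 0"
proof -
  have "(\<lambda>n. (real n * sqrt q ^ n)\<^sup>2) \<longlonglongrightarrow> 0\<^sup>2"
    using assms by (intro tendsto_power powser_times_n_limit_0) (auto simp: real_sqrt_lt_1_iff)
  moreover have "(real n * sqrt q ^ n)\<^sup>2 = (real n)\<^sup>2 * q ^ n" for n
    using assms by (simp add: power_mult_distrib power_mult[symmetric] mult.commute[of n 2])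
      (simp add: power_mult)
  ultimately show ?thesis by simp
qed

text \<open>
  The difference between the product of two partial sums of length \<open>N\<close> and the \<open>N\<close>-th partial sum of
  the Cauchy product consists of fewer than \<open>N\<^sup>2\<close> terms, each of order \<open>q\<^sup>N\<close>.
\<close>

lemma bilinear_Cauchy_product_sums:
  assumes B: "bounded_bilinear B" and q: "0 \<le> q" "q < 1"
    and a: "a sums s" "\<And>n. norm (a n) \<le> C * q ^ n"
    and b: "b sums t" "\<And>n. norm (b n) \<le> D * q ^ n"
  shows "(\<lambda>n. \<Sum>i\<le>n. B (a i) (b (n - i))) sums B s t"
proof -
  interpret B: bounded_bilinear B by fact
  obtain K where K: "K > 0" "\<And>x y. norm (B x y) \<le> norm x * norm y * K" using B.pos_bounded by blast
  have C: "C \<ge> 0" "D \<ge> 0"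
    using order_trans[OF norm_ge_zero a(2)[of 0]] order_trans[OF norm_ge_zero b(2)[of 0]] by auto
  have Bab: "norm (B (a i) (b j)) \<le> C * D * K * q ^ (i + j)" for i j
  proof -
    have "norm (B (a i) (b j)) \<le> norm (a i) * norm (b j) * K" by (rule K)
    also have "\<dots> \<le> (C * q ^ i) * (D * q ^ j) * K"
      using K(1) C q by (intro mult_mono a b) auto
    finally show ?thesis by (simp add: power_add algebra_simps)
  qed
  have lim: "(\<lambda>N. B (\<Sum>i<N. a i) (\<Sum>j<N. b j)) \<longlonglongrightarrow> B s t"
    using a(1) b(1) unfolding sums_def by (rule B.tendsto)
  have diff: "norm (B (\<Sum>i<N. a i) (\<Sum>j<N. b j) - (\<Sum>n<N. \<Sum>i\<le>n. B (a i) (b (n - i))))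
      \<le> C * D * K * ((real N)\<^sup>2 * q ^ N)" for N
  proof -
    let ?f = "\<lambda>(i, j). B (a i) (b j)"
    let ?S = "{(i, j). i + j < N}"
    have fin: "finite ?S" by (rule finite_subset[of _ "{..<N} \<times> {..<N}"]) auto
    have 1: "B (\<Sum>i<N. a i) (\<Sum>j<N. b j) = (\<Sum>p\<in>{..<N}\<times>{..<N}. ?f p)"
      by (simp only: B.sum_left) (simp add: B.sum_right sum.cartesian_product)
    have 2: "(\<Sum>n<N. \<Sum>i\<le>n. B (a i) (b (n - i))) = (\<Sum>p\<in>?S. ?f p)"
      by (simp add: sum.triangle_reindex)
    have "B (\<Sum>i<N. a i) (\<Sum>j<N. b j) - (\<Sum>n<N. \<Sum>i\<le>n. B (a i) (b (n - i))) =
      (\<Sum>p\<in>{..<N}\<times>{..<N} - ?S. ?f p)"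
      unfolding 1 2 by (rule sum_diff[symmetric]) auto
    also have "norm \<dots> \<le> (\<Sum>p\<in>{..<N}\<times>{..<N} - ?S. C * D * K * q ^ N)"
    proof (rule sum_norm_le)
      fix p assume p: "p \<in> {..<N}\<times>{..<N} - ?S"
      have "q ^ (fst p + snd p) \<le> q ^ N"
        using p q by (intro power_decreasing) auto
      then have "C * D * K * q ^ (fst p + snd p) \<le> C * D * K * q ^ N"
        using C K(1) by (intro mult_left_mono) auto
      then show "norm (?f p) \<le> C * D * K * q ^ N"
        using Bab[of "fst p" "snd p"] by (auto simp: case_prod_beta)
    qed
    also have "\<dots> \<le> (\<Sum>p\<in>{..<N}\<times>{..<N}. C * D * K * q ^ N)"
      using C K(1) q by (intro sum_mono2) auto
    also have "\<dots> = C * D * K * ((real N)\<^sup>2 * q ^ N)"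
      by (simp add: card_cartesian_product power2_eq_square)
    finally show ?thesis .
  qed
  have "(\<lambda>N. B (\<Sum>i<N. a i) (\<Sum>j<N. b j) - (\<Sum>n<N. \<Sum>i\<le>n. B (a i) (b (n - i)))) \<longlonglongrightarrow> 0"
    by (rule Lim_null_comparison[of _ "\<lambda>N. C * D * K * ((real N)\<^sup>2 * q ^ N)"])
      (use diff tendsto_mult_right_zero[OF tendsto_square_times_geometric[OF q]] in auto)
  from tendsto_diff[OF lim this] show ?thesis
    unfolding sums_def by simp
qed

lemma prod_list_take_drop:
  "prod_list (map f (take i vs)) * prod_list (map f (drop i vs)) = (prod_list (map f vs) :: real)"
  by (metis append_take_drop_id map_append prod_list.append)

lemma Suc_le_two_power: "real (Suc n) \<le> 2 ^ n"
proof -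
  have "Suc n \<le> 2 ^ n" by (induction n) auto
  then show ?thesis by (metis of_nat_le_iff of_nat_numeral of_nat_power)
qed

text \<open>
  The product term of length \<open>n\<close> is a sum over the \<open>n + 1\<close> ways to cut a list in two. Halving the
  radius absorbs the factor \<open>n + 1\<close>.
\<close>

lemma multilinear_family_Cauchy_product:
  assumes B: "bounded_bilinear B" and K: "K > 0" "\<And>x y. norm (B x y) \<le> norm x * norm y * K"
    and a: "multilinear_family S r C a" and b: "multilinear_family S r D b" and r: "r > 0"
  shows "multilinear_family S (r / 2) (C * D * K) (\<lambda>vs. \<Sum>i\<le>length vs. B (a (take i vs)) (b (drop i vs)))"
proof (rule multilinear_familyI)
  interpret B: bounded_bilinear B by fact
  note C = multilinear_family_nonneg[OF a] multilinear_family_nonneg[OF b]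
  fix us ws x y \<alpha> \<beta>
  assume S: "set us \<subseteq> S" "set ws \<subseteq> S" "x \<in> S" "y \<in> S"
  have "B (a (take i (us @ (\<alpha> *\<^sub>R x + \<beta> *\<^sub>R y) # ws))) (b (drop i (us @ (\<alpha> *\<^sub>R x + \<beta> *\<^sub>R y) # ws))) =
    \<alpha> *\<^sub>R B (a (take i (us @ x # ws))) (b (drop i (us @ x # ws))) +
    \<beta> *\<^sub>R B (a (take i (us @ y # ws))) (b (drop i (us @ y # ws)))" for i
  proof (cases "i \<le> length us")
    case True
    have "set (drop i us) \<subseteq> S" using S set_drop_subset by force
    then show ?thesis
      using True S by (simp add: multilinear_family_linear[OF b] B.add_right B.scaleR_right)
  next
    case False
    then obtain j where i: "i = length us + Suc j"
      by (metis add_Suc_right less_imp_Suc_add not_le)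
    have "set (take j ws) \<subseteq> S" using S set_take_subset by force
    then show ?thesis
      using S by (simp add: i multilinear_family_linear[OF a] B.add_left B.scaleR_left)
  qed
  then show "(\<Sum>i\<le>length (us @ (\<alpha> *\<^sub>R x + \<beta> *\<^sub>R y) # ws).
      B (a (take i (us @ (\<alpha> *\<^sub>R x + \<beta> *\<^sub>R y) # ws))) (b (drop i (us @ (\<alpha> *\<^sub>R x + \<beta> *\<^sub>R y) # ws)))) =
    \<alpha> *\<^sub>R (\<Sum>i\<le>length (us @ x # ws). B (a (take i (us @ x # ws))) (b (drop i (us @ x # ws)))) +
    \<beta> *\<^sub>R (\<Sum>i\<le>length (us @ y # ws). B (a (take i (us @ y # ws))) (b (drop i (us @ y # ws))))"
    by (simp add: scaleR_sum_right sum.distrib del: sum.atMost_Suc)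
next
  note C = multilinear_family_nonneg[OF a] multilinear_family_nonneg[OF b]
  let ?p = "\<lambda>vs. prod_list (map (\<lambda>v. norm v / r) vs)"
  fix vs assume vs: "set vs \<subseteq> S"
  have "norm (B (a (take i vs)) (b (drop i vs))) \<le> C * D * K * ?p vs" for i
  proof -
    have "set (take i vs) \<subseteq> S" "set (drop i vs) \<subseteq> S"
      using vs set_take_subset set_drop_subset by force+
    then have "norm (B (a (take i vs)) (b (drop i vs))) \<le> (C * ?p (take i vs)) * (D * ?p (drop i vs)) * K"
      using K C r prod_list_norm_nonneg[of r]
      by (intro order_trans[OF K(2)] mult_mono mult_nonneg_nonneg
          multilinear_family_bound[OF a] multilinear_family_bound[OF b]) auto
    also have "\<dots> = C * D * K * (?p (take i vs) * ?p (drop i vs))" by (simp add: algebra_simps)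
    also have "\<dots> = C * D * K * ?p vs" by (simp only: prod_list_take_drop)
    finally show ?thesis .
  qed
  then have "norm (\<Sum>i\<le>length vs. B (a (take i vs)) (b (drop i vs))) \<le> (\<Sum>i\<le>length vs. C * D * K * ?p vs)"
    by (intro sum_norm_le) auto
  also have "\<dots> = C * D * K * ?p vs * real (Suc (length vs))" by simp
  also have "\<dots> \<le> C * D * K * ?p vs * 2 ^ length vs"
    using C K(1) r by (intro mult_left_mono Suc_le_two_power mult_nonneg_nonneg prod_list_norm_nonneg) auto
  also have "\<dots> = C * D * K * prod_list (map (\<lambda>v. norm v / (r / 2)) vs)"
    using prod_list_norm_scale[of r "1/2" vs] r by (simp add: power_divide)
  finally show "norm (\<Sum>i\<le>length vs. B (a (take i vs)) (b (drop i vs)))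
      \<le> C * D * K * prod_list (map (\<lambda>v. norm v / (r / 2)) vs)" .
qed

lemma Cauchy_product_replicate:
  "(\<Sum>i\<le>length (replicate n h). B (a (take i (replicate n h))) (b (drop i (replicate n h)))) =
    (\<Sum>i\<le>n. B (a (replicate i h)) (b (replicate (n - i) h)))"
  by (rule sum.cong) (auto simp: min_def)

lemma analytic_at_bilinear:
  assumes B: "bounded_bilinear B" and f: "analytic_at S x f" and g: "analytic_at S x g"
  shows "analytic_at S x (\<lambda>u. B (f u) (g u))"
proof -
  obtain K where K: "K > 0" "\<And>x y. norm (B x y) \<le> norm x * norm y * K"
    using bounded_bilinear.pos_bounded[OF B] by blast
  obtain r C a where *: "r > 0" "0 \<le> C" "\<And>s. 0 < s \<Longrightarrow> s \<le> r \<Longrightarrow> multilinear_family S s C a"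
    "\<And>h. h \<in> S \<Longrightarrow> norm h < r \<Longrightarrow> (\<lambda>n. a (replicate n h)) sums f (x + h)"
    using analytic_at_shrunk[OF f] by blast
  obtain t D b where **: "t > 0" "0 \<le> D" "\<And>s. 0 < s \<Longrightarrow> s \<le> t \<Longrightarrow> multilinear_family S s D b"
    "\<And>h. h \<in> S \<Longrightarrow> norm h < t \<Longrightarrow> (\<lambda>n. b (replicate n h)) sums g (x + h)"
    using analytic_at_shrunk[OF g] by blast
  define s where "s = min r t"
  have ab: "multilinear_family S s C a" "multilinear_family S s D b" "s > 0"
    using * ** by (auto simp: s_def)
  show ?thesis
  proof (rule analytic_atI[OF _ multilinear_family_Cauchy_product[OF B K ab]])
    fix h assume h: "h \<in> S" "norm h < s / 2"
    show "(\<lambda>n. \<Sum>i\<le>length (replicate n h). B (a (take i (replicate n h))) (b (drop i (replicate n h))))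
        sums B (f (x + h)) (g (x + h))"
      unfolding Cauchy_product_replicate
    proof (rule bilinear_Cauchy_product_sums[OF B, of "norm h / s"])
      show "(\<lambda>n. a (replicate n h)) sums f (x + h)" "(\<lambda>n. b (replicate n h)) sums g (x + h)"
        using h * ** ab by (auto simp: s_def)
      show "norm (a (replicate n h)) \<le> C * (norm h / s) ^ n"
        "norm (b (replicate n h)) \<le> D * (norm h / s) ^ n" for n
        using h ab by (auto intro: multilinear_family_replicate_bound)
    qed (use h ab in auto)
  qed (use ab in auto)
qed

subsection \<open>Inverses\<close>

lemma replicate_zero_family:
  assumes "multilinear_family S r C a" "r > 0" "0 \<in> S" "n > 0"
  shows "a (replicate n 0) = 0"
  using multilinear_family_replicate_bound[OF assms(1,3), of n] assms(4) by (simp add: power_0_left)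

lemma family_Nil:
  assumes a: "multilinear_family S r C a" "r > 0" "0 \<in> S"
    and s: "\<And>h. h \<in> S \<Longrightarrow> norm h < r \<Longrightarrow> (\<lambda>n. a (replicate n h)) sums f (x + h)"
  shows "a [] = f x"
proof -
  have "(\<lambda>n. a (replicate n 0)) sums a []"
    using sums_replicate_Nil[of 1 a 0] replicate_zero_family[OF a] by simp
  moreover have "(\<lambda>n. a (replicate n 0)) sums f x"
    using s[OF a(3)] a(2) by simp
  ultimately show ?thesis by (rule sums_unique2)
qed

text \<open>
  The coefficients of the inverse series, obtained by solving the Cauchy product identity
  \<open>(\<Sum>i\<le>n. a\<^sub>i b\<^sub>n\<^sub>-\<^sub>i) = 0\<close> for \<open>b\<^sub>n\<close>, with \<open>c\<close> in the role of the inverse of the constant term of \<open>a\<close>.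
\<close>

fun inverse_family :: "('a list \<Rightarrow> 'b) \<Rightarrow> 'b \<Rightarrow> 'a list \<Rightarrow> 'b :: {ring, monoid_mult}"
  where
    "inverse_family a c [] = c"
  | "inverse_family a c (v # vs) =
      - (c * (\<Sum>i\<le>length vs. a (v # take i vs) * inverse_family a c (drop i vs)))"

lemma inverse_family_linear:
  fixes a :: "'a :: real_normed_vector list \<Rightarrow> 'b :: {real_normed_algebra, monoid_mult, banach}"
  assumes a: "multilinear_family S r C a"
    and S: "set us \<subseteq> S" "set ws \<subseteq> S" "x \<in> S" "y \<in> S"
  shows "inverse_family a c (us @ (\<alpha> *\<^sub>R x + \<beta> *\<^sub>R y) # ws) =
    \<alpha> *\<^sub>R inverse_family a c (us @ x # ws) + \<beta> *\<^sub>R inverse_family a c (us @ y # ws)"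
  using S
proof (induction "length us" arbitrary: us rule: less_induct)
  case less
  show ?case
  proof (cases us)
    case Nil
    have "a ((\<alpha> *\<^sub>R x + \<beta> *\<^sub>R y) # take i ws) = \<alpha> *\<^sub>R a (x # take i ws) + \<beta> *\<^sub>R a (y # take i ws)" for i
    proof -
      have "set (take i ws) \<subseteq> S" using less.prems set_take_subset by force
      then show ?thesis using multilinear_family_linear[OF a, of "[]" "take i ws" x y \<alpha> \<beta>] less.prems by simp
    qed
    then show ?thesis
      by (simp add: Nil algebra_simps sum.distrib scaleR_sum_right sum_distrib_left del: sum.atMost_Suc)
  next
    case (Cons v vs)
    let ?b = "inverse_family a c"
    let ?t = "\<lambda>z i. a (v # take i (vs @ z # ws)) * ?b (drop i (vs @ z # ws))"
    have "?t (\<alpha> *\<^sub>R x + \<beta> *\<^sub>R y) i = \<alpha> *\<^sub>R ?t x i + \<beta> *\<^sub>R ?t y i" for i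
    proof (cases "i \<le> length vs")
      case True
      have "set (drop i vs) \<subseteq> S" using less.prems Cons set_drop_subset by force
      then have "?b (drop i vs @ (\<alpha> *\<^sub>R x + \<beta> *\<^sub>R y) # ws) =
          \<alpha> *\<^sub>R ?b (drop i vs @ x # ws) + \<beta> *\<^sub>R ?b (drop i vs @ y # ws)"
        using less.prems Cons by (intro less.hyps) auto
      then show ?thesis using True by (simp add: algebra_simps)
    next
      case False
      then obtain j where i: "i = length vs + Suc j"
        by (metis add_Suc_right less_imp_Suc_add not_le)
      have "set (take j ws) \<subseteq> S" using less.prems set_take_subset by force
      then show ?thesis
        using less.prems Cons multilinear_family_linear[OF a, of "v # vs" "take j ws" x y \<alpha> \<beta>]
        by (simp add: i algebra_simps)
    qed
    then show ?thesis
      by (simp add: Cons algebra_simps sum.distrib scaleR_sum_right[symmetric] del: sum.atMost_Suc)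
  qed
qed

text \<open>
  With the radius scaled by \<open>q\<close>, the recursion bounds the new coefficient by a geometric sum, which the
  smallness condition on \<open>q\<close> keeps below \<open>1\<close>.
\<close>

lemma inverse_family_bound:
  fixes a :: "'a :: real_normed_vector list \<Rightarrow> 'b :: {real_normed_algebra, monoid_mult, banach}"
  assumes a: "multilinear_family S r C a" and r: "r > 0"
    and q: "0 < q" "q \<le> 1 / 2" "norm c * C * (2 * q) \<le> 1" and S: "set vs \<subseteq> S"
  shows "norm (inverse_family a c vs) \<le> norm c * prod_list (map (\<lambda>v. norm v / (q * r)) vs)"
  using S
proof (induction "length vs" arbitrary: vs rule: less_induct)
  case less
  note C = multilinear_family_nonneg[OF a]
  show ?case
  proof (cases vs)
    case (Cons v ws)
    let ?b = "inverse_family a c"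
    let ?p = "\<lambda>vs. prod_list (map (\<lambda>v. norm v / (q * r)) vs)"
    have p0: "0 \<le> ?p us" for us using q r by (intro prod_list_norm_nonneg) auto
    have 1: "norm (a (v # take i ws) * ?b (drop i ws)) \<le> norm c * C * ?p (v # ws) * q ^ Suc i"
      if i: "i \<le> length ws" for i
    proof -
      have sub: "set (v # take i ws) \<subseteq> S" "set (drop i ws) \<subseteq> S"
        using less.prems Cons set_drop_subset[of i ws] set_take_subset[of i ws] by auto
      have "norm (a (v # take i ws)) \<le> C * prod_list (map (\<lambda>v. norm v / r) (v # take i ws))"
        by (rule multilinear_family_bound[OF a sub(1)])
      also have "\<dots> = C * (?p (v # take i ws) * q ^ Suc i)"
        using prod_list_norm_scale[OF r q(1), of "v # take i ws"] i q by (simp add: min_def field_simps)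
      finally have "norm (a (v # take i ws)) \<le> C * (?p (v # take i ws) * q ^ Suc i)" .
      moreover have "norm (?b (drop i ws)) \<le> norm c * ?p (drop i ws)"
        using sub Cons by (intro less.hyps) auto
      ultimately have "norm (a (v # take i ws) * ?b (drop i ws)) \<le>
          C * (?p (v # take i ws) * q ^ Suc i) * (norm c * ?p (drop i ws))"
        using p0[of "v # take i ws"] p0[of "drop i ws"] q C
        by (intro order_trans[OF norm_mult_ineq] mult_mono mult_nonneg_nonneg) (auto simp del: list.map)
      also have "\<dots> = norm c * C * (norm v / (q * r) * (?p (take i ws) * ?p (drop i ws))) * q ^ Suc i"
        by (simp add: algebra_simps)
      finally show ?thesis by (simp only: prod_list_take_drop list.map prod_list.Cons)
    qed
    have geo: "(\<Sum>i\<le>n. q ^ Suc i) \<le> 2 * q" for n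
    proof -
      have "(\<Sum>i\<le>n. q ^ Suc i) = q * (\<Sum>i<Suc n. q ^ i)"
        by (simp add: sum_distrib_left lessThan_Suc_atMost del: sum.lessThan_Suc)
      also have "(\<Sum>i<Suc n. q ^ i) = (1 - q ^ Suc n) / (1 - q)"
        using q by (subst sum_gp_strict) auto
      also have "\<dots> \<le> 1 / (1 / 2)"
        using q by (intro frac_le) auto
      finally show ?thesis using q by (simp add: mult.commute)
    qed
    have "norm (?b vs) \<le> norm c * norm (\<Sum>i\<le>length ws. a (v # take i ws) * ?b (drop i ws))"
      unfolding Cons by (simp add: norm_mult_ineq)
    also have "\<dots> \<le> norm c * (\<Sum>i\<le>length ws. norm c * C * ?p (v # ws) * q ^ Suc i)"
      using 1 by (intro mult_left_mono sum_norm_le) auto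
    also have "\<dots> = norm c * (norm c * C * ?p (v # ws) * (\<Sum>i\<le>length ws. q ^ Suc i))"
      by (simp only: sum_distrib_left)
    also have "\<dots> \<le> norm c * (norm c * C * ?p (v # ws) * (2 * q))"
      using geo p0[of "v # ws"] C by (intro mult_left_mono mult_nonneg_nonneg) (auto simp del: list.map)
    also have "\<dots> = norm c * ((norm c * C * (2 * q)) * ?p (v # ws))" by (simp only: ac_simps)
    also have "\<dots> \<le> norm c * (1 * ?p (v # ws))"
      using q(3) p0[of "v # ws"] by (intro mult_left_mono mult_right_mono) (auto simp del: list.map)
    finally show ?thesis by (simp add: Cons)
  qed simp
qed

text \<open>
  The inverse series converges on a small ball, and its Cauchy product with the series of \<open>f\<close> is \<open>1\<close>
  by construction; uniqueness of inverses identifies its sum with \<open>g\<close>.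
\<close>

lemma analytic_at_ring_inverse:
  fixes f g :: "'a :: real_normed_vector \<Rightarrow> 'b :: {real_normed_algebra, monoid_mult, banach}"
  assumes f: "analytic_at S x f" and S: "0 \<in> S" and e: "e > 0"
    and inv: "\<And>h. h \<in> S \<Longrightarrow> norm h < e \<Longrightarrow> f (x + h) * g (x + h) = 1 \<and> g (x + h) * f (x + h) = 1"
  shows "analytic_at S x g"
proof -
  obtain r C a where *: "r > 0" "0 \<le> C" "\<And>s. 0 < s \<Longrightarrow> s \<le> r \<Longrightarrow> multilinear_family S s C a"
    "\<And>h. h \<in> S \<Longrightarrow> norm h < r \<Longrightarrow> (\<lambda>n. a (replicate n h)) sums f (x + h)"
    using analytic_at_shrunk[OF f] by blast
  have a: "multilinear_family S r C a" using * by simp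
  have a0: "a [] = f x" using family_Nil[OF a *(1) S *(4)] .
  define q where "q = 1 / (2 * (1 + norm (g x) * C))"
  have G: "0 \<le> norm (g x) * C" using *(2) by simp
  have q: "0 < q" "q \<le> 1 / 2" "norm (g x) * C * (2 * q) \<le> 1"
    using G by (auto simp: q_def field_simps)
  define s where "s = q * r"
  have s: "0 < s" "s \<le> r" using q *(1) by (auto simp: s_def)
  define b where "b = inverse_family a (g x)"
  have b: "multilinear_family S s (norm (g x)) b"
    unfolding b_def s_def
    by (rule multilinear_familyI)
      (assumption | rule inverse_family_linear[OF a] inverse_family_bound[OF a *(1) q])+
  have as: "multilinear_family S s C a" using * s by simp
  show ?thesis
  proof (rule analytic_atI)
    show "0 < min s e" using s e by simp
    show "multilinear_family S (min s e) (norm (g x)) b"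
      using s e by (intro multilinear_family_shrink[OF b]) auto
    fix h assume h: "h \<in> S" "norm h < min s e"
    have hq: "0 \<le> norm h / s" "norm h / s < 1" using h s by auto
    have "summable (\<lambda>n. b (replicate n h))"
      by (rule summable_comparison_test'[OF summable_mult[OF summable_geometric[of "norm h / s"]],
            of 0 _ "norm (g x)"])
        (use hq multilinear_family_replicate_bound[OF b h(1)] in auto)
    then obtain B where B: "(\<lambda>n. b (replicate n h)) sums B" by (auto simp: summable_def)
    have sums: "(\<lambda>n. \<Sum>i\<le>n. a (replicate i h) * b (replicate (n - i) h)) sums (f (x + h) * B)"
      by (rule bilinear_Cauchy_product_sums[OF bounded_bilinear_mult hq _ _ B])
        (use h s *(4) multilinear_family_replicate_bound[OF as h(1)]
          multilinear_family_replicate_bound[OF b h(1)] in auto)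
    have "(\<Sum>i\<le>Suc m. a (replicate i h) * b (replicate (Suc m - i) h)) = 0" for m
    proof -
      have "(\<Sum>i\<le>Suc m. a (replicate i h) * b (replicate (Suc m - i) h)) =
        f x * b (replicate (Suc m) h) + (\<Sum>i\<le>m. a (replicate (Suc i) h) * b (replicate (m - i) h))"
        by (subst sum.atMost_Suc_shift) (simp add: a0)
      also have "b (replicate (Suc m) h) =
        - (g x * (\<Sum>i\<le>m. a (replicate (Suc i) h) * b (replicate (m - i) h)))"
        unfolding b_def
        by (simp add: min_def)
      also have "f x * (- (g x * (\<Sum>i\<le>m. a (replicate (Suc i) h) * b (replicate (m - i) h)))) =
        - ((f x * g x) * (\<Sum>i\<le>m. a (replicate (Suc i) h) * b (replicate (m - i) h)))"
        by (simp add: mult.assoc)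
      finally show ?thesis using inv[OF S] e by simp
    qed
    then have "(\<lambda>n. \<Sum>i\<le>n. a (replicate i h) * b (replicate (n - i) h)) sums
        (\<Sum>n<1. \<Sum>i\<le>n. a (replicate i h) * b (replicate (n - i) h))"
      by (intro sums_finite) (auto simp: gr0_conv_Suc simp del: sum.atMost_Suc)
    then have "(\<lambda>n. \<Sum>i\<le>n. a (replicate i h) * b (replicate (n - i) h)) sums 1"
      using inv[OF S] e by (simp add: a0 b_def)
    with sums have fB: "f (x + h) * B = 1" by (rule sums_unique2)
    have "B = (g (x + h) * f (x + h)) * B" using inv[OF h(1)] h by simp
    also have "\<dots> = g (x + h)" by (simp add: fB mult.assoc)
    finally show "(\<lambda>n. b (replicate n h)) sums g (x + h)" using B by simp
  qed
qed

subsection \<open>First and second order estimates\<close>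

text \<open>
  The formal directional derivative: for \<open>a\<close> the sum of a power series, \<open>insertion a v\<close> is the family of
  its derivative in direction \<open>v\<close>.
\<close>

definition insertion :: "('a list \<Rightarrow> 'b :: comm_monoid_add) \<Rightarrow> 'a \<Rightarrow> 'a list \<Rightarrow> 'b"
  where "insertion a v vs = (\<Sum>i\<le>length vs. a (take i vs @ v # drop i vs))"

lemma multilinear_family_insertion:
  assumes a: "multilinear_family S r C a" and r: "r > 0" and v: "v \<in> S"
  shows "multilinear_family S (r / 2) (C * norm v / r) (insertion a v)"
proof (rule multilinear_familyI)
  fix us ws x y \<alpha> \<beta>
  assume S: "set us \<subseteq> S" "set ws \<subseteq> S" "x \<in> S" "y \<in> S"
  let ?t = "\<lambda>z i. a (take i (us @ z # ws) @ v # drop i (us @ z # ws))"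
  have "?t (\<alpha> *\<^sub>R x + \<beta> *\<^sub>R y) i = \<alpha> *\<^sub>R ?t x i + \<beta> *\<^sub>R ?t y i" for i
  proof (cases "i \<le> length us")
    case True
    have "set (take i us @ v # drop i us) \<subseteq> S"
      using S v set_drop_subset[of i us] set_take_subset[of i us] by auto
    then show ?thesis
      using True S multilinear_family_linear[OF a, of "take i us @ v # drop i us" ws x y \<alpha> \<beta>] by simp
  next
    case False
    then obtain j where i: "i = length us + Suc j"
      by (metis add_Suc_right less_imp_Suc_add not_le)
    have "set (take j ws @ v # drop j ws) \<subseteq> S"
      using S v set_drop_subset[of j ws] set_take_subset[of j ws] by auto
    then show ?thesis
      using S multilinear_family_linear[OF a, of us "take j ws @ v # drop j ws" x y \<alpha> \<beta>] by (simp add: i)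
  qed
  then show "insertion a v (us @ (\<alpha> *\<^sub>R x + \<beta> *\<^sub>R y) # ws) =
    \<alpha> *\<^sub>R insertion a v (us @ x # ws) + \<beta> *\<^sub>R insertion a v (us @ y # ws)"
    by (simp add: insertion_def scaleR_sum_right sum.distrib del: sum.atMost_Suc)
next
  let ?p = "\<lambda>vs. prod_list (map (\<lambda>v. norm v / r) vs)"
  fix vs assume vs: "set vs \<subseteq> S"
  have "norm (a (take i vs @ v # drop i vs)) \<le> C * norm v / r * ?p vs" for i
  proof -
    have "set (take i vs @ v # drop i vs) \<subseteq> S"
      using vs v set_drop_subset[of i vs] set_take_subset[of i vs] by auto
    then have "norm (a (take i vs @ v # drop i vs)) \<le> C * ?p (take i vs @ v # drop i vs)"
      by (rule multilinear_family_bound[OF a])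
    also have "\<dots> = C * norm v / r * (?p (take i vs) * ?p (drop i vs))"
      by (simp add: algebra_simps)
    finally show ?thesis by (simp only: prod_list_take_drop)
  qed
  then have "norm (insertion a v vs) \<le> (\<Sum>i\<le>length vs. C * norm v / r * ?p vs)"
    unfolding insertion_def by (intro sum_norm_le) auto
  also have "\<dots> = C * norm v / r * ?p vs * real (Suc (length vs))" by simp
  also have "\<dots> \<le> C * norm v / r * ?p vs * 2 ^ length vs"
    using multilinear_family_nonneg[OF a] r
    by (intro mult_left_mono Suc_le_two_power mult_nonneg_nonneg divide_nonneg_nonneg prod_list_norm_nonneg) auto
  also have "\<dots> = C * norm v / r * prod_list (map (\<lambda>v. norm v / (r / 2)) vs)"
    using prod_list_norm_scale[of r "1/2" vs] r by (simp add: power_divide)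
  finally show "norm (insertion a v vs) \<le> C * norm v / r * prod_list (map (\<lambda>v. norm v / (r / 2)) vs)" .
qed

lemma multilinear_family_add:
  assumes "multilinear_family S r C a" "set us \<subseteq> S" "set ws \<subseteq> S" "x \<in> S" "y \<in> S"
  shows "a (us @ (x + y) # ws) = a (us @ x # ws) + a (us @ y # ws)"
  using multilinear_family_linear[OF assms, of 1 1] by simp

context
  fixes S :: "'a :: real_normed_vector set" and a :: "'a list \<Rightarrow> 'b :: real_normed_vector"
    and r C q :: real and u h :: 'a
  assumes a: "multilinear_family S r C a" and r: "r > 0" and q: "q > 0"
    and S: "u \<in> S" "h \<in> S" "u + h \<in> S"
    and small: "norm u \<le> q * r" "norm (u + h) \<le> q * r"
begin

text \<open>
  The prefix \<open>us\<close> is carried along for the induction: replacing the entries \<open>u + h\<close> by \<open>u\<close> one after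
  the other moves the entries already replaced into the prefix.
\<close>

lemma power_first_order:
  assumes us: "set us \<subseteq> S"
  shows "norm (a (us @ replicate n (u + h)) - a (us @ replicate n u)) \<le>
    C * prod_list (map (\<lambda>v. norm v / r) us) * (real n * (norm h / r) * q ^ n / q)"
  using us
proof (induction n arbitrary: us)
  case (Suc n)
  let ?p = "\<lambda>vs. prod_list (map (\<lambda>v. norm v / r) vs)"
  have C: "0 \<le> C" by (rule multilinear_family_nonneg[OF a])
  have rep: "set (replicate n (u + h)) \<subseteq> S" using S by (induction n) auto
  have p0: "0 \<le> ?p us" using prod_list_norm_nonneg[OF r] .
  have e: "a (us @ replicate (Suc n) (u + h)) - a (us @ replicate (Suc n) u) =
    a (us @ h # replicate n (u + h)) + (a ((us @ [u]) @ replicate n (u + h)) - a ((us @ [u]) @ replicate n u))"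
    using multilinear_family_add[OF a Suc.prems rep S(1,2)] by simp
  have 1: "norm (a (us @ h # replicate n (u + h))) \<le> C * ?p us * ((norm h / r) * q ^ n)"
  proof -
    have "norm (a (us @ h # replicate n (u + h))) \<le> C * ?p (us @ h # replicate n (u + h))"
      using Suc.prems S rep by (intro multilinear_family_bound[OF a]) auto
    also have "\<dots> = C * ?p us * (norm h / r) * (norm (u + h) / r) ^ n"
      by (simp add: prod_list_replicate)
    also have "\<dots> \<le> C * ?p us * (norm h / r) * q ^ n"
      using C p0 r small by (intro mult_left_mono power_mono) (auto simp: field_simps)
    finally show ?thesis by (simp add: mult.assoc)
  qed
  have "norm (a ((us @ [u]) @ replicate n (u + h)) - a ((us @ [u]) @ replicate n u)) \<le>
    C * ?p (us @ [u]) * (real n * (norm h / r) * q ^ n / q)"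
    using Suc.prems S by (intro Suc.IH) auto
  also have "\<dots> = C * ?p us * (norm u / r * (real n * (norm h / r) * q ^ n / q))" by simp
  also have "\<dots> \<le> C * ?p us * (q * (real n * (norm h / r) * q ^ n / q))"
    using C p0 r q small by (intro mult_left_mono mult_right_mono) (auto simp: field_simps)
  finally have 2: "norm (a ((us @ [u]) @ replicate n (u + h)) - a ((us @ [u]) @ replicate n u)) \<le>
    C * ?p us * (q * (real n * (norm h / r) * q ^ n / q))" .
  have "norm (a (us @ replicate (Suc n) (u + h)) - a (us @ replicate (Suc n) u)) \<le>
    C * ?p us * ((norm h / r) * q ^ n) + C * ?p us * (q * (real n * (norm h / r) * q ^ n / q))"
    unfolding e using 1 2 by (rule norm_triangle_mono)
  also have "\<dots> = C * ?p us * ((norm h / r) * q ^ n + q * (real n * (norm h / r) * q ^ n / q))"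
    by (simp only: distrib_left)
  also have "(norm h / r) * q ^ n + q * (real n * (norm h / r) * q ^ n / q) =
      real (Suc n) * (norm h / r) * q ^ Suc n / q"
    using q r by (simp add: field_simps)
  finally show ?case .
qed simp

text \<open>
  The same telescoping as in \<open>power_first_order\<close>. In the summand where \<open>h\<close> was split off, the first
  order estimate applies once more, which produces the second factor \<open>norm h\<close>.
\<close>

lemma power_second_order:
  assumes us: "set us \<subseteq> S"
  shows "norm (a (us @ replicate n (u + h)) - a (us @ replicate n u) -
      (\<Sum>i<n. a (us @ replicate i u @ h # replicate (n - 1 - i) u))) \<le>
    C * prod_list (map (\<lambda>v. norm v / r) us) * ((real n)\<^sup>2 * (norm h / r)\<^sup>2 * q ^ n / q\<^sup>2)"
  using us
proof (induction n arbitrary: us)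
  case (Suc n)
  let ?p = "\<lambda>vs. prod_list (map (\<lambda>v. norm v / r) vs)"
  let ?s = "\<lambda>us n. \<Sum>i<n. a (us @ replicate i u @ h # replicate (n - 1 - i) u)"
  have C: "0 \<le> C" by (rule multilinear_family_nonneg[OF a])
  have rep: "set (replicate n (u + h)) \<subseteq> S" using S by (induction n) auto
  have p0: "0 \<le> ?p us" using prod_list_norm_nonneg[OF r] .
  have s: "?s us (Suc n) = a (us @ h # replicate n u) + ?s (us @ [u]) n"
    by (subst sum.lessThan_Suc_shift) simp
  have e: "a (us @ replicate (Suc n) (u + h)) - a (us @ replicate (Suc n) u) - ?s us (Suc n) =
    (a ((us @ [h]) @ replicate n (u + h)) - a ((us @ [h]) @ replicate n u)) +
    (a ((us @ [u]) @ replicate n (u + h)) - a ((us @ [u]) @ replicate n u) - ?s (us @ [u]) n)"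
    using multilinear_family_add[OF a Suc.prems rep S(1,2)] unfolding s by simp
  have "norm (a ((us @ [h]) @ replicate n (u + h)) - a ((us @ [h]) @ replicate n u)) \<le>
    C * ?p (us @ [h]) * (real n * (norm h / r) * q ^ n / q)"
    using Suc.prems S by (intro power_first_order) auto
  then have 1: "norm (a ((us @ [h]) @ replicate n (u + h)) - a ((us @ [h]) @ replicate n u)) \<le>
    C * ?p us * (real n * (norm h / r)\<^sup>2 * q ^ n / q)"
    by (simp add: power2_eq_square algebra_simps)
  have "norm (a ((us @ [u]) @ replicate n (u + h)) - a ((us @ [u]) @ replicate n u) - ?s (us @ [u]) n) \<le>
    C * ?p (us @ [u]) * ((real n)\<^sup>2 * (norm h / r)\<^sup>2 * q ^ n / q\<^sup>2)"
    using Suc.prems S by (intro Suc.IH) auto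
  also have "\<dots> = C * ?p us * (norm u / r * ((real n)\<^sup>2 * (norm h / r)\<^sup>2 * q ^ n / q\<^sup>2))" by simp
  also have "\<dots> \<le> C * ?p us * (q * ((real n)\<^sup>2 * (norm h / r)\<^sup>2 * q ^ n / q\<^sup>2))"
    using C p0 r q small by (intro mult_left_mono mult_right_mono) (auto simp: field_simps)
  finally have 2: "norm (a ((us @ [u]) @ replicate n (u + h)) - a ((us @ [u]) @ replicate n u) - ?s (us @ [u]) n)
    \<le> C * ?p us * (q * ((real n)\<^sup>2 * (norm h / r)\<^sup>2 * q ^ n / q\<^sup>2))" .
  have "norm (a (us @ replicate (Suc n) (u + h)) - a (us @ replicate (Suc n) u) - ?s us (Suc n)) \<le>
    C * ?p us * (real n * (norm h / r)\<^sup>2 * q ^ n / q) +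
    C * ?p us * (q * ((real n)\<^sup>2 * (norm h / r)\<^sup>2 * q ^ n / q\<^sup>2))"
    unfolding e using 1 2 by (rule norm_triangle_mono)
  also have "\<dots> = C * ?p us * (real n * (norm h / r)\<^sup>2 * q ^ n / q +
      q * ((real n)\<^sup>2 * (norm h / r)\<^sup>2 * q ^ n / q\<^sup>2))"
    by (simp only: distrib_left)
  also have "real n * (norm h / r)\<^sup>2 * q ^ n / q + q * ((real n)\<^sup>2 * (norm h / r)\<^sup>2 * q ^ n / q\<^sup>2) =
      (real n + (real n)\<^sup>2) * (norm h / r)\<^sup>2 * q ^ Suc n / q\<^sup>2"
    using q by (simp add: distrib_right add_divide_distrib power2_eq_square)
  also have "C * ?p us * ((real n + (real n)\<^sup>2) * (norm h / r)\<^sup>2 * q ^ Suc n / q\<^sup>2) \<le>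
      C * ?p us * ((real (Suc n))\<^sup>2 * (norm h / r)\<^sup>2 * q ^ Suc n / q\<^sup>2)"
    using C p0 q by (intro mult_left_mono divide_right_mono mult_right_mono)
      (auto simp: power2_eq_square algebra_simps)
  finally show ?case .
qed simp

end

lemma insertion_replicate:
  "insertion a h (replicate n u) = (\<Sum>i<Suc n. a (replicate i u @ h # replicate (Suc n - 1 - i) u))"
  unfolding insertion_def lessThan_Suc_atMost by (intro sum.cong) (auto simp: min_def)

lemma sum_geometric_half: "(\<lambda>n. c * (1 / 2) ^ n) sums (2 * c :: real)"
  using sums_mult[OF geometric_sums[of "1 / 2 :: real"], of c] by (simp add: mult.commute)

text \<open>
  On the ball of radius \<open>r / 8\<close> the second order estimates sum to a geometric series of ratio \<open>1 / 2\<close>,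
  so the remainder is quadratic in \<open>h\<close>, with a constant proportional to the bound \<open>C\<close> of the family.
  This proportionality makes the estimate uniform over unit directions when it is applied to iterated
  insertions.
\<close>

lemma power_series_derivative:
  fixes a :: "'a :: real_normed_vector list \<Rightarrow> 'b :: banach"
  assumes a: "multilinear_family S r C a" and r: "r > 0"
    and S: "u \<in> S" "h \<in> S" "u + h \<in> S" and small: "norm u \<le> r / 8" "norm (u + h) \<le> r / 8"
    and g: "(\<lambda>n. a (replicate n u)) sums g" "(\<lambda>n. a (replicate n (u + h))) sums g'"
  shows "\<exists>d. (\<lambda>n. insertion a h (replicate n u)) sums d \<and> norm (g' - g - d) \<le> 128 * C * (norm h / r)\<^sup>2"
proof -
  have C: "0 \<le> C" by (rule multilinear_family_nonneg[OF a])
  let ?b = "\<lambda>n. insertion a h (replicate n u)"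
  have b: "multilinear_family S (r / 2) (C * norm h / r) (insertion a h)"
    by (rule multilinear_family_insertion[OF a r S(2)])
  have "summable ?b"
  proof (rule summable_comparison_test')
    show "summable (\<lambda>n. (C * norm h / r) * (1 / 2) ^ n)"
      by (intro summable_mult summable_geometric) auto
    show "norm (?b n) \<le> (C * norm h / r) * (1 / 2) ^ n" for n
    proof -
      have "norm u / (r / 2) \<le> 1 / 2" using small r by (simp add: field_simps)
      then have "(norm u / (r / 2)) ^ n \<le> (1 / 2) ^ n" using r by (intro power_mono) auto
      then have "(C * norm h / r) * (norm u / (r / 2)) ^ n \<le> (C * norm h / r) * (1 / 2) ^ n"
        using C r by (intro mult_left_mono) auto
      then show ?thesis
        using multilinear_family_replicate_bound[OF b S(1), of n] by linarith
    qed
  qed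
  then obtain d where d: "?b sums d" by (auto simp: summable_def)
  let ?s = "\<lambda>n. \<Sum>i<n. a (replicate i u @ h # replicate (n - 1 - i) u)"
  have "?s sums d"
    using d sums_Suc_iff[of ?s d] by (simp only: insertion_replicate) simp
  then have sums: "(\<lambda>n. a (replicate n (u + h)) - a (replicate n u) - ?s n) sums (g' - g - d)"
    using g by (intro sums_diff)
  have "norm (g' - g - d) \<le> 2 * (C * 64 * (norm h / r)\<^sup>2)"
  proof (rule norm_sums_le[OF sums sum_geometric_half])
    fix n
    have n: "(real n)\<^sup>2 \<le> 4 ^ n"
    proof -
      have "real n \<le> 2 ^ n" using Suc_le_two_power[of n] by simp
      then have "(real n)\<^sup>2 \<le> (2 ^ n)\<^sup>2" by (intro power_mono) auto
      also have "(2 ^ n)\<^sup>2 = (4 :: real) ^ n" by (simp add: power2_eq_square flip: power_mult_distrib)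
      finally show ?thesis .
    qed
    have "norm (a (replicate n (u + h)) - a (replicate n u) - ?s n) \<le>
      C * ((real n)\<^sup>2 * (norm h / r)\<^sup>2 * (1 / 8) ^ n / (1 / 8)\<^sup>2)"
      using power_second_order[OF a r, of "1 / 8" u h "[]" n] S small by simp
    also have "\<dots> \<le> C * (4 ^ n * (norm h / r)\<^sup>2 * (1 / 8) ^ n / (1 / 8)\<^sup>2)"
      using C n by (intro mult_left_mono divide_right_mono mult_right_mono) auto
    also have "\<dots> = C * 64 * (norm h / r)\<^sup>2 * (4 ^ n * (1 / 8) ^ n)"
      by (simp add: power2_eq_square)
    also have "4 ^ n * (1 / 8) ^ n = (1 / 2 :: real) ^ n"
      by (simp flip: power_mult_distrib)
    finally show "norm (a (replicate n (u + h)) - a (replicate n u) - ?s n) \<le>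
      C * 64 * (norm h / r)\<^sup>2 * (1 / 2) ^ n" .
  qed
  with d show ?thesis by (intro exI[of _ d]) simp
qed

lemma multilinear_family_summable:
  fixes a :: "'a :: real_normed_vector list \<Rightarrow> 'b :: banach"
  assumes a: "multilinear_family S r C a" and r: "r > 0" and u: "u \<in> S" "norm u < r"
  shows "summable (\<lambda>n. a (replicate n u))"
proof (rule summable_comparison_test')
  show "summable (\<lambda>n. C * (norm u / r) ^ n)"
    using u r by (intro summable_mult summable_geometric) auto
  show "norm (a (replicate n u)) \<le> C * (norm u / r) ^ n" if "n \<ge> 0" for n
    using multilinear_family_replicate_bound[OF a u(1)] .
qed

lemma sums_family_zero:
  assumes a: "multilinear_family S r C a" "r > 0" "0 \<in> S"
  shows "(\<lambda>n. a (replicate n 0)) sums a []"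
  using sums_replicate_Nil[of 1 a 0] replicate_zero_family[OF a] by simp

lemma power_series_derivative_zero:
  fixes a :: "'a :: real_normed_vector list \<Rightarrow> 'b :: banach"
  assumes a: "multilinear_family S r C a" and r: "r > 0" and S: "subspace S" "h \<in> S"
    and small: "norm h \<le> r / 8" and g: "(\<lambda>n. a (replicate n h)) sums g"
  shows "norm (g - a [] - a [h]) \<le> 128 * C * (norm h / r)\<^sup>2"
proof -
  have 0: "0 \<in> S" using S(1) by (rule subspace_0)
  obtain d where d: "(\<lambda>n. insertion a h (replicate n 0)) sums d" "norm (g - a [] - d) \<le> 128 * C * (norm h / r)\<^sup>2"
    using power_series_derivative[OF a r 0 S(2) _ _ _ sums_family_zero[OF a r 0], of g] S small g r by auto
  have "(\<lambda>n. insertion a h (replicate n 0)) sums insertion a h []"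
    by (rule sums_family_zero[OF multilinear_family_insertion[OF a r S(2)]]) (use r 0 in auto)
  with d(1) have "d = insertion a h []" by (rule sums_unique2)
  with d(2) show ?thesis by (simp add: insertion_def)
qed

lemma analytic_at_first_order:
  fixes f :: "'a :: real_normed_vector \<Rightarrow> 'b :: banach"
  assumes f: "analytic_at S x f" and S: "subspace S"
  obtains L K e where "e > 0" "K \<ge> 0"
    "\<And>\<alpha> \<beta> u v. u \<in> S \<Longrightarrow> v \<in> S \<Longrightarrow> L (\<alpha> *\<^sub>R u + \<beta> *\<^sub>R v) = \<alpha> *\<^sub>R L u + \<beta> *\<^sub>R L v"
    "\<And>h. h \<in> S \<Longrightarrow> norm (L h) \<le> K * norm h"
    "\<And>h. h \<in> S \<Longrightarrow> norm h < e \<Longrightarrow> norm (f (x + h) - f x - L h) \<le> K * (norm h)\<^sup>2"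
proof -
  obtain r C a where *: "r > 0" "0 \<le> C" "\<And>s. 0 < s \<Longrightarrow> s \<le> r \<Longrightarrow> multilinear_family S s C a"
    "\<And>h. h \<in> S \<Longrightarrow> norm h < r \<Longrightarrow> (\<lambda>n. a (replicate n h)) sums f (x + h)"
    using analytic_at_shrunk[OF f] by blast
  have a: "multilinear_family S r C a" using * by simp
  have a0: "a [] = f x" using family_Nil[OF a *(1) subspace_0[OF S] *(4)] .
  let ?K = "max (C / r) (128 * C / r\<^sup>2)"
  show ?thesis
  proof (rule that[of "r / 8" ?K "\<lambda>h. a [h]"])
    show "?K \<ge> 0" "r / 8 > 0" using * by (auto simp: le_max_iff_disj)
    show "a [\<alpha> *\<^sub>R u + \<beta> *\<^sub>R v] = \<alpha> *\<^sub>R a [u] + \<beta> *\<^sub>R a [v]" if "u \<in> S" "v \<in> S" for u v \<alpha> \<beta>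
      using multilinear_family_linear[OF a, of "[]" "[]"] that by simp
    show "norm (a [h]) \<le> ?K * norm h" if "h \<in> S" for h
    proof -
      have "norm (a [h]) \<le> C / r * norm h"
        using multilinear_family_bound[OF a, of "[h]"] that by simp
      also have "\<dots> \<le> ?K * norm h" by (intro mult_right_mono) auto
      finally show ?thesis .
    qed
    show "norm (f (x + h) - f x - a [h]) \<le> ?K * (norm h)\<^sup>2" if h: "h \<in> S" "norm h < r / 8" for h
    proof -
      have "norm (f (x + h) - f x - a [h]) \<le> 128 * C * (norm h / r)\<^sup>2"
        using power_series_derivative_zero[OF a *(1) S h(1) _ *(4)[OF h(1)]] h *(1) a0 by simp
      also have "\<dots> = 128 * C / r\<^sup>2 * (norm h)\<^sup>2" by (simp add: power_divide)
      also have "\<dots> \<le> ?K * (norm h)\<^sup>2" by (intro mult_right_mono) auto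
      finally show ?thesis .
    qed
  qed
qed

lemma analytic_at_tendsto:
  fixes f :: "'a :: real_normed_vector \<Rightarrow> 'b :: banach"
  assumes f: "analytic_at S x f" and S: "subspace S"
  shows "((\<lambda>h. f (x + h)) \<longlongrightarrow> f x) (at 0 within S)"
proof -
  obtain L K e where *: "e > 0" "K \<ge> 0" "\<And>h. h \<in> S \<Longrightarrow> norm (L h) \<le> K * norm h"
    "\<And>h. h \<in> S \<Longrightarrow> norm h < e \<Longrightarrow> norm (f (x + h) - f x - L h) \<le> K * (norm h)\<^sup>2"
    using analytic_at_first_order[OF f S] by metis
  have "((\<lambda>h. f (x + h) - f x) \<longlongrightarrow> 0) (at 0 within S)"
  proof (rule Lim_null_comparison)
    show "\<forall>\<^sub>F h in at 0 within S. norm (f (x + h) - f x) \<le> K * (norm h)\<^sup>2 + K * norm h"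
      unfolding eventually_at
    proof (intro exI[of _ e] conjI ballI impI)
      fix h assume h: "h \<in> S" "h \<noteq> 0 \<and> dist h 0 < e"
      have "norm (f (x + h) - f x) \<le> norm (f (x + h) - f x - L h) + norm (L h)"
        using norm_triangle_ineq[of "f (x + h) - f x - L h" "L h"] by simp
      with h *(3)[of h] *(4)[of h] show "norm (f (x + h) - f x) \<le> K * (norm h)\<^sup>2 + K * norm h"
        by simp
    qed (use * in auto)
    show "((\<lambda>h. K * (norm h)\<^sup>2 + K * norm h) \<longlongrightarrow> 0) (at 0 within S)"
      by (rule tendsto_eq_intros | simp)+
  qed
  then show ?thesis by (rule LIM_zero_cancel)
qed

lemma analytic_at_eventually:
  fixes f :: "'a :: real_normed_vector \<Rightarrow> 'b :: banach"
  assumes f: "analytic_at S x f" and S: "subspace S" and T: "open T" "f x \<in> T"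
  obtains e where "e > 0" "\<And>h. h \<in> S \<Longrightarrow> norm h < e \<Longrightarrow> f (x + h) \<in> T"
proof -
  have "\<forall>\<^sub>F h in at 0 within S. f (x + h) \<in> T"
    using topological_tendstoD[OF analytic_at_tendsto[OF f S] T] .
  then obtain e where "e > 0" "\<forall>h\<in>S. h \<noteq> 0 \<and> dist h 0 < e \<longrightarrow> f (x + h) \<in> T"
    unfolding eventually_at by blast
  with T(2) show ?thesis by (intro that[of e]) (metis add.right_neutral dist_0_norm dist_commute)+
qed

lemma analytic_at_isCont:
  fixes f :: "'a :: real_normed_vector \<Rightarrow> 'b :: banach"
  assumes "analytic_at UNIV x f"
  shows "isCont f x"
  using analytic_at_tendsto[OF assms subspace_UNIV] by (simp add: isCont_iff)

text \<open>
  The linear term of the series is defined on \<open>S\<close> only; composing it with a bounded projection onto \<open>S\<close>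
  gives a bounded linear map on the whole space.
\<close>

lemma analytic_at_has_derivative:
  fixes f :: "'a :: real_normed_vector \<Rightarrow> 'b :: banach"
  assumes f: "analytic_at S x f" and S: "subspace S" "x \<in> S"
    and p: "bounded_linear p" "\<And>u. p u \<in> S" "\<And>u. u \<in> S \<Longrightarrow> p u = u"
  shows "\<exists>L. (f has_derivative L) (at x within S)"
proof -
  interpret p: bounded_linear p by fact
  obtain L K e where *: "e > 0" "K \<ge> 0"
    "\<And>\<alpha> \<beta> u v. u \<in> S \<Longrightarrow> v \<in> S \<Longrightarrow> L (\<alpha> *\<^sub>R u + \<beta> *\<^sub>R v) = \<alpha> *\<^sub>R L u + \<beta> *\<^sub>R L v"
    "\<And>h. h \<in> S \<Longrightarrow> norm (L h) \<le> K * norm h"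
    "\<And>h. h \<in> S \<Longrightarrow> norm h < e \<Longrightarrow> norm (f (x + h) - f x - L h) \<le> K * (norm h)\<^sup>2"
    using analytic_at_first_order[OF f S(1)] by metis
  obtain M where M: "M > 0" "\<And>u. norm (p u) \<le> norm u * M" using p.pos_bounded by blast
  have "bounded_linear (\<lambda>u. L (p u))"
  proof (rule bounded_linear_intro)
    show "L (p (u + v)) = L (p u) + L (p v)" for u v
      using *(3)[of "p u" "p v" 1 1] p by (simp add: p.add)
    show "L (p (c *\<^sub>R u)) = c *\<^sub>R L (p u)" for c u
      using *(3)[of "p u" "p u" c 0] p by (simp add: p.scale)
    show "norm (L (p u)) \<le> norm u * (M * K)" for u
      using order_trans[OF *(4)[OF p(2)] mult_left_mono[OF M(2) *(2)]] by (simp add: ac_simps)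
  qed
  then have "(f has_derivative (\<lambda>u. L (p u))) (at x within S)"
  proof (rule has_derivativeI_sandwich[OF *(1), where H = "\<lambda>y. K * norm (y - x)"])
    fix y assume y: "y \<in> S" "y \<noteq> x" "dist y x < e"
    have h: "y - x \<in> S" using y S by (intro subspace_diff) auto
    have "norm (f y - f x - L (p (y - x))) \<le> K * (norm (y - x))\<^sup>2"
      using *(5)[OF h] y p(3)[OF h] by (simp add: dist_norm)
    then show "norm ((f y - f x) - L (p (y - x))) / norm (y - x) \<le> K * norm (y - x)"
      using y by (simp add: divide_le_eq power2_eq_square mult.assoc)
  next
    show "((\<lambda>y. K * norm (y - x)) \<longlongrightarrow> 0) (at x within S)"
      by (rule tendsto_eq_intros | simp)+
  qed
  then show ?thesis by blast
qed

section \<open>Analytic maps are smooth\<close>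

text \<open>
  Defining the higher derivatives through one-dimensional derivatives makes them depend on \<open>f\<close> alone,
  so that the power series of \<open>f\<close> at neighbouring points compute the same objects.
\<close>

primrec iterated_derivative :: "('a :: real_normed_vector \<Rightarrow> 'b :: real_normed_vector) \<Rightarrow> 'a list \<Rightarrow> 'a \<Rightarrow> 'b"
  where
    "iterated_derivative f [] = f"
  | "iterated_derivative f (v # vs) =
      (\<lambda>x. vector_derivative (\<lambda>t. iterated_derivative f vs (x + t *\<^sub>R v)) (at 0))"

definition insertions :: "('a list \<Rightarrow> 'b :: comm_monoid_add) \<Rightarrow> 'a list \<Rightarrow> 'a list \<Rightarrow> 'b"
  where "insertions a vs = foldr (\<lambda>v b. insertion b v) vs a"

lemma insertions_simps [simp]:
  "insertions a [] = a" "insertions a (v # vs) = insertion (insertions a vs) v"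
  by (auto simp: insertions_def)

lemma has_vector_derivative_power_series:
  fixes a :: "'a :: real_normed_vector list \<Rightarrow> 'b :: banach"
  assumes a: "multilinear_family S r C a" and r: "r > 0" and S: "subspace S"
    and f: "\<And>u. u \<in> S \<Longrightarrow> norm u < r \<Longrightarrow> (\<lambda>n. a (replicate n u)) sums f (x + u)"
    and u: "u \<in> S" "norm u < r / 8" and v: "v \<in> S"
  shows "(\<lambda>n. insertion a v (replicate n u)) sums
    vector_derivative (\<lambda>t. f (x + u + t *\<^sub>R v)) (at 0)"
proof -
  have b: "multilinear_family S (r / 2) (C * norm v / r) (insertion a v)"
    by (rule multilinear_family_insertion[OF a r v])
  obtain d where d: "(\<lambda>n. insertion a v (replicate n u)) sums d"
    using multilinear_family_summable[OF b _ u(1)] u r by (auto simp: summable_def)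
  \<comment> \<open>for \<open>\<bar>t\<bar> < e\<close> the point \<open>u + t v\<close> stays in the ball of radius \<open>r / 8\<close>\<close>
  define e where "e = (r / 8 - norm u) / (norm v + 1)"
  have e: "e > 0" using u by (auto simp: e_def intro!: divide_pos_pos add_nonneg_pos)
  define H where "H t = 128 * C * (norm v / r)\<^sup>2 * \<bar>t\<bar>" for t :: real
  have "((\<lambda>t. f (x + u + t *\<^sub>R v)) has_derivative (\<lambda>t. t *\<^sub>R d)) (at 0)"
  proof (rule has_derivativeI_sandwich[OF e, where H = H])
    show "(H \<longlongrightarrow> 0) (at 0)"
      unfolding H_def by (rule tendsto_eq_intros | simp)+
    fix t :: real assume t: "t \<noteq> 0" "dist t 0 < e"
    have tv: "t *\<^sub>R v \<in> S" "u + t *\<^sub>R v \<in> S"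
      using S u v by (auto intro: subspace_scale subspace_add)
    have "\<bar>t\<bar> * norm v \<le> e * norm v" using t by (intro mult_right_mono) auto
    also have "\<dots> \<le> e * (norm v + 1)" using e by (intro mult_left_mono) auto
    also have "e * (norm v + 1) = r / 8 - norm u"
      unfolding e_def using norm_ge_zero[of v] by (simp add: add_nonneg_eq_0_iff)
    finally have small: "norm (u + t *\<^sub>R v) \<le> r / 8"
      using norm_triangle_ineq[of u "t *\<^sub>R v"] by simp
    have "(\<lambda>n. a (replicate n u)) sums f (x + u)" "(\<lambda>n. a (replicate n (u + t *\<^sub>R v))) sums f (x + (u + t *\<^sub>R v))"
      using u r tv small by (auto intro!: f)
    from power_series_derivative[OF a r u(1) tv _ small this] u obtain d'
      where d': "(\<lambda>n. insertion a (t *\<^sub>R v) (replicate n u)) sums d'"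
        "norm (f (x + (u + t *\<^sub>R v)) - f (x + u) - d') \<le> 128 * C * (norm (t *\<^sub>R v) / r)\<^sup>2" by auto
    have rep: "set (replicate n u) \<subseteq> S" for n using u by (induction n) auto
    have "insertion a (t *\<^sub>R v) (replicate n u) = t *\<^sub>R insertion a v (replicate n u)" for n
    proof -
      have "a (take i (replicate n u) @ t *\<^sub>R v # drop i (replicate n u)) =
        t *\<^sub>R a (take i (replicate n u) @ v # drop i (replicate n u))" for i
        using multilinear_family_linear[OF a _ _ v v, of "take i (replicate n u)" "drop i (replicate n u)" t 0] rep
        by (simp del: take_replicate drop_replicate)
          (metis rep set_drop_subset set_take_subset subset_trans)
      then show ?thesis
        by (simp add: insertion_def scaleR_sum_right del: sum.atMost_Suc take_replicate drop_replicate)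
    qed
    with d' have "(\<lambda>n. t *\<^sub>R insertion a v (replicate n u)) sums d'" by simp
    with sums_scaleR_right[OF d, of t] have "d' = t *\<^sub>R d" by (rule sums_unique2[symmetric])
    with d'(2) have "norm (f (x + u + t *\<^sub>R v) - f (x + u) - t *\<^sub>R d) \<le> 128 * C * (norm v / r)\<^sup>2 * \<bar>t\<bar>\<^sup>2"
      by (simp add: add.assoc power_mult_distrib power_divide ac_simps)
    then show "norm (f (x + u + t *\<^sub>R v) - f (x + u + 0 *\<^sub>R v) - (t - 0) *\<^sub>R d) / norm (t - 0) \<le> H t"
      using t by (simp add: divide_le_eq H_def power2_eq_square mult.assoc)
  qed (rule bounded_linear_scaleR_left)
  then have "vector_derivative (\<lambda>t. f (x + u + t *\<^sub>R v)) (at 0) = d"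
    by (intro vector_derivative_at) (simp add: has_vector_derivative_def)
  with d show ?thesis by simp
qed

text \<open>
  Each further derivative costs a factor in the radius and in the constant, but neither depends on the
  directions \<open>vs\<close> beyond the product of their norms.
\<close>

lemma iterated_derivative_power_series:
  fixes a :: "'a :: real_normed_vector list \<Rightarrow> 'b :: banach"
  assumes a: "multilinear_family S r C a" and r: "r > 0" and S: "subspace S"
    and f: "\<And>u. u \<in> S \<Longrightarrow> norm u < r \<Longrightarrow> (\<lambda>n. a (replicate n u)) sums f (x + u)"
  shows "\<exists>s>0. \<exists>K\<ge>0. \<forall>vs. set vs \<subseteq> S \<and> length vs = k \<longrightarrow>
    multilinear_family S s (K * prod_list (map norm vs)) (insertions a vs) \<and>
    (\<forall>u\<in>S. norm u < s \<longrightarrow> (\<lambda>n. insertions a vs (replicate n u)) sums iterated_derivative f vs (x + u))"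
proof (induction k)
  case 0
  show ?case
    using a r f multilinear_family_nonneg[OF a] by (intro exI[of _ r] conjI exI[of _ C]) auto
next
  case (Suc k)
  then obtain s K where s: "s > 0" "K \<ge> 0"
    and IH: "\<And>vs. set vs \<subseteq> S \<Longrightarrow> length vs = k \<Longrightarrow> multilinear_family S s (K * prod_list (map norm vs)) (insertions a vs)"
      "\<And>vs u. set vs \<subseteq> S \<Longrightarrow> length vs = k \<Longrightarrow> u \<in> S \<Longrightarrow> norm u < s \<Longrightarrow>
        (\<lambda>n. insertions a vs (replicate n u)) sums iterated_derivative f vs (x + u)"
    by blast
  have "multilinear_family S (s / 8) (K / s * prod_list (map norm vs)) (insertions a vs) \<and>
    (\<forall>u\<in>S. norm u < s / 8 \<longrightarrow> (\<lambda>n. insertions a vs (replicate n u)) sums iterated_derivative f vs (x + u))"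
    if vs: "set vs \<subseteq> S" "length vs = Suc k" for vs
  proof -
    obtain v ws where vws: "vs = v # ws" using vs by (cases vs) auto
    have ws: "set ws \<subseteq> S" "length ws = k" "v \<in> S" using vs vws by auto
    have "multilinear_family S (s / 2) (K * prod_list (map norm ws) * norm v / s) (insertions a vs)"
      using multilinear_family_insertion[OF IH(1)[OF ws(1,2)] s(1) ws(3)] by (simp add: vws)
    then have "multilinear_family S (s / 8) (K / s * prod_list (map norm vs)) (insertions a vs)"
      using s by (rule_tac multilinear_family_shrink) (auto simp: vws ac_simps)
    moreover have "(\<lambda>n. insertions a vs (replicate n u)) sums iterated_derivative f vs (x + u)"
      if u: "u \<in> S" "norm u < s / 8" for u
      using has_vector_derivative_power_series[OF IH(1)[OF ws(1,2)] s(1) S IH(2)[OF ws(1,2)] u ws(3)]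
      by (simp add: vws)
    ultimately show ?thesis by blast
  qed
  then show ?case using s by (intro exI[of _ "s / 8"] conjI exI[of _ "K / s"]) auto
qed

lemma insertion_linear:
  fixes a b c :: "'a list \<Rightarrow> 'b :: real_vector"
  assumes "\<And>l. set l \<subseteq> S \<Longrightarrow> a l = \<alpha> *\<^sub>R b l + \<beta> *\<^sub>R c l" and S: "v \<in> S" "set l \<subseteq> S"
  shows "insertion a v l = \<alpha> *\<^sub>R insertion b v l + \<beta> *\<^sub>R insertion c v l"
proof -
  have "set (take i l @ v # drop i l) \<subseteq> S" for i
    using S set_drop_subset[of i l] set_take_subset[of i l] by auto
  then show ?thesis
    using assms(1) by (simp add: insertion_def scaleR_sum_right sum.distrib del: sum.atMost_Suc)
qed

lemma insertions_linear:
  assumes a: "multilinear_family S r C a" and r: "r > 0"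
    and S: "set ws \<subseteq> S" "x \<in> S" "y \<in> S" and sub: "subspace S"
  shows "set us \<subseteq> S \<Longrightarrow> set l \<subseteq> S \<Longrightarrow> insertions a (us @ (\<alpha> *\<^sub>R x + \<beta> *\<^sub>R y) # ws) l =
    \<alpha> *\<^sub>R insertions a (us @ x # ws) l + \<beta> *\<^sub>R insertions a (us @ y # ws) l"
proof (induction us arbitrary: l)
  case Nil
  have lin: "\<exists>r>0. \<exists>C. multilinear_family S r C (insertions a ws)"
    using S(1)
  proof (induction ws)
    case (Cons w ws)
    then obtain r C where "r > 0" "multilinear_family S r C (insertions a ws)" by auto
    from multilinear_family_insertion[OF this(2,1), of w] Cons.prems this(1) show ?case
      by (metis half_gt_zero insertions_simps(2) list.set_intros(1) subset_iff)
  qed (use a r in auto)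
  then obtain r C where b: "multilinear_family S r C (insertions a ws)" by blast
  have "set (take i l) \<subseteq> S" "set (drop i l) \<subseteq> S" for i
    using Nil set_drop_subset[of i l] set_take_subset[of i l] by auto
  then show ?case
    using multilinear_family_linear[OF b _ _ S(2,3)]
    by (simp add: insertion_def scaleR_sum_right sum.distrib del: sum.atMost_Suc)
next
  case (Cons u us)
  then show ?case by (auto intro!: insertion_linear[where S = S])
qed

text \<open>
  The \<open>k\<close>-th derivative near \<open>x\<close> is the sum of an iterated insertion series, so its difference quotient
  is controlled by the quadratic remainder of \<open>power_series_derivative_zero\<close>, uniformly in \<open>vs\<close>.
\<close>

lemma smooth_on_analytic:
  fixes f :: "'a :: banach \<Rightarrow> 'b :: banach"
  assumes S: "subspace S" and U: "openin (top_of_set S) U" and f: "\<And>x. x \<in> U \<Longrightarrow> analytic_at S x f"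
  shows "smooth_on S U f"
  unfolding smooth_on_def
proof (intro conjI exI[of _ "\<lambda>k x vs. iterated_derivative f vs x"] ballI allI impI)
  have US: "U \<subseteq> S" using U openin_imp_subset by blast
  have 0: "0 \<in> S" using S by (rule subspace_0)
  fix x assume x: "x \<in> U"
  obtain r C a where *: "r > 0" "0 \<le> C" "\<And>s. 0 < s \<Longrightarrow> s \<le> r \<Longrightarrow> multilinear_family S s C a"
    "\<And>h. h \<in> S \<Longrightarrow> norm h < r \<Longrightarrow> (\<lambda>n. a (replicate n h)) sums f (x + h)"
    using analytic_at_shrunk[OF f[OF x]] by blast
  have a: "multilinear_family S r C a" using * by simp
  obtain s K where sK: "\<And>k. s k > 0" "\<And>k. K k \<ge> 0"
    and fam: "\<And>vs. set vs \<subseteq> S \<Longrightarrow>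
      multilinear_family S (s (length vs)) (K (length vs) * prod_list (map norm vs)) (insertions a vs)"
    and sums: "\<And>vs u. set vs \<subseteq> S \<Longrightarrow> u \<in> S \<Longrightarrow> norm u < s (length vs) \<Longrightarrow>
      (\<lambda>n. insertions a vs (replicate n u)) sums iterated_derivative f vs (x + u)"
    using iterated_derivative_power_series[OF a *(1) S *(4)] by metis
  have Nil: "insertions a vs [] = iterated_derivative f vs x" if "set vs \<subseteq> S" for vs
    using family_Nil[OF fam[OF that] sK(1) 0 sums[OF that]] .
  show "iterated_derivative f [] x = f x" by simp
  fix k
  show "multilinear_on S k (\<lambda>vs. iterated_derivative f vs x)"
    unfolding multilinear_on_def
  proof (intro allI impI, elim conjE)
    fix us ws y z \<alpha> \<beta>
    assume l: "set us \<subseteq> S" "set ws \<subseteq> S" "y \<in> S" "z \<in> S"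
    then have "\<alpha> *\<^sub>R y + \<beta> *\<^sub>R z \<in> S" using S by (simp add: subspace_add subspace_scale)
    with l show "iterated_derivative f (us @ (\<alpha> *\<^sub>R y + \<beta> *\<^sub>R z) # ws) x =
        \<alpha> *\<^sub>R iterated_derivative f (us @ y # ws) x + \<beta> *\<^sub>R iterated_derivative f (us @ z # ws) x"
      using insertions_linear[OF a *(1) l(2-4) S l(1), of "[]" \<alpha> \<beta>] by (simp add: Nil)
  qed
  show "\<exists>C. multi_norm_le S k (\<lambda>vs. iterated_derivative f vs x) C"
    unfolding multi_norm_le_def
    using multilinear_family_bound[OF fam, of _ "[]"] Nil by (intro exI[of _ "K k"]) auto
  {
    fix e :: real assume e: "e > 0"
    define M where "M = 128 * K k / (s k)\<^sup>2"
    have M: "M \<ge> 0" using sK by (simp add: M_def)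
    define d where "d = min (s k / 8) (e / (M + 1))"
    have d: "d > 0" using e M sK by (simp add: d_def)
    show "\<exists>d>0. \<forall>y\<in>U. norm (y - x) < d \<longrightarrow>
      multi_norm_le S k (\<lambda>vs. iterated_derivative f vs y - iterated_derivative f vs x -
        iterated_derivative f ((y - x) # vs) x) (e * norm (y - x))"
      unfolding multi_norm_le_def
    proof (intro exI[of _ d] conjI d ballI allI impI, elim conjE)
      fix y vs assume y: "y \<in> U" "norm (y - x) < d" and vs: "set vs \<subseteq> S" "length vs = k"
      define h where "h = y - x"
      have h: "h \<in> S" using S US x y by (auto simp: h_def intro: subspace_diff)
      have hd: "norm h < s k / 8" "norm h < e / (M + 1)" using y(2) by (auto simp: h_def d_def)
      have P: "0 \<le> prod_list (map norm vs)" using prod_list_norm_nonneg[of 1 vs] by simp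
      have "norm (iterated_derivative f vs (x + h) - insertions a vs [] - insertions a vs [h])
        \<le> 128 * (K k * prod_list (map norm vs)) * (norm h / s k)\<^sup>2"
        using fam[OF vs(1)] sums[OF vs(1) h] vs hd sK(1)[of k]
        by (intro power_series_derivative_zero[OF _ _ S h]) auto
      moreover have "insertions a vs [h] = iterated_derivative f (h # vs) x"
        using Nil[of "h # vs"] vs h by (simp add: insertion_def)
      ultimately have "norm (iterated_derivative f vs y - iterated_derivative f vs x -
          iterated_derivative f (h # vs) x) \<le> M * norm h * (norm h * prod_list (map norm vs))"
        using Nil[OF vs(1)] by (simp add: h_def M_def power_divide power2_eq_square ac_simps)
      also have "\<dots> \<le> e * (norm h * prod_list (map norm vs))"
      proof (intro mult_right_mono)
        have "M * norm h \<le> (M + 1) * norm h" by (simp add: algebra_simps)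
        also have "\<dots> \<le> e" using hd(2) M by (simp add: field_simps)
        finally show "M * norm h \<le> e" .
      qed (use P in auto)
      finally show "norm (iterated_derivative f vs y - iterated_derivative f vs x -
          iterated_derivative f ((y - x) # vs) x) \<le> e * norm (y - x) * prod_list (map norm vs)"
        by (simp add: h_def mult.assoc)
    qed
  }
qed (rule U)

lemma of_class_analytic:
  fixes f :: "'a :: banach \<Rightarrow> 'b :: banach"
  assumes S: "subspace S" and U: "openin (top_of_set S) U" and f: "\<And>x. x \<in> U \<Longrightarrow> analytic_at S x f"
  shows "of_class r S U f"
proof (cases r)
  case Smooth
  with smooth_on_analytic[OF assms] show ?thesis by simp
next
  case Analytic
  have US: "U \<subseteq> S" using U openin_imp_subset by blast
  have "\<exists>r>0. \<exists>C. \<exists>a :: nat \<Rightarrow> 'a list \<Rightarrow> 'b.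
      (\<forall>k. multilinear_on S k (a k) \<and> multi_norm_le S k (a k) (C / r ^ k)) \<and>
      (\<forall>h\<in>S. norm h < r \<longrightarrow> x + h \<in> U \<and> (\<lambda>k. a k (replicate k h)) sums f (x + h))"
    if x: "x \<in> U" for x
  proof -
    obtain r C a where *: "r > 0" "0 \<le> C" "\<And>s. 0 < s \<Longrightarrow> s \<le> r \<Longrightarrow> multilinear_family S s C a"
      "\<And>h. h \<in> S \<Longrightarrow> norm h < r \<Longrightarrow> (\<lambda>n. a (replicate n h)) sums f (x + h)"
      using analytic_at_shrunk[OF f[OF x]] by blast
    obtain e where e: "e > 0" "ball x e \<inter> S \<subseteq> U"
      using U x by (auto simp: openin_contains_ball)
    define s where "s = min r e"
    have s: "s > 0" "s \<le> r" "s \<le> e" using * e by (auto simp: s_def)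
    have a: "multilinear_family S s C a" using * s by simp
    have "multilinear_on S k a" for k
      unfolding multilinear_on_def using multilinear_family_linear[OF a] by blast
    moreover have "multi_norm_le S k a (C / s ^ k)" for k
      unfolding multi_norm_le_def using multilinear_family_bound[OF a]
      by (auto simp: prod_list_norm_conv_power)
    moreover have "x + h \<in> U" if "h \<in> S" "norm h < s" for h
    proof -
      have "x + h \<in> S" using S US x that by (auto intro: subspace_add)
      moreover have "dist x (x + h) < e" using that s by (simp add: dist_norm)
      ultimately show ?thesis using e(2) by auto
    qed
    ultimately show ?thesis
      using *(4) s by (intro exI[of _ s] conjI exI[of _ C] exI[of _ "\<lambda>_. a"]) auto
  qed
  with U Analytic show ?thesis by (simp add: real_analytic_on_def)
qed

section \<open>Units of a Banach algebra\<close>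

text \<open>
  Invertibility is taken in a monoid: over the zero space the algebra of operators has \<open>0 = 1\<close>, so it is
  not an instance of \<open>ring_1\<close>.
\<close>

definition has_inverse :: "'a :: monoid_mult \<Rightarrow> bool"
  where "has_inverse x \<longleftrightarrow> (\<exists>y. x * y = 1 \<and> y * x = 1)"

definition inv_elt :: "'a :: monoid_mult \<Rightarrow> 'a"
  where "inv_elt x = (THE y. x * y = 1 \<and> y * x = 1)"

lemma has_inverseI: "x * y = 1 \<Longrightarrow> y * x = 1 \<Longrightarrow> has_inverse x"
  by (auto simp: has_inverse_def)

lemma inv_elt_eq:
  assumes "x * y = 1" "y * x = 1"
  shows "inv_elt x = y"
  unfolding inv_elt_def
proof (rule the_equality)
  fix z assume "x * z = 1 \<and> z * x = 1"
  then show "z = y" using assms by (metis mult.assoc mult_1_left mult_1_right)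
qed (use assms in auto)

lemma inv_elt_right [simp]: "has_inverse x \<Longrightarrow> x * inv_elt x = 1"
  and inv_elt_left [simp]: "has_inverse x \<Longrightarrow> inv_elt x * x = 1"
  by (metis has_inverse_def inv_elt_eq)+

lemma inv_elt_right_assoc [simp]: "has_inverse x \<Longrightarrow> x * (inv_elt x * y) = y"
  and inv_elt_left_assoc [simp]: "has_inverse x \<Longrightarrow> inv_elt x * (x * y) = y"
  by (simp_all flip: mult.assoc)

lemma has_inverse_mult:
  assumes "has_inverse x" "has_inverse y"
  shows "has_inverse (x * y)"
  by (rule has_inverseI[of _ "inv_elt y * inv_elt x"]) (use assms in \<open>simp_all add: mult.assoc\<close>)

lemma has_inverse_inv_elt: "has_inverse x \<Longrightarrow> has_inverse (inv_elt x)"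
  by (rule has_inverseI[of _ x]) auto

lemma inv_elt_commute:
  assumes "has_inverse x" "x * y = y * x"
  shows "inv_elt x * y = y * inv_elt x"
proof -
  have "inv_elt x * y = inv_elt x * (y * x) * inv_elt x" using assms(1) by (simp add: mult.assoc)
  also have "\<dots> = y * inv_elt x" by (simp add: assms flip: assms(2) mult.assoc)
  finally show ?thesis .
qed

text \<open>
  The fixed points of the contractions \<open>y \<mapsto> 1 + E y\<close> and \<open>z \<mapsto> 1 + z E\<close> are a right and a left inverse.
\<close>

lemma has_inverse_one_minus:
  fixes E :: "'a :: {real_normed_algebra, monoid_mult, banach}"
  assumes "norm E < 1"
  shows "has_inverse (1 - E)"
proof -
  have "\<exists>!y. 1 + E * y = y"
    using assms
    by (intro banach_fix_type[of "norm E"])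
      (auto simp: dist_norm norm_mult_ineq simp flip: right_diff_distrib)
  then obtain y where y: "1 + E * y = y" by blast
  have "\<exists>!z. 1 + z * E = z"
    using assms
    by (intro banach_fix_type[of "norm E"])
      (auto simp: dist_norm norm_mult_ineq mult.commute[of "norm E"] simp flip: left_diff_distrib)
  then obtain z where z: "1 + z * E = z" by blast
  have 1: "(1 - E) * y = 1" "z * (1 - E) = 1"
    using y z by (simp_all add: algebra_simps)
  then have "z = y" by (metis mult.assoc mult_1_left mult_1_right)
  with 1 show ?thesis by (auto intro: has_inverseI)
qed

lemma has_inverse_one_plus:
  fixes E :: "'a :: {real_normed_algebra, monoid_mult, banach}"
  assumes "norm E < 1"
  shows "has_inverse (1 + E)"
  using has_inverse_one_minus[of "- E"] assms by simp

lemma open_has_inverse: "open {x :: 'a :: {real_normed_algebra, monoid_mult, banach}. has_inverse x}"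
proof (rule openI)
  fix x :: 'a assume "x \<in> {x. has_inverse x}"
  then have x: "has_inverse x" by simp
  define d where "d = 1 / (norm (inv_elt x) + 1)"
  have d: "d > 0" by (auto simp: d_def intro!: divide_pos_pos add_nonneg_pos)
  have "has_inverse y" if y: "dist x y < d" for y
  proof -
    have "norm (inv_elt x * (x - y)) \<le> norm (inv_elt x) * norm (x - y)" by (rule norm_mult_ineq)
    also have "\<dots> \<le> norm (inv_elt x) * d" using y by (intro mult_left_mono) (auto simp: dist_norm)
    also have "\<dots> < 1" unfolding d_def by (simp add: divide_less_eq add_nonneg_pos)
    finally have "has_inverse (x * (1 - inv_elt x * (x - y)))"
      by (intro has_inverse_mult x has_inverse_one_minus)
    then show ?thesis using x by (simp add: right_diff_distrib)
  qed
  with d show "\<exists>e>0. ball x e \<subseteq> {x. has_inverse x}" by auto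
qed

lemma analytic_at_inv_elt:
  fixes f :: "'a :: real_normed_vector \<Rightarrow> 'b :: {real_normed_algebra, monoid_mult, banach}"
  assumes f: "analytic_at S x f" and S: "subspace S" and inv: "has_inverse (f x)"
  shows "analytic_at S x (\<lambda>u. inv_elt (f u))"
proof -
  obtain e where e: "e > 0" "\<And>h. h \<in> S \<Longrightarrow> norm h < e \<Longrightarrow> f (x + h) \<in> {y. has_inverse y}"
    using analytic_at_eventually[OF f S open_has_inverse] inv by auto
  show ?thesis
    by (rule analytic_at_ring_inverse[OF f subspace_0[OF S] e(1)]) (use e(2) in auto)
qed

lemma analytic_at_inverse_real:
  fixes f :: "'a :: real_normed_vector \<Rightarrow> real"
  assumes f: "analytic_at S x f" and S: "subspace S" and inv: "f x \<noteq> 0"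
  shows "analytic_at S x (\<lambda>u. inverse (f u))"
proof -
  obtain e where e: "e > 0" "\<And>h. h \<in> S \<Longrightarrow> norm h < e \<Longrightarrow> f (x + h) \<in> - {0}"
    using analytic_at_eventually[OF f S, of "- {0}"] inv by auto
  show ?thesis
    by (rule analytic_at_ring_inverse[OF f subspace_0[OF S] e(1)]) (use e(2) in auto)
qed

lemmas analytic_at_mult = analytic_at_bilinear[OF bounded_bilinear_mult]
lemmas analytic_at_scaleR = analytic_at_bilinear[OF bounded_bilinear_scaleR]

text \<open>
  The equation \<open>(1 + Y)\<^sup>2 = 1 + Z\<close> is the fixed point equation \<open>Y = (Z - Y\<^sup>2) / 2\<close> of a contraction. The
  invariant closed set \<open>C\<close> transports to \<open>Y\<close> properties such as self-adjointness and commutation.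
\<close>

lemma square_root_near_one:
  fixes Z :: "'a :: {real_normed_algebra, monoid_mult, banach}"
  assumes Z: "norm Z \<le> 1 / 2"
    and C: "closed C" "0 \<in> C" "\<And>Y. Y \<in> C \<Longrightarrow> (1 / 2) *\<^sub>R (Z - Y * Y) \<in> C"
  obtains Y where "(1 + Y) * (1 + Y) = 1 + Z" "Y \<in> C" "norm Y \<le> 1 / 2"
proof -
  let ?D = "C \<inter> cball 0 (1 / 2)"
  let ?f = "\<lambda>Y. (1 / 2) *\<^sub>R (Z - Y * Y)"
  have sq: "norm (Y * Y) \<le> 1 / 4" if "norm Y \<le> 1 / 2" for Y :: 'a
  proof -
    have "norm Y * norm Y \<le> (1 / 2) * (1 / 2)" using that by (intro mult_mono) auto
    then show ?thesis using norm_mult_ineq[of Y Y] by simp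
  qed
  have "\<exists>!Y\<in>?D. ?f Y = Y"
  proof (rule Banach_fix[of ?D "1 / 2"])
    show "complete ?D" using C(1) by (intro closed_Int closed_cball complete_eq_closed[THEN iffD2])
    show "?D \<noteq> {}" using C(2) by auto
    show "?f ` ?D \<subseteq> ?D"
    proof (intro image_subsetI IntI)
      fix Y assume Y: "Y \<in> ?D"
      then show "?f Y \<in> C" using C(3) by blast
      have "norm (Z - Y * Y) \<le> norm Z + norm (Y * Y)" by (rule norm_triangle_ineq4)
      also have "\<dots> \<le> 1 / 2 + 1 / 4" using Z sq[of Y] Y by (intro add_mono) auto
      finally show "?f Y \<in> cball 0 (1 / 2)" by simp
    qed
    fix X Y assume XY: "X \<in> ?D" "Y \<in> ?D"
    have "?f X - ?f Y = (1 / 2) *\<^sub>R (Y * (Y - X) + (Y - X) * X)"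
      by (simp add: algebra_simps)
    then have "norm (?f X - ?f Y) = norm (Y * (Y - X) + (Y - X) * X) / 2" by simp
    also have "\<dots> \<le> (norm Y * norm (Y - X) + norm (Y - X) * norm X) / 2"
      by (intro divide_right_mono norm_triangle_mono norm_mult_ineq) auto
    also have "\<dots> \<le> (1 / 2 * norm (Y - X) + norm (Y - X) * (1 / 2)) / 2"
      using XY by (intro divide_right_mono add_mono mult_mono) auto
    finally show "dist (?f X) (?f Y) \<le> 1 / 2 * dist X Y"
      by (simp add: dist_norm norm_minus_commute)
  qed auto
  then obtain Y where Y: "Y \<in> ?D" "?f Y = Y" by blast
  have "Y + Y = 2 *\<^sub>R ?f Y" by (simp only: Y(2) scaleR_2)
  then have "Y + Y = Z - Y * Y" by simp
  then have "(1 + Y) * (1 + Y) = 1 + Z" by (simp add: algebra_simps)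
  with Y show ?thesis by (intro that[of Y]) auto
qed

section \<open>The Cayley transform\<close>

definition cayley :: "'a :: {real_algebra, monoid_mult} \<Rightarrow> 'a"
  where "cayley A = (1 + A) * inv_elt (1 - A)"

definition cayley_coord :: "'a :: {real_algebra, monoid_mult} \<Rightarrow> 'a"
  where "cayley_coord T = (T - 1) * inv_elt (T + 1)"

lemma cayley_zero [simp]: "cayley 0 = 1"
  by (simp add: cayley_def inv_elt_eq[of 1 1])

lemma has_inverse_scaleR:
  fixes x :: "'a :: {real_algebra, monoid_mult}"
  assumes "has_inverse x" "c \<noteq> 0"
  shows "has_inverse (c *\<^sub>R x)" "inv_elt (c *\<^sub>R x) = (1 / c) *\<^sub>R inv_elt x"
proof -
  have *: "(c *\<^sub>R x) * ((1 / c) *\<^sub>R inv_elt x) = 1" "((1 / c) *\<^sub>R inv_elt x) * (c *\<^sub>R x) = 1"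
    using assms by auto
  show "has_inverse (c *\<^sub>R x)" "inv_elt (c *\<^sub>R x) = (1 / c) *\<^sub>R inv_elt x"
    using has_inverseI[OF *] inv_elt_eq[OF *] by auto
qed

lemma has_inverse_two: "has_inverse (1 + 1 :: 'a :: {real_algebra, monoid_mult})"
  using has_inverse_scaleR(1)[of "1 :: 'a" 2] by (simp add: scaleR_2 has_inverseI[of 1 1])

lemma cayley_plus_one:
  assumes "has_inverse (1 - A)"
  shows "cayley A + 1 = 2 *\<^sub>R inv_elt (1 - A)"
proof -
  have "cayley A + 1 = (1 + A) * inv_elt (1 - A) + (1 - A) * inv_elt (1 - A)"
    using assms by (simp add: cayley_def)
  also have "\<dots> = 2 *\<^sub>R inv_elt (1 - A)" by (simp add: scaleR_2 algebra_simps)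
  finally show ?thesis .
qed

lemma cayley_minus_one:
  assumes "has_inverse (1 - A)"
  shows "cayley A - 1 = 2 *\<^sub>R (A * inv_elt (1 - A))"
proof -
  have "cayley A - 1 = (1 + A) * inv_elt (1 - A) - (1 - A) * inv_elt (1 - A)"
    using assms by (simp add: cayley_def)
  also have "\<dots> = 2 *\<^sub>R (A * inv_elt (1 - A))" by (simp add: scaleR_2 algebra_simps)
  finally show ?thesis .
qed

lemma cayley_coord_cayley:
  assumes "has_inverse (1 - A)"
  shows "has_inverse (cayley A + 1)" "cayley_coord (cayley A) = A"
proof -
  have "has_inverse (2 *\<^sub>R inv_elt (1 - A))" "inv_elt (2 *\<^sub>R inv_elt (1 - A)) = (1 / 2) *\<^sub>R (1 - A)"
    using has_inverse_scaleR[OF has_inverse_inv_elt[OF assms], of 2] assms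
    by (auto simp: inv_elt_eq[of "inv_elt (1 - A)" "1 - A"])
  then show "has_inverse (cayley A + 1)" "cayley_coord (cayley A) = A"
    unfolding cayley_coord_def cayley_plus_one[OF assms] cayley_minus_one[OF assms]
    using assms by (auto simp: mult.assoc)
qed

lemma cayley_cayley_coord:
  assumes "has_inverse (T + 1)"
  shows "has_inverse (1 - cayley_coord T)" "cayley (cayley_coord T) = T"
proof -
  let ?K = "inv_elt (T + 1)"
  have "1 - cayley_coord T = (T + 1) * ?K - (T - 1) * ?K" using assms by (simp add: cayley_coord_def)
  then have 1: "1 - cayley_coord T = 2 *\<^sub>R ?K" by (simp add: scaleR_2 algebra_simps)
  have "1 + cayley_coord T = (T + 1) * ?K + (T - 1) * ?K" using assms by (simp add: cayley_coord_def)
  then have 2: "1 + cayley_coord T = 2 *\<^sub>R (T * ?K)" by (simp add: scaleR_2 algebra_simps)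
  have "has_inverse (2 *\<^sub>R ?K)" "inv_elt (2 *\<^sub>R ?K) = (1 / 2) *\<^sub>R (T + 1)"
    using has_inverse_scaleR[OF has_inverse_inv_elt[OF assms], of 2] assms
    by (auto simp: inv_elt_eq[of "inv_elt (T + 1)" "T + 1"])
  then show "has_inverse (1 - cayley_coord T)" "cayley (cayley_coord T) = T"
    unfolding cayley_def 1 2 using assms by (auto simp: mult.assoc)
qed

lemma cayley_mult_cayley_minus:
  assumes "has_inverse (1 - A)" "has_inverse (1 + A)"
  shows "cayley A * cayley (- A) = 1"
proof -
  have c: "inv_elt (1 - A) * (1 - A) = (1 - A) * inv_elt (1 - A)" using assms by simp
  have "cayley A * cayley (- A) = (1 + A) * (inv_elt (1 - A) * (1 - A)) * inv_elt (1 + A)"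
    by (simp add: cayley_def mult.assoc)
  also have "\<dots> = 1" using assms by simp
  finally show ?thesis .
qed

lemma cayley_commuted:
  assumes "has_inverse (1 - A)"
  shows "cayley A = inv_elt (1 - A) * (1 + A)"
  unfolding cayley_def using assms by (subst inv_elt_commute) (auto simp: algebra_simps)

lemma cayley_conjugate:
  assumes S: "S * S = 1" and A: "has_inverse (1 - A)"
  shows "has_inverse (1 - S * A * S)" "S * cayley A * S = cayley (S * A * S)"
proof -
  have SS: "S * (S * x) = x" for x using S by (simp flip: mult.assoc)
  have e: "1 - S * A * S = S * (1 - A) * S" "1 + S * A * S = S * (1 + A) * S"
    using S by (simp_all add: algebra_simps)
  have *: "(S * (1 - A) * S) * (S * inv_elt (1 - A) * S) = 1" "(S * inv_elt (1 - A) * S) * (S * (1 - A) * S) = 1"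
    using A by (simp_all add: mult.assoc SS S)
  show "has_inverse (1 - S * A * S)" unfolding e by (rule has_inverseI[OF *])
  show "S * cayley A * S = cayley (S * A * S)"
    unfolding cayley_def e inv_elt_eq[OF *] by (simp add: mult.assoc SS)
qed

text \<open>
  This turns the nonlinear condition \<open>T\<^sup>* = T\<^sup>-\<^sup>1\<close> into a linear one.
\<close>

lemma cayley_coord_inverse:
  assumes TT: "T * T' = 1" "T' * T = 1" and T: "has_inverse (T + 1)"
  shows "cayley_coord T' = - cayley_coord T"
proof -
  let ?K = "inv_elt (T + 1)"
  have e: "T' + 1 = T' * (T + 1)" "T' - 1 = - ((T - 1) * T')"
    using TT by (simp_all add: algebra_simps)
  have c: "?K * T = T * ?K" using T by (intro inv_elt_commute) (auto simp: algebra_simps)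
  have *: "(T' * (T + 1)) * (?K * T) = 1" "(?K * T) * (T' * (T + 1)) = 1"
    using T TT by (simp_all add: mult.assoc) (simp_all flip: mult.assoc add: TT)
  have "cayley_coord T' = - ((T - 1) * T') * (T * ?K)"
    unfolding cayley_coord_def e inv_elt_eq[OF *] c ..
  also have "\<dots> = - ((T - 1) * ((T' * T) * ?K))" by (simp add: mult.assoc)
  finally show ?thesis by (simp add: TT cayley_coord_def)
qed

lemma cayley_coord_one [simp]: "cayley_coord 1 = 0"
  by (simp add: cayley_coord_def)

text \<open>
  With \<open>T\<^sup>2 = (1 + A)\<^sup>2 (1 - A)\<^sup>-\<^sup>2\<close>, the numerators \<open>(1 + A)\<^sup>2 - (1 - A)\<^sup>2 = 4 A\<close> and
  \<open>(1 + A)\<^sup>2 + (1 - A)\<^sup>2 = 2 (1 + A\<^sup>2)\<close> give the double angle formula of the tangent of half the angle.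
\<close>

lemma cayley_coord_cayley_square:
  assumes A: "has_inverse (1 - A)" and B: "has_inverse (1 + A * A)"
  shows "has_inverse (cayley A * cayley A + 1)"
    "cayley_coord (cayley A * cayley A) = 2 *\<^sub>R (A * inv_elt (1 + A * A))"
proof -
  let ?J = "inv_elt (1 - A)"
  have c: "?J * A = A * ?J" using A by (intro inv_elt_commute) (auto simp: algebra_simps)
  have c': "?J * (A * x) = A * (?J * x)" for x using c by (simp flip: mult.assoc)
  have J: "(1 - A) * (1 - A) * (?J * ?J) = 1" using A by (simp add: mult.assoc)
  have JJ: "?J * ?J * (1 - A) * (1 - A) = 1" using A by (simp add: mult.assoc)
  have sq: "cayley A * cayley A = (1 + A) * (1 + A) * (?J * ?J)"
    unfolding cayley_def using c by (simp add: algebra_simps c')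
  have 1: "cayley A * cayley A + 1 = 2 *\<^sub>R ((1 + A * A) * (?J * ?J))"
  proof -
    have "cayley A * cayley A + 1 = ((1 + A) * (1 + A) + (1 - A) * (1 - A)) * (?J * ?J)"
      unfolding sq distrib_right J ..
    also have "(1 + A) * (1 + A) + (1 - A) * (1 - A) = 2 *\<^sub>R (1 + A * A)"
      by (simp add: algebra_simps scaleR_2)
    finally show ?thesis by simp
  qed
  have 2: "cayley A * cayley A - 1 = 4 *\<^sub>R (A * (?J * ?J))"
  proof -
    have "cayley A * cayley A - 1 = ((1 + A) * (1 + A) - (1 - A) * (1 - A)) * (?J * ?J)"
      unfolding sq left_diff_distrib[of "(1 + A) * (1 + A)"] J ..
    also have "(1 + A) * (1 + A) - (1 - A) * (1 - A) = 4 *\<^sub>R A"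
      using scaleR_add_left[of 2 2 A] by (simp add: algebra_simps scaleR_2)
    finally show ?thesis by simp
  qed
  have inv: "has_inverse ((1 + A * A) * (?J * ?J))"
    using A B by (intro has_inverse_mult has_inverse_inv_elt)
  have *: "inv_elt ((1 + A * A) * (?J * ?J)) = (1 - A) * (1 - A) * inv_elt (1 + A * A)"
  proof (rule inv_elt_eq)
    show "((1 + A * A) * (?J * ?J)) * ((1 - A) * (1 - A) * inv_elt (1 + A * A)) = 1"
      using A B by (simp add: mult.assoc)
    show "(1 - A) * (1 - A) * inv_elt (1 + A * A) * ((1 + A * A) * (?J * ?J)) = 1"
      using A B by (simp add: mult.assoc)
  qed
  show "has_inverse (cayley A * cayley A + 1)" unfolding 1 using inv by (intro has_inverse_scaleR) auto
  show "cayley_coord (cayley A * cayley A) = 2 *\<^sub>R (A * inv_elt (1 + A * A))"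
    unfolding cayley_coord_def 1 2 has_inverse_scaleR(2)[OF inv, of 2, simplified] *
    using A by (simp add: mult.assoc)
qed

lemma analytic_at_cayley:
  fixes f :: "'a :: real_normed_vector \<Rightarrow> 'b :: {real_normed_algebra, monoid_mult, banach}"
  assumes f: "analytic_at S x f" and S: "subspace S" and inv: "has_inverse (1 - f x)"
  shows "analytic_at S x (\<lambda>u. cayley (f u))"
  unfolding cayley_def
  by (intro analytic_at_mult analytic_at_add analytic_at_const f analytic_at_inv_elt analytic_at_diff S inv)

lemma analytic_at_cayley_coord:
  fixes f :: "'a :: real_normed_vector \<Rightarrow> 'b :: {real_normed_algebra, monoid_mult, banach}"
  assumes f: "analytic_at S x f" and S: "subspace S" and inv: "has_inverse (f x + 1)"
  shows "analytic_at S x (\<lambda>u. cayley_coord (f u))"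
  unfolding cayley_coord_def
  by (intro analytic_at_mult analytic_at_add analytic_at_const f analytic_at_inv_elt analytic_at_diff S inv)

section \<open>The inner product and the Riesz representation theorem\<close>

lemma cinner_add_left: "cinner (x + y) z = cinner x z + cinner y z"
  by (metis cinner_add_right cinner_commute complex_cnj_add)

lemma cinner_scaleC_left: "cinner (c *\<^sub>C x) y = cnj c * cinner x y"
  by (metis cinner_commute cinner_scaleC_right complex_cnj_mult)

lemma cinner_scaleR_right: "cinner x (r *\<^sub>R y) = of_real r * cinner x y"
  by (simp add: scaleR_eq_scaleC cinner_scaleC_right)

lemma cinner_scaleR_left: "cinner (r *\<^sub>R x) y = of_real r * cinner x y"
  by (simp add: scaleR_eq_scaleC cinner_scaleC_left)

lemma cinner_zero_right [simp]: "cinner x 0 = 0"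
  using cinner_scaleR_right[of x 0 0] by simp

lemma cinner_zero_left [simp]: "cinner 0 x = 0"
  using cinner_scaleR_left[of 0 0 x] by simp

lemma cinner_minus_right: "cinner x (- y) = - cinner x y"
  using cinner_scaleR_right[of x "-1" y] by simp

lemma cinner_minus_left: "cinner (- x) y = - cinner x y"
  using cinner_scaleR_left[of "-1" x y] by simp

lemma cinner_diff_right: "cinner x (y - z) = cinner x y - cinner x z"
  using cinner_add_right[of x y "- z"] by (simp add: cinner_minus_right)

lemma cinner_diff_left: "cinner (x - y) z = cinner x z - cinner y z"
  using cinner_add_left[of x "- y" z] by (simp add: cinner_minus_left)

lemmas cinner_simps = cinner_add_left cinner_add_right cinner_diff_left cinner_diff_right
  cinner_minus_left cinner_minus_right cinner_scaleC_left cinner_scaleC_right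
  cinner_scaleR_left cinner_scaleR_right

lemma cinner_self: "cinner x x = of_real ((norm x)\<^sup>2)"
proof (rule complex_eqI)
  show "Re (cinner x x) = Re (of_real ((norm x)\<^sup>2))"
    by (simp add: norm_eq_sqrt_cinner[of x] cinner_ge_zero)
  have "Im (cinner x x) = Im (cnj (cinner x x))" by (metis cinner_commute)
  then show "Im (cinner x x) = Im (of_real ((norm x)\<^sup>2))" by simp
qed

lemma Re_cinner_commute: "Re (cinner x y) = Re (cinner y x)"
  by (subst cinner_commute) simp

lemma Im_cinner_commute: "Im (cinner x y) = - Im (cinner y x)"
  by (subst cinner_commute) simp

lemma norm_add_squared: "(norm (x + y))\<^sup>2 = (norm x)\<^sup>2 + 2 * Re (cinner x y) + (norm y)\<^sup>2"
  for x y :: "'a :: complex_inner"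
proof -
  have "Re (cinner (x + y) (x + y)) = Re (cinner x x) + 2 * Re (cinner x y) + Re (cinner y y)"
    using Re_cinner_commute[of y x] by (simp add: cinner_simps)
  then show ?thesis by (simp add: cinner_self)
qed

lemma norm_scaleC: "norm (c *\<^sub>C x) = cmod c * norm x" for x :: "'a :: complex_inner"
proof -
  have "cinner (c *\<^sub>C x) (c *\<^sub>C x) = (c * cnj c) * cinner x x"
    by (simp add: cinner_simps)
  also have "\<dots> = of_real ((cmod c * norm x)\<^sup>2)"
    by (simp only: cinner_self power_mult_distrib of_real_mult complex_norm_square)
  finally have "cinner (c *\<^sub>C x) (c *\<^sub>C x) = of_real ((cmod c * norm x)\<^sup>2)" .
  then have "(norm (c *\<^sub>C x))\<^sup>2 = (cmod c * norm x)\<^sup>2"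
    unfolding cinner_self of_real_eq_iff .
  then show ?thesis by (rule power2_eq_imp_eq) auto
qed

lemma cinner_norm_le: "cmod (cinner x y) \<le> norm x * norm y" for x y :: "'a :: complex_inner"
proof (cases "y = 0")
  case False
  define c where "c = cinner y x / of_real ((norm y)\<^sup>2)"
  have y: "norm y > 0" using False by simp
  have "(norm (x - c *\<^sub>C y))\<^sup>2 = (norm x)\<^sup>2 - (cmod (cinner x y))\<^sup>2 / (norm y)\<^sup>2"
  proof -
    have "cinner (x - c *\<^sub>C y) (x - c *\<^sub>C y) =
      cinner x x - c * cinner x y - cnj c * cinner y x + cnj c * c * cinner y y"
      by (simp add: cinner_simps algebra_simps)
    also have "cnj c * c * cinner y y = cnj c * cinner y x"
    proof -
      have "c * cinner y y = cinner y x" using y by (simp add: c_def cinner_self)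
      then show ?thesis by (simp add: mult.assoc)
    qed
    also have "c * cinner x y = of_real ((cmod (cinner x y))\<^sup>2 / (norm y)\<^sup>2)"
    proof -
      have "cinner y x * cinner x y = of_real ((cmod (cinner x y))\<^sup>2)"
        by (metis cinner_commute complex_norm_square mult.commute)
      then show ?thesis by (simp add: c_def)
    qed
    finally have "cinner (x - c *\<^sub>C y) (x - c *\<^sub>C y) =
      of_real ((norm x)\<^sup>2 - (cmod (cinner x y))\<^sup>2 / (norm y)\<^sup>2)" by (simp add: cinner_self)
    then show ?thesis unfolding cinner_self of_real_eq_iff .
  qed
  then have "(cmod (cinner x y))\<^sup>2 / (norm y)\<^sup>2 \<le> (norm x)\<^sup>2"
    using zero_le_power2[of "norm (x - c *\<^sub>C y)"] by linarith
  then have "(cmod (cinner x y))\<^sup>2 \<le> (norm x * norm y)\<^sup>2"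
    using y by (simp add: divide_le_eq power_mult_distrib)
  then show ?thesis by (rule power2_le_imp_le) auto
qed simp

lemma bounded_bilinear_cinner: "bounded_bilinear (cinner :: 'a :: complex_inner \<Rightarrow> 'a \<Rightarrow> complex)"
  by standard (auto simp: cinner_simps scaleR_conv_of_real intro!: exI[of _ 1] cinner_norm_le)

lemma bounded_bilinear_scaleC: "bounded_bilinear (scaleC :: complex \<Rightarrow> 'a :: complex_inner \<Rightarrow> 'a)"
  by standard
    (auto simp: scaleC_add_left scaleC_add_right scaleC_scaleR_commute norm_scaleC
      scaleR_eq_scaleC scaleC_scaleC scaleR_conv_of_real mult.commute intro!: exI[of _ 1])

lemma cinner_right_eqI: "(\<And>y. cinner u y = cinner v y) \<Longrightarrow> u = v" for u v :: "'a :: complex_inner"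
proof -
  assume "\<And>y. cinner u y = cinner v y"
  then have "cinner (u - v) (u - v) = 0" by (simp add: cinner_diff_left)
  then show "u = v" by (simp add: cinner_self)
qed

text \<open>
  The functional \<open>J x = norm x\<^sup>2 - 2 Re (\<phi> x)\<close> is bounded below and uniformly convex by the parallelogram
  identity, so minimising sequences converge. The first variation of \<open>J\<close> at the minimiser \<open>z\<close> says
  \<open>Re (cinner z v) = Re (\<phi> v)\<close> for all \<open>v\<close>, and replacing \<open>v\<close> by \<open>\<i> v\<close> gives the imaginary part.
\<close>

lemma riesz_representation:
  fixes \<phi> :: "'a :: complex_hilbert \<Rightarrow> complex"
  assumes add: "\<And>x y. \<phi> (x + y) = \<phi> x + \<phi> y" and homogeneous: "\<And>c x. \<phi> (c *\<^sub>C x) = c * \<phi> x"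
    and bound: "\<And>x. cmod (\<phi> x) \<le> K * norm x"
  shows "\<exists>z. \<forall>x. \<phi> x = cinner z x"
proof -
  have lin: "bounded_linear \<phi>"
    by (rule bounded_linear_intro[of _ K])
      (auto simp: add scaleR_eq_scaleC homogeneous scaleR_conv_of_real bound mult.commute)
  interpret bounded_linear \<phi> by (rule lin)
  define J where "J x = (norm x)\<^sup>2 - 2 * Re (\<phi> x)" for x
  \<comment> \<open>complete the square in \<open>norm x\<close>\<close>
  have low: "- K\<^sup>2 \<le> J x" for x
  proof -
    have "Re (\<phi> x) \<le> K * norm x" using bound[of x] complex_Re_le_cmod[of "\<phi> x"] by linarith
    moreover have "0 \<le> (norm x - K)\<^sup>2" by simp
    ultimately show ?thesis by (simp add: J_def power2_diff algebra_simps)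
  qed
  then have bdd: "bdd_below (range J)" by (auto intro!: bdd_belowI2)
  define m where "m = Inf (range J)"
  have mJ: "m \<le> J x" for x unfolding m_def using bdd by (intro cInf_lower) auto
  have "\<exists>x. J x < m + inverse (real (Suc n))" for n
  proof -
    have "\<exists>y\<in>range J. y < m + inverse (real (Suc n))"
      unfolding m_def by (subst cInf_less_iff[symmetric]) (use bdd in auto)
    then show ?thesis by auto
  qed
  then obtain X where X: "\<And>n. J (X n) < m + inverse (real (Suc n))" by metis
  have par: "(norm (x - y))\<^sup>2 = 2 * (J x + J y - 2 * J ((1 / 2) *\<^sub>R (x + y)))" for x y
  proof -
    have half: "J ((1 / 2) *\<^sub>R (x + y)) = (norm (x + y))\<^sup>2 / 4 - Re (\<phi> x) - Re (\<phi> y)"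
      by (simp add: J_def add scaleR power_divide add_divide_distrib)
    have "(norm (x - y))\<^sup>2 = (norm x)\<^sup>2 - 2 * Re (cinner x y) + (norm y)\<^sup>2"
      using norm_add_squared[of x "- y"] by (simp add: cinner_simps)
    then show ?thesis
      using norm_add_squared[of x y] unfolding half unfolding J_def by argo
  qed
  have "Cauchy X"
  proof (rule metric_CauchyI)
    fix e :: real assume e: "e > 0"
    obtain N where N: "inverse (real (Suc N)) < e\<^sup>2 / 4"
      using reals_Archimedean[of "e\<^sup>2 / 4"] e by auto
    have "dist (X i) (X j) < e" if "i \<ge> N" "j \<ge> N" for i j
    proof -
      have le: "inverse (real (Suc i)) \<le> inverse (real (Suc N))" "inverse (real (Suc j)) \<le> inverse (real (Suc N))"
        using that by (auto intro!: le_imp_inverse_le)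
      have "(norm (X i - X j))\<^sup>2 < e\<^sup>2"
        using par[of "X i" "X j"] X[of i] X[of j] mJ[of "(1 / 2) *\<^sub>R (X i + X j)"] N le by argo
      then show ?thesis using e by (simp add: dist_norm power2_less_imp_less)
    qed
    then show "\<exists>M. \<forall>m\<ge>M. \<forall>n\<ge>M. dist (X m) (X n) < e" by blast
  qed
  then obtain z where z: "X \<longlonglongrightarrow> z" by (auto simp: Cauchy_convergent_iff convergent_def)
  have "(\<lambda>n. J (X n)) \<longlonglongrightarrow> J z"
    unfolding J_def by (intro tendsto_intros z tendsto)
  moreover have "(\<lambda>n. m + inverse (real (Suc n))) \<longlonglongrightarrow> m + 0"
    by (intro tendsto_add tendsto_const LIMSEQ_inverse_real_of_nat)
  ultimately have "J z \<le> m + 0"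
    by (rule LIMSEQ_le) (use X less_imp_le in blast)
  then have min: "J z \<le> J x" for x using mJ[of x] by simp
  have Re: "Re (cinner z v) = Re (\<phi> v)" for v
  proof -
    define a where "a = Re (cinner z v) - Re (\<phi> v)"
    define N where "N = (norm v)\<^sup>2"
    have "0 \<le> 2 * t * a + t\<^sup>2 * N" for t
      using min[of "z + t *\<^sub>R v"] norm_add_squared[of z "t *\<^sub>R v"]
      by (simp add: J_def a_def N_def add scaleR cinner_simps power_mult_distrib algebra_simps)
    \<comment> \<open>the quadratic in \<open>t\<close> can be nonnegative only if its linear coefficient vanishes; this \<open>t\<close> shows it also when \<open>N = 0\<close>\<close>
    from this[of "- a / (N + 1)"] have "0 \<le> a\<^sup>2 * (- N - 2) / (N + 1)\<^sup>2"
    proof -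
      have N1: "N + 1 \<noteq> 0" using zero_le_power2[of "norm v"] by (simp add: N_def add_nonneg_eq_0_iff)
      have "2 * (- a / (N + 1)) * a + (- a / (N + 1))\<^sup>2 * N = a\<^sup>2 * (- N - 2) / (N + 1)\<^sup>2"
        using N1 by (simp add: power2_eq_square divide_simps) (simp add: algebra_simps)
      with \<open>0 \<le> 2 * (- a / (N + 1)) * a + (- a / (N + 1))\<^sup>2 * N\<close> show ?thesis by simp
    qed
    moreover have N: "N \<ge> 0" by (simp add: N_def)
    ultimately have "0 \<le> a\<^sup>2 * (- N - 2)"
      by (auto simp: zero_le_divide_iff add_nonneg_eq_0_iff)
    then have "a\<^sup>2 * (N + 2) \<le> 0" by (simp add: algebra_simps)
    then have "a = 0" using N by (auto simp: mult_le_0_iff)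
    then show ?thesis by (simp add: a_def)
  qed
  have "\<phi> x = cinner z x" for x
  proof (rule complex_eqI)
    show "Re (\<phi> x) = Re (cinner z x)" using Re by simp
    show "Im (\<phi> x) = Im (cinner z x)" using Re[of "\<i> *\<^sub>C x"] by (simp add: homogeneous cinner_simps)
  qed
  then show ?thesis by blast
qed

section \<open>The algebra of bounded operators\<close>

lemma op_eqI: "(\<And>x. S \<cdot> x = T \<cdot> x) \<Longrightarrow> S = T"
  unfolding op_apply_def by (metis blinfun_eqI blinfun_of_inject)

lemma op_apply_scaleC: "T \<cdot> (c *\<^sub>C x) = c *\<^sub>C (T \<cdot> x)"
  using blinfun_of[of T] by (simp add: op_apply_def)

lemma op_apply_norm_le: "norm (T \<cdot> x) \<le> norm T * norm x"
  unfolding op_apply_def by transfer (rule norm_blinfun)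

lemma norm_op_leI:
  assumes "b \<ge> 0" "\<And>x. norm (T \<cdot> x) \<le> b * norm x"
  shows "norm T \<le> b"
proof -
  have "norm (blinfun_of T) \<le> b"
    using assms by (intro norm_blinfun_bound) (auto simp: op_apply_def)
  then show ?thesis by (simp add: norm_bdd_op.rep_eq)
qed

lemma bounded_bilinear_op_apply: "bounded_bilinear (\<lambda>T x. T \<cdot> x)"
  by standard
    (auto simp: op_apply_def plus_bdd_op.rep_eq scaleR_bdd_op.rep_eq blinfun.add_left blinfun.add_right
      blinfun.scaleR_left blinfun.scaleR_right norm_bdd_op.rep_eq intro!: exI[of _ 1] norm_blinfun)

interpretation op_apply: bounded_bilinear "\<lambda>T x. T \<cdot> x"
  by (rule bounded_bilinear_op_apply)

definition mk_op :: "('a :: complex_inner \<Rightarrow> 'a) \<Rightarrow> 'a bdd_op"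
  where "mk_op f = Bdd_op (Blinfun f)"

lemma mk_op_apply:
  assumes "bounded_linear f" "\<And>c x. f (c *\<^sub>C x) = c *\<^sub>C f x"
  shows "mk_op f \<cdot> x = f x"
  unfolding mk_op_def op_apply_def
  by (subst Bdd_op_inverse) (use assms in \<open>auto simp: bounded_linear_Blinfun_apply\<close>)

instantiation bdd_op :: (complex_inner) "{real_normed_algebra, monoid_mult}"
begin

definition times_bdd_op :: "'a bdd_op \<Rightarrow> 'a bdd_op \<Rightarrow> 'a bdd_op"
  where "times_bdd_op = op_comp"

definition one_bdd_op :: "'a bdd_op"
  where "one_bdd_op = op_id"

lemma op_mult_apply: "(S * T) \<cdot> x = S \<cdot> (T \<cdot> x)" for S T :: "'a bdd_op"
  by (simp add: times_bdd_op_def op_apply_def op_comp.rep_eq)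

lemma op_one_apply: "1 \<cdot> x = (x :: 'a)"
  by (simp add: one_bdd_op_def op_apply_def op_id.rep_eq)

instance
proof
  fix a b c :: "'a bdd_op" and r :: real
  show "norm (a * b) \<le> norm a * norm b"
  proof (rule norm_op_leI)
    fix x
    have "norm ((a * b) \<cdot> x) \<le> norm a * norm (b \<cdot> x)"
      unfolding op_mult_apply by (rule op_apply_norm_le)
    also have "\<dots> \<le> norm a * (norm b * norm x)"
      by (intro mult_left_mono op_apply_norm_le) auto
    finally show "norm ((a * b) \<cdot> x) \<le> norm a * norm b * norm x" by (simp add: mult.assoc)
  qed simp
qed (auto intro!: op_eqI simp: op_mult_apply op_one_apply op_apply.add_left op_apply.add_right
    op_apply.scaleR_left op_apply.scaleR_right)

end

lemmas op_simps = op_mult_apply op_one_apply op_apply.add_left op_apply.add_right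
  op_apply.diff_left op_apply.diff_right op_apply.minus_left op_apply.minus_right
  op_apply.scaleR_left op_apply.scaleR_right op_apply_scaleC

lemma op_comp_eq_times: "S \<odot> T = S * T"
  by (simp add: times_bdd_op_def)

lemma op_id_eq_one: "op_id = 1"
  by (simp add: one_bdd_op_def)

subsection \<open>Adjoints\<close>

lemma adjoint_exists:
  fixes T :: "'a :: complex_hilbert bdd_op"
  shows "\<exists>S. \<forall>x y. cinner (S \<cdot> x) y = cinner x (T \<cdot> y)"
proof -
  have "\<exists>z. \<forall>y. cinner x (T \<cdot> y) = cinner z y" for x
  proof (rule riesz_representation)
    show "cmod (cinner x (T \<cdot> y)) \<le> (norm x * norm T) * norm y" for y
      using order_trans[OF cinner_norm_le mult_left_mono[OF op_apply_norm_le]]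
      by (simp add: mult.assoc)
  qed (auto simp: op_simps cinner_simps)
  then obtain f where f: "\<And>x y. cinner x (T \<cdot> y) = cinner (f x) y" by metis
  have scaleC: "f (c *\<^sub>C x) = c *\<^sub>C f x" for c x
    by (rule cinner_right_eqI) (simp add: cinner_simps flip: f)
  have "bounded_linear f"
  proof (rule bounded_linear_intro)
    show "f (x + y) = f x + f y" for x y
      by (rule cinner_right_eqI) (simp add: cinner_simps flip: f)
    show "f (r *\<^sub>R x) = r *\<^sub>R f x" for r x
      by (simp add: scaleR_eq_scaleC scaleC)
    show "norm (f x) \<le> norm x * norm T" for x
    proof (cases "f x = 0")
      case False
      have "(norm (f x))\<^sup>2 = cmod (cinner (f x) (f x))"
        by (simp only: cinner_self norm_of_real) simp
      also have "\<dots> = cmod (cinner x (T \<cdot> f x))" by (simp add: f)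
      also have "\<dots> \<le> norm x * (norm T * norm (f x))"
        by (intro order_trans[OF cinner_norm_le] mult_left_mono op_apply_norm_le) auto
      finally show ?thesis using False by (simp add: power2_eq_square)
    qed simp
  qed
  from mk_op_apply[OF this scaleC] f show ?thesis by metis
qed

lemma adjoint_unique:
  fixes S T :: "'a :: complex_hilbert bdd_op"
  assumes "\<And>x y. cinner (S \<cdot> x) y = cinner x (T \<cdot> y)"
  shows "adjoint_op T = S"
  unfolding adjoint_op_def
proof (rule the_equality)
  fix S' assume "\<forall>x y. cinner (S' \<cdot> x) y = cinner x (T \<cdot> y)"
  then show "S' = S" using assms by (intro op_eqI cinner_right_eqI) auto
qed (use assms in auto)

lemma cinner_adjoint_left: "cinner (adjoint_op T \<cdot> x) y = cinner x (T \<cdot> y)"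
proof -
  obtain S where S: "\<And>x y. cinner (S \<cdot> x) y = cinner x (T \<cdot> y)" using adjoint_exists by blast
  from adjoint_unique[OF this] S show ?thesis by simp
qed

lemma cinner_adjoint_right: "cinner x (adjoint_op T \<cdot> y) = cinner (T \<cdot> x) y"
  by (metis cinner_adjoint_left cinner_commute)

lemma adjoint_adjoint [simp]: "adjoint_op (adjoint_op T) = T"
  by (rule adjoint_unique) (simp add: cinner_adjoint_right)

lemma adjoint_add: "adjoint_op (S + T) = adjoint_op S + adjoint_op T"
  by (rule adjoint_unique) (simp add: op_simps cinner_simps cinner_adjoint_left)

lemma adjoint_diff: "adjoint_op (S - T) = adjoint_op S - adjoint_op T"
  by (rule adjoint_unique) (simp add: op_simps cinner_simps cinner_adjoint_left)

lemma adjoint_minus: "adjoint_op (- T) = - adjoint_op T"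
  by (rule adjoint_unique) (simp add: op_simps cinner_simps cinner_adjoint_left)

lemma adjoint_scaleR: "adjoint_op (r *\<^sub>R T) = r *\<^sub>R adjoint_op T"
  by (rule adjoint_unique) (simp add: op_simps cinner_simps cinner_adjoint_left)

lemma adjoint_mult: "adjoint_op (S * T) = adjoint_op T * adjoint_op S"
  by (rule adjoint_unique) (simp add: op_simps cinner_adjoint_left)

lemma adjoint_one [simp]: "adjoint_op 1 = 1"
  by (rule adjoint_unique) (simp add: op_simps)

lemma adjoint_zero [simp]: "adjoint_op 0 = 0"
  using adjoint_scaleR[of 0 0] by simp

lemmas adjoint_simps = adjoint_add adjoint_diff adjoint_minus adjoint_scaleR adjoint_mult

lemma norm_adjoint_le: "norm (adjoint_op T) \<le> norm T"
proof (rule norm_op_leI)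
  fix x
  show "norm (adjoint_op T \<cdot> x) \<le> norm T * norm x"
  proof (cases "adjoint_op T \<cdot> x = 0")
    case False
    have "(norm (adjoint_op T \<cdot> x))\<^sup>2 = cmod (cinner (adjoint_op T \<cdot> x) (adjoint_op T \<cdot> x))"
      by (simp only: cinner_self norm_of_real) simp
    also have "\<dots> = cmod (cinner x (T \<cdot> adjoint_op T \<cdot> x))" by (simp add: cinner_adjoint_left)
    also have "\<dots> \<le> norm x * (norm T * norm (adjoint_op T \<cdot> x))"
      by (intro order_trans[OF cinner_norm_le] mult_left_mono op_apply_norm_le) auto
    finally show ?thesis using False by (simp add: power2_eq_square mult.commute)
  qed simp
qed simp

lemma bounded_linear_adjoint: "bounded_linear adjoint_op"
  by (rule bounded_linear_intro[of _ 1]) (auto simp: adjoint_simps norm_adjoint_le)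

lemma adjoint_inv_elt:
  assumes "has_inverse T"
  shows "has_inverse (adjoint_op T)" "adjoint_op (inv_elt T) = inv_elt (adjoint_op T)"
proof -
  have *: "adjoint_op T * adjoint_op (inv_elt T) = 1" "adjoint_op (inv_elt T) * adjoint_op T = 1"
    using assms by (simp_all flip: adjoint_mult)
  show "has_inverse (adjoint_op T)" "adjoint_op (inv_elt T) = inv_elt (adjoint_op T)"
    using has_inverseI[OF *] inv_elt_eq[OF *] by auto
qed

lemma adjoint_cayley:
  assumes "has_inverse (1 - A)"
  shows "adjoint_op (cayley A) = cayley (adjoint_op A)"
  using adjoint_inv_elt[OF assms]
  by (simp add: cayley_def[of A] adjoint_simps) (simp add: cayley_commuted)

lemma adjoint_cayley_coord:
  assumes "has_inverse (T + 1)"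
  shows "adjoint_op (cayley_coord T) = cayley_coord (adjoint_op T)"
proof -
  note inv = adjoint_inv_elt[OF assms, unfolded adjoint_simps adjoint_one]
  have "inv_elt (adjoint_op T + 1) * (adjoint_op T - 1) = (adjoint_op T - 1) * inv_elt (adjoint_op T + 1)"
    using inv by (intro inv_elt_commute) (auto simp: algebra_simps)
  then show ?thesis using inv by (simp add: cayley_coord_def adjoint_simps)
qed

subsection \<open>Rank one operators and scalars\<close>

definition rank_one :: "'a :: complex_inner \<Rightarrow> 'a \<Rightarrow> 'a bdd_op"
  where "rank_one u v = mk_op (\<lambda>x. cinner v x *\<^sub>C u)"

lemma rank_one_apply: "rank_one u v \<cdot> x = cinner v x *\<^sub>C u"
  unfolding rank_one_def
proof (rule mk_op_apply)
  show "bounded_linear (\<lambda>x. cinner v x *\<^sub>C u)"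
    using bounded_linear_compose[OF bounded_bilinear.bounded_linear_left[OF bounded_bilinear_scaleC]
      bounded_bilinear.bounded_linear_right[OF bounded_bilinear_cinner]] .
qed (simp add: cinner_simps scaleC_scaleC)

lemma norm_rank_one_le: "norm (rank_one u v) \<le> norm u * norm v"
proof (rule norm_op_leI)
  fix x
  have "cmod (cinner v x) * norm u \<le> (norm v * norm x) * norm u"
    by (intro mult_right_mono cinner_norm_le) auto
  then show "norm (rank_one u v \<cdot> x) \<le> norm u * norm v * norm x"
    by (simp add: rank_one_apply norm_scaleC ac_simps)
qed simp

lemma scaleC_zero_left [simp]: "0 *\<^sub>C x = (0 :: 'a :: complex_inner)"
  using scaleR_eq_scaleC[of 0 x] by simp

lemma bounded_bilinear_rank_one: "bounded_bilinear (rank_one :: 'a :: complex_inner \<Rightarrow> 'a \<Rightarrow> 'a bdd_op)"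
proof
  show "\<exists>K. \<forall>u v :: 'a. norm (rank_one u v) \<le> norm u * norm v * K"
    using norm_rank_one_le by (intro exI[of _ 1]) auto
qed (auto intro!: op_eqI simp: rank_one_apply op_simps cinner_simps scaleC_add_left scaleC_add_right
    scaleC_scaleR_commute scaleR_eq_scaleC scaleC_scaleC mult.commute)

lemma adjoint_rank_one: "adjoint_op (rank_one u v) = rank_one v (u :: 'a :: complex_hilbert)"
  by (rule adjoint_unique)
    (simp add: rank_one_apply cinner_simps, metis cinner_commute mult.commute)

definition scalar_op :: "complex \<Rightarrow> 'a :: complex_inner bdd_op"
  where "scalar_op c = mk_op (\<lambda>x. c *\<^sub>C x)"

lemma scalar_op_apply: "scalar_op c \<cdot> x = c *\<^sub>C x"
  unfolding scalar_op_def
  by (rule mk_op_apply[OF bounded_bilinear.bounded_linear_right[OF bounded_bilinear_scaleC]])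
    (simp add: scaleC_scaleC mult.commute)

lemma norm_scalar_op_le: "norm (scalar_op c) \<le> cmod c"
  by (rule norm_op_leI) (auto simp: scalar_op_apply norm_scaleC)

lemma bounded_linear_scalar_op: "bounded_linear (scalar_op :: complex \<Rightarrow> 'a :: complex_inner bdd_op)"
proof (rule bounded_linear_intro[of _ 1])
  show "norm (scalar_op c :: 'a bdd_op) \<le> norm c * 1" for c
    using norm_scalar_op_le by simp
qed (auto intro!: op_eqI simp: scalar_op_apply op_simps scaleC_add_left scaleR_eq_scaleC scaleC_scaleC scaleR_conv_of_real)

lemma adjoint_scalar_op: "adjoint_op (scalar_op c) = scalar_op (cnj c)"
  by (rule adjoint_unique) (simp add: scalar_op_apply cinner_simps)

section \<open>Unitary operators and reflections\<close>

lemma unitary_ops_iff: "W \<in> unitary_ops \<longleftrightarrow> adjoint_op W * W = 1 \<and> W * adjoint_op W = 1"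
  by (simp add: unitary_ops_def op_comp_eq_times op_id_eq_one)

lemma unitary_mult_assoc:
  assumes "W \<in> unitary_ops"
  shows "adjoint_op W * (W * T) = T" "W * (adjoint_op W * T) = T"
  using assms by (simp_all add: unitary_ops_iff flip: mult.assoc)

lemma unitary_mult:
  assumes "V \<in> unitary_ops" "W \<in> unitary_ops"
  shows "V * W \<in> unitary_ops"
  using assms unitary_mult_assoc[OF assms(1)] unitary_mult_assoc[OF assms(2)]
  by (simp add: unitary_ops_iff adjoint_simps mult.assoc)

lemma unitary_adjoint: "W \<in> unitary_ops \<Longrightarrow> adjoint_op W \<in> unitary_ops"
  by (auto simp: unitary_ops_iff)

lemma unitary_norm:
  assumes "W \<in> unitary_ops"
  shows "norm (W \<cdot> x) = norm x"
proof -
  have "adjoint_op W \<cdot> W \<cdot> x = x"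
    using assms by (simp add: unitary_ops_iff op_one_apply flip: op_mult_apply)
  then have "cinner (W \<cdot> x) (W \<cdot> x) = cinner x x"
    by (metis cinner_adjoint_right)
  then have "(norm (W \<cdot> x))\<^sup>2 = (norm x)\<^sup>2"
    unfolding cinner_self of_real_eq_iff .
  then show ?thesis by (rule power2_eq_imp_eq) auto
qed

definition skew_ops :: "'a :: complex_hilbert bdd_op set"
  where "skew_ops = {A. adjoint_op A = - A}"

lemma subspace_skew: "subspace skew_ops"
  by (auto simp: subspace_def skew_ops_def adjoint_simps)

lemma cayley_skew:
  assumes A: "A \<in> skew_ops" "norm A < 1"
  shows "adjoint_op (cayley A) = cayley (- A)" "cayley A \<in> unitary_ops"
proof -
  have inv: "has_inverse (1 - A)" "has_inverse (1 + A)"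
    using A(2) by (auto intro: has_inverse_one_minus has_inverse_one_plus)
  show *: "adjoint_op (cayley A) = cayley (- A)"
    using A(1) adjoint_cayley[OF inv(1)] by (simp add: skew_ops_def)
  show "cayley A \<in> unitary_ops"
    unfolding unitary_ops_iff *
    using cayley_mult_cayley_minus[OF inv] cayley_mult_cayley_minus[of "- A"] inv by simp
qed

lemma cayley_unitary_iff:
  assumes A: "norm A < 1"
  shows "cayley A \<in> unitary_ops \<longleftrightarrow> A \<in> skew_ops"
proof
  assume u: "cayley A \<in> unitary_ops"
  note c = cayley_coord_cayley[OF has_inverse_one_minus[OF A]]
  have "cayley_coord (adjoint_op (cayley A)) = - cayley_coord (cayley A)"
    using u c(1) by (intro cayley_coord_inverse) (auto simp: unitary_ops_iff)
  then show "A \<in> skew_ops"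
    using adjoint_cayley_coord[OF c(1)] c(2) by (simp add: skew_ops_def)
qed (use A cayley_skew in blast)

text \<open>
  Take \<open>W = (1 + X) (1 - X\<^sup>2)\<^sup>-\<^sup>1\<^sup>/\<^sup>2\<close>, the unitary part of \<open>1 + X\<close>. The square root \<open>1 + Y\<close> of \<open>1 - X\<^sup>2\<close> is
  found in the closed set of self-adjoint operators commuting with \<open>S\<close> and \<open>X\<close>, so that
  \<open>W S W\<^sup>* = (1 + X) S (1 + X)\<^sup>-\<^sup>1 = (1 + X) (1 - X)\<^sup>-\<^sup>1 S\<close>.
\<close>

lemma anticommuting_cayley_conjugate:
  fixes S X :: "'a :: complex_hilbert bdd_op"
  assumes S: "S * S = 1" "adjoint_op S = S" and X: "X \<in> skew_ops" "X * S = - (S * X)" "norm X \<le> 1 / 2"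
  obtains W where "W \<in> unitary_ops" "cayley X * S = W * S * adjoint_op W"
proof -
  let ?Z = "- (X * X)"
  let ?C = "{Y. adjoint_op Y = Y \<and> S * Y = Y * S \<and> X * Y = Y * X}"
  have adjX: "adjoint_op X = - X" using X by (simp add: skew_ops_def)
  have SX: "S * X = - (X * S)" using X(2) by simp
  have SXX: "S * (X * X) = X * X * S"
  proof -
    have "S * (X * X) = (S * X) * X" by (simp add: mult.assoc)
    also have "\<dots> = - (X * (S * X))" by (simp add: SX mult.assoc)
    also have "\<dots> = X * X * S" by (simp add: SX mult.assoc)
    finally show ?thesis .
  qed
  have "norm X * norm X \<le> (1 / 2) * (1 / 2)" using X(3) by (intro mult_mono) auto
  then have Z: "norm ?Z \<le> 1 / 2" using norm_mult_ineq[of X X] by simp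
  have "closed ?C"
    by (intro closed_Collect_conj closed_Collect_eq continuous_intros
        bounded_linear.continuous_on[OF bounded_linear_adjoint])
  moreover have "(1 / 2) *\<^sub>R (?Z - Y * Y) \<in> ?C" if "Y \<in> ?C" for Y
  proof -
    have Y: "adjoint_op Y = Y" "S * Y = Y * S" "X * Y = Y * X" using that by auto
    have "S * (Y * Y) = Y * Y * S" "X * (Y * Y) = Y * Y * X"
      using Y by (metis mult.assoc)+
    then show ?thesis
      using Y SXX by (simp add: adjoint_simps adjX algebra_simps)
  qed
  ultimately obtain Y where Y: "(1 + Y) * (1 + Y) = 1 + ?Z" "Y \<in> ?C" "norm Y \<le> 1 / 2"
    using square_root_near_one[OF Z, of ?C] by auto
  define J where "J = inv_elt (1 + Y)"
  have inv: "has_inverse (1 + Y)" using Y(3) by (intro has_inverse_one_plus) auto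
  have J: "adjoint_op J = J" "J * S = S * J" "J * X = X * J"
    unfolding J_def using adjoint_inv_elt[OF inv] Y(2)
    by (auto simp: adjoint_simps algebra_simps intro!: inv_elt_commute[OF inv])
  have YX: "(1 + Y) * (1 + Y) = (1 + X) * (1 - X)" "(1 + Y) * (1 + Y) = (1 - X) * (1 + X)"
    using Y(1) by (simp_all add: algebra_simps)
  have JJ: "J * J * ((1 + Y) * (1 + Y)) = 1" "(1 + Y) * (1 + Y) * (J * J) = 1"
    unfolding J_def using inv by (simp_all add: mult.assoc)
  have JX: "J * (1 - X) = (1 - X) * J" "J * (1 + X) = (1 + X) * J" using J(3) by (simp_all add: algebra_simps)
  define W where "W = (1 + X) * J"
  have adjW: "adjoint_op W = J * (1 - X)"
    unfolding W_def by (simp add: adjoint_simps adjX J)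
  have 1: "W * adjoint_op W = (1 + X) * (1 - X) * (J * J)"
  proof -
    have "W * adjoint_op W = (1 + X) * (J * (J * (1 - X)))" unfolding adjW by (simp add: W_def mult.assoc)
    also have "\<dots> = (1 + X) * ((J * (1 - X)) * J)" by (simp only: mult.assoc JX(1)[symmetric])
    finally show ?thesis unfolding JX(1) by (simp only: mult.assoc)
  qed
  have 2: "adjoint_op W * W = (1 - X) * (1 + X) * (J * J)"
  proof -
    have "adjoint_op W * W = (J * (1 - X)) * ((1 + X) * J)" unfolding adjW by (simp add: W_def mult.assoc)
    also have "\<dots> = (1 - X) * ((J * (1 + X)) * J)" unfolding JX(1) by (simp only: mult.assoc)
    finally show ?thesis unfolding JX(2) by (simp only: mult.assoc)
  qed
  have W: "W \<in> unitary_ops"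
    unfolding unitary_ops_iff 1 2 using JJ(2) YX by simp
  have invX: "has_inverse (1 - X)" "has_inverse (1 + X)"
    using X(3) by (auto intro!: has_inverse_one_minus has_inverse_one_plus)
  have "W * S * adjoint_op W = (1 + X) * S * ((1 - X) * (J * J))"
  proof -
    have "W * S * adjoint_op W = (1 + X) * ((J * S) * (J * (1 - X)))"
      unfolding adjW by (simp add: W_def mult.assoc)
    also have "\<dots> = (1 + X) * (S * ((J * (1 - X)) * J))"
      unfolding J(2) by (simp only: mult.assoc JX(1)[symmetric])
    also have "\<dots> = (1 + X) * S * ((1 - X) * (J * J))"
      unfolding JX(1) by (simp only: mult.assoc)
    finally show ?thesis .
  qed
  also have "(1 - X) * (J * J) = inv_elt (1 + X)"
  proof -
    have "(1 + X) * ((1 - X) * (J * J)) = 1" using JJ(2) YX by (simp add: mult.assoc)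
    then show ?thesis using inv_elt_left_assoc[OF invX(2), of "(1 - X) * (J * J)"] by simp
  qed
  also have "(1 + X) * S * inv_elt (1 + X) = (1 + X) * (inv_elt (1 - X) * S)"
  proof -
    have "(1 - X) * S = S * (1 + X)" using X(2) by (simp add: algebra_simps)
    then have "S = inv_elt (1 - X) * (S * (1 + X))" using invX(1) inv_elt_left_assoc by metis
    then have "S * inv_elt (1 + X) = inv_elt (1 - X) * S"
      using invX(2) by (metis inv_elt_right mult.assoc mult_1_right)
    then show ?thesis by (simp add: mult.assoc)
  qed
  finally have "cayley X * S = W * S * adjoint_op W"
    by (simp add: cayley_def mult.assoc)
  with W show ?thesis by (rule that)
qed

text \<open>
  Projections correspond to self-adjoint involutions, whose products are unitary and have Cayley
  coordinates.
\<close>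

definition reflection :: "'a :: complex_inner bdd_op \<Rightarrow> 'a bdd_op"
  where "reflection P = 2 *\<^sub>R P - 1"

definition of_reflection :: "'a :: complex_inner bdd_op \<Rightarrow> 'a bdd_op"
  where "of_reflection S = (1 / 2) *\<^sub>R (S + 1)"

lemma of_reflection_reflection [simp]: "of_reflection (reflection P) = P"
  and reflection_of_reflection [simp]: "reflection (of_reflection S) = S"
  by (simp_all add: of_reflection_def reflection_def)

lemma projections_iff_reflection:
  "P \<in> projections \<longleftrightarrow> reflection P * reflection P = 1 \<and> adjoint_op (reflection P) = reflection P"
proof -
  define Q where "Q = 2 *\<^sub>R P"
  have "reflection P * reflection P = 1 \<longleftrightarrow> Q * Q = Q + Q"
    by (auto simp: reflection_def Q_def[symmetric] algebra_simps)
  moreover have "Q * Q = 4 *\<^sub>R (P * P)" "Q + Q = 4 *\<^sub>R P"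
    by (simp_all add: Q_def flip: scaleR_add_left)
  ultimately have "reflection P * reflection P = 1 \<longleftrightarrow> P * P = P" by simp
  moreover have "adjoint_op (reflection P) = reflection P \<longleftrightarrow> adjoint_op P = P"
    by (auto simp: reflection_def adjoint_simps)
  ultimately show ?thesis by (simp add: projections_def op_comp_eq_times)
qed

lemma reflection_apply_iff: "reflection P \<cdot> f = f \<longleftrightarrow> P \<cdot> f = f"
proof -
  have "reflection P \<cdot> f - f = 2 *\<^sub>R (P \<cdot> f - f)"
    by (simp add: reflection_def op_simps algebra_simps scaleR_2)
  then show ?thesis by (auto simp: algebra_simps)
qed

lemma reflection_conjugate:
  "V * V' = 1 \<Longrightarrow> reflection (V * P * V') = V * reflection P * V'"
  by (simp add: reflection_def algebra_simps)

lemma of_reflection_conjugate: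
  "V * V' = 1 \<Longrightarrow> of_reflection (V * S * V') = V * of_reflection S * V'"
  by (simp add: of_reflection_def algebra_simps)

lemma proj_vectors_iff:
  "(P, f) \<in> proj_vectors \<longleftrightarrow> reflection P * reflection P = 1 \<and>
    adjoint_op (reflection P) = reflection P \<and> reflection P \<cdot> f = f \<and> norm f = 1"
  by (auto simp: proj_vectors_def projections_iff_reflection reflection_apply_iff)

lemma rho_eq: "rho (P0, f0) U = (U * P0 * adjoint_op U, U \<cdot> f0)"
  by (simp add: rho_def op_comp_eq_times)

lemma proj_vectors_orbit_iff: "(P, f) \<in> proj_vectors_orbit P0 \<longleftrightarrow>
    (P, f) \<in> proj_vectors \<and> (\<exists>W\<in>unitary_ops. P = W * P0 * adjoint_op W)"
  by (auto simp: proj_vectors_orbit_def op_comp_eq_times)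

lemma unitary_action_proj_vectors:
  assumes U: "U \<in> unitary_ops" and p: "(P, f) \<in> proj_vectors"
  shows "(U * P * adjoint_op U, U \<cdot> f) \<in> proj_vectors"
proof -
  have e: "reflection (U * P * adjoint_op U) = U * reflection P * adjoint_op U"
    using U by (intro reflection_conjugate) (simp add: unitary_ops_iff)
  have p': "reflection P * reflection P = 1" "adjoint_op (reflection P) = reflection P"
    "reflection P \<cdot> f = f" "norm f = 1" using p by (auto simp: proj_vectors_iff)
  have r: "reflection P * (reflection P * T) = T" for T using p'(1) by (simp flip: mult.assoc)
  have "(U * reflection P * adjoint_op U) \<cdot> (U \<cdot> f) = (U * reflection P * (adjoint_op U * U)) \<cdot> f"
    by (simp add: op_simps)
  also have "\<dots> = U \<cdot> f" using U by (simp add: unitary_ops_iff op_simps p')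
  finally show ?thesis
    unfolding proj_vectors_iff e
    using U p' unitary_mult_assoc[OF U] r
    by (simp add: adjoint_simps mult.assoc unitary_norm unitary_ops_iff)
qed

lemma rho_orbit:
  assumes "(P0, f0) \<in> proj_vectors" "U \<in> unitary_ops"
  shows "rho (P0, f0) U \<in> proj_vectors_orbit P0"
  using unitary_action_proj_vectors[OF assms(2,1)] assms(2)
  by (auto simp: rho_eq proj_vectors_orbit_iff)

section \<open>Stereographic projection of the unit sphere\<close>

text \<open>
  The inversion \<open>y \<mapsto> y / norm y\<^sup>2\<close> about the centre \<open>- f\<close> sends the unit sphere through \<open>- f\<close> to a real
  hyperplane; the shift by \<open>f / 2\<close> moves this hyperplane through the origin.
\<close>

definition stereo :: "'a :: complex_hilbert \<Rightarrow> 'a \<Rightarrow> 'a"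
  where "stereo f g = inverse ((norm (g + f))\<^sup>2) *\<^sub>R (g + f) - (1 / 2) *\<^sub>R f"

definition stereo_inv :: "'a :: complex_hilbert \<Rightarrow> 'a \<Rightarrow> 'a"
  where "stereo_inv f w = inverse ((norm (w + (1 / 2) *\<^sub>R f))\<^sup>2) *\<^sub>R (w + (1 / 2) *\<^sub>R f) - f"

text \<open>
  The requirement behind this formula is that the Cayley transform \<open>V\<close> of \<open>Y = tilt f w\<close> satisfy
  \<open>V f = g\<close>, where \<open>w\<close> is the stereographic coordinate of \<open>g\<close>. It amounts to \<open>Y (g + f) = g - f\<close>, and in
  terms of \<open>w\<close> it follows from \<open>Y f = 2 w\<close> and \<open>Y w = - 2 norm w\<^sup>2 f\<close>. The scalar summand corrects the
  phase that the rank two part produces when \<open>cinner f w\<close> is imaginary.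
\<close>

definition tilt :: "'a :: complex_hilbert \<Rightarrow> 'a \<Rightarrow> 'a bdd_op"
  where "tilt f w = 2 *\<^sub>R (rank_one w f - rank_one f w - scalar_op (\<i> * of_real (Im (cinner f w))))"

definition rotation :: "'a :: complex_hilbert \<Rightarrow> 'a \<Rightarrow> 'a bdd_op"
  where "rotation f w = cayley (tilt f w)"

lemma inversion_involution:
  fixes y :: "'a :: real_normed_vector"
  assumes "y \<noteq> 0"
  defines "z \<equiv> inverse ((norm y)\<^sup>2) *\<^sub>R y"
  shows "inverse ((norm z)\<^sup>2) *\<^sub>R z = y" "z \<noteq> 0"
proof -
  have "(norm z)\<^sup>2 = inverse ((norm y)\<^sup>2)"
    using assms(1) by (simp add: z_def power_mult_distrib power2_eq_square)
  then show "inverse ((norm z)\<^sup>2) *\<^sub>R z = y" "z \<noteq> 0" using assms(1) by (auto simp: z_def)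
qed

lemma stereo_inv_stereo:
  assumes "g \<noteq> - f"
  shows "stereo_inv f (stereo f g) = g"
  using inversion_involution(1)[of "g + f"] assms by (simp add: stereo_def stereo_inv_def eq_neg_iff_add_eq_0)

lemma stereo_stereo_inv:
  assumes "w \<noteq> - (1 / 2) *\<^sub>R f"
  shows "stereo f (stereo_inv f w) = w" "stereo_inv f w \<noteq> - f"
  using inversion_involution[of "w + (1 / 2) *\<^sub>R f"] assms
  by (auto simp: stereo_def stereo_inv_def eq_neg_iff_add_eq_0)

lemma small_not_pole:
  assumes "norm f = 1" "norm w < 1 / 6"
  shows "w \<noteq> - (1 / 2) *\<^sub>R f"
  using assms by auto

lemma stereo_self: "norm f = 1 \<Longrightarrow> stereo f f = 0"
  by (simp add: stereo_def power2_eq_square flip: scaleR_2)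

lemma norm_stereo_inv:
  assumes f: "norm f = 1" and w: "w \<noteq> - (1 / 2) *\<^sub>R f"
  shows "norm (stereo_inv f w) = 1 \<longleftrightarrow> Re (cinner f w) = 0"
proof -
  define z where "z = w + (1 / 2) *\<^sub>R f"
  define c where "c = inverse ((norm z)\<^sup>2)"
  have z: "norm z > 0" using w by (simp add: z_def eq_neg_iff_add_eq_0)
  have zz: "c * c * (norm z)\<^sup>2 = c" "c > 0" using z by (auto simp: c_def)
  have e: "stereo_inv f w = c *\<^sub>R z - f" by (simp add: stereo_inv_def z_def c_def)
  have "(norm (stereo_inv f w))\<^sup>2 = c * c * (norm z)\<^sup>2 - 2 * c * Re (cinner z f) + 1"
    using norm_add_squared[of "c *\<^sub>R z" "- f"] f
    by (simp add: e cinner_simps power_mult_distrib power2_eq_square[of c])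
  also have "\<dots> = 1 - 2 * c * Re (cinner f w)"
    using Re_cinner_commute[of w f] f unfolding zz
    by (simp add: z_def cinner_simps cinner_self algebra_simps)
  finally have "(norm (stereo_inv f w))\<^sup>2 = 1 \<longleftrightarrow> Re (cinner f w) = 0" using zz(2) by simp
  then show ?thesis by (simp add: abs_square_eq_1 power2_eq_1_iff)
qed

lemma scalar_op_minus: "scalar_op (- c) = - scalar_op c"
  using bounded_linear.linear[OF bounded_linear_scalar_op] by (rule linear_neg)

lemma scaleC_minus_left: "(- c) *\<^sub>C x = - (c *\<^sub>C x)" for x :: "'a :: complex_inner"
  by (rule bounded_bilinear.minus_left[OF bounded_bilinear_scaleC])

lemma tilt_skew: "tilt f w \<in> skew_ops"
  by (simp add: tilt_def skew_ops_def adjoint_simps adjoint_rank_one adjoint_scalar_op scalar_op_minus)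
    (simp add: algebra_simps)

lemma norm_tilt_le:
  assumes "norm f = 1"
  shows "norm (tilt f w) \<le> 6 * norm w"
proof -
  have "cmod (\<i> * of_real (Im (cinner f w))) \<le> norm w"
    using abs_Im_le_cmod[of "cinner f w"] cinner_norm_le[of f w] assms by (simp add: norm_mult)
  then have "norm (scalar_op (\<i> * of_real (Im (cinner f w))) :: 'a bdd_op) \<le> norm w"
    using norm_scalar_op_le order_trans by blast
  moreover have "norm (rank_one w f - rank_one f w) \<le> norm w + norm w"
    using norm_triangle_ineq4[of "rank_one w f" "rank_one f w"]
      norm_rank_one_le[of w f] norm_rank_one_le[of f w] assms by simp
  ultimately have "norm (rank_one w f - rank_one f w - scalar_op (\<i> * of_real (Im (cinner f w)))) \<le> 3 * norm w"
    using norm_triangle_ineq4[of "rank_one w f - rank_one f w" "scalar_op (\<i> * of_real (Im (cinner f w)))"]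
    by linarith
  then show ?thesis by (simp add: tilt_def)
qed

lemma bounded_linear_tilt:
  assumes "norm f = 1"
  shows "bounded_linear (tilt f)"
proof (rule bounded_linear_intro)
  interpret r: bounded_bilinear rank_one by (rule bounded_bilinear_rank_one)
  interpret s: bounded_linear scalar_op by (rule bounded_linear_scalar_op)
  show "tilt f (v + w) = tilt f v + tilt f w" for v w
  proof -
    have "\<i> * of_real (Im (cinner f (v + w))) = \<i> * of_real (Im (cinner f v)) + \<i> * of_real (Im (cinner f w))"
      by (simp add: cinner_simps algebra_simps)
    then show ?thesis
      by (simp add: tilt_def r.add_left r.add_right s.add algebra_simps)
  qed
  show "tilt f (c *\<^sub>R w) = c *\<^sub>R tilt f w" for c w
  proof -
    have "\<i> * of_real (Im (cinner f (c *\<^sub>R w))) = c *\<^sub>R (\<i> * of_real (Im (cinner f w)))"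
      by (simp add: cinner_simps scaleR_conv_of_real)
    then show ?thesis
      by (simp add: tilt_def r.scaleR_left r.scaleR_right s.scaleR algebra_simps)
  qed
  show "norm (tilt f w) \<le> norm w * 6" for w using norm_tilt_le[OF assms, of w] by simp
qed

lemma tilt_minus: "norm f = 1 \<Longrightarrow> tilt f (- w) = - tilt f w"
  using bounded_linear.linear[OF bounded_linear_tilt] linear_neg by blast

lemma rotation_zero [simp]: "norm f = 1 \<Longrightarrow> rotation f 0 = 1"
  using bounded_linear.linear[OF bounded_linear_tilt[of f]] by (simp add: rotation_def linear_0)

lemma rotation_unitary:
  assumes f: "norm f = 1" and w: "norm w < 1 / 6"
  shows "rotation f w \<in> unitary_ops" "adjoint_op (rotation f w) = rotation f (- w)"
    "rotation f w * rotation f (- w) = 1" "rotation f (- w) * rotation f w = 1"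
proof -
  have "norm (tilt f w) < 1" using norm_tilt_le[OF f, of w] w by simp
  from cayley_skew[OF tilt_skew this] show *: "rotation f w \<in> unitary_ops"
    "adjoint_op (rotation f w) = rotation f (- w)"
    by (simp_all add: rotation_def tilt_minus f)
  then show "rotation f w * rotation f (- w) = 1" "rotation f (- w) * rotation f w = 1"
    by (auto simp: unitary_ops_iff)
qed

text \<open>
  With \<open>z = w + f / 2\<close> and \<open>norm z\<^sup>2 = norm w\<^sup>2 + 1 / 4\<close>, the values of \<open>Y = tilt f w\<close> at \<open>f\<close> and \<open>w\<close> give
  \<open>(1 - Y) z = 2 norm z\<^sup>2 f\<close>. Dividing by \<open>norm z\<^sup>2\<close> and subtracting \<open>(1 - Y) f\<close> yields
  \<open>(1 - Y) (stereo_inv f w) = (1 + Y) f\<close>.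
\<close>

lemma rotation_apply:
  assumes f: "norm f = 1" and w: "norm w < 1 / 6" "Re (cinner f w) = 0"
  shows "rotation f w \<cdot> f = stereo_inv f w"
proof -
  let ?Y = "tilt f w" and ?z = "w + (1 / 2) *\<^sub>R f"
  define c where "c = inverse ((norm ?z)\<^sup>2)"
  have z: "norm ?z > 0" using small_not_pole[OF f w(1)] by (simp add: eq_neg_iff_add_eq_0)
  have fw: "cinner f w = \<i> * of_real (Im (cinner f w))"
    by (rule complex_eqI) (use w(2) in auto)
  have wf: "cinner w f = - cinner f w"
    by (rule complex_eqI) (use w(2) Re_cinner_commute[of w f] Im_cinner_commute[of w f] in auto)
  have Yf: "?Y \<cdot> f = 2 *\<^sub>R w"
    using f by (simp add: tilt_def op_simps rank_one_apply scalar_op_apply wf cinner_self scaleC_one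
        scaleC_minus_left flip: fw)
  have Yw: "?Y \<cdot> w = - (2 * (norm w)\<^sup>2) *\<^sub>R f"
    using f by (simp add: tilt_def op_simps rank_one_apply scalar_op_apply cinner_self flip: fw)
      (simp add: scaleR_eq_scaleC scaleC_scaleC scaleC_minus_right)
  have zz: "(norm ?z)\<^sup>2 = 1 / 4 + (norm w)\<^sup>2"
    using norm_add_squared[of w "(1 / 2) *\<^sub>R f"] f w(2) Re_cinner_commute[of w f]
    by (simp add: cinner_simps power2_eq_square)
  have Yz: "?Y \<cdot> ?z = ?z - (2 * (norm ?z)\<^sup>2) *\<^sub>R f"
    unfolding zz by (simp add: op_simps Yf Yw algebra_simps flip: scaleR_add_left)
  have "(1 - ?Y) \<cdot> stereo_inv f w = (1 + ?Y) \<cdot> f"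
  proof -
    have "(1 - ?Y) \<cdot> (c *\<^sub>R z - f) = c *\<^sub>R (z - ?Y \<cdot> z) - f + ?Y \<cdot> f" for z
      by (simp add: op_simps algebra_simps)
    then have "(1 - ?Y) \<cdot> stereo_inv f w = c *\<^sub>R (?z - ?Y \<cdot> ?z) - f + ?Y \<cdot> f"
      by (simp add: stereo_inv_def c_def)
    also have "?z - ?Y \<cdot> ?z = (2 * (norm ?z)\<^sup>2) *\<^sub>R f" unfolding Yz by simp
    also have "c *\<^sub>R \<dots> = 2 *\<^sub>R f" using z by (simp add: c_def)
    finally show ?thesis by (simp add: op_simps scaleR_2)
  qed
  moreover have inv: "has_inverse (1 - ?Y)"
    using norm_tilt_le[OF f, of w] w by (intro has_inverse_one_minus) simp
  ultimately have "stereo_inv f w = inv_elt (1 - ?Y) \<cdot> (1 + ?Y) \<cdot> f"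
    by (metis inv_elt_left op_mult_apply op_one_apply)
  then show ?thesis
    by (simp add: rotation_def cayley_commuted[OF inv] op_mult_apply)
qed

lemma analytic_at_norm_squared:
  fixes f :: "'b :: real_normed_vector \<Rightarrow> 'a :: complex_inner"
  assumes f: "analytic_at S x f"
  shows "analytic_at S x (\<lambda>u. (norm (f u))\<^sup>2)"
proof -
  have "analytic_at S x (\<lambda>u. Re (cinner (f u) (f u)))"
    by (intro analytic_at_bounded_linear[OF bounded_linear_Re] analytic_at_bilinear[OF bounded_bilinear_cinner] f)
  then show ?thesis by (simp add: cinner_self)
qed

lemma analytic_at_stereo:
  assumes g: "analytic_at S x g" and S: "subspace S" and f: "g x \<noteq> - f"
  shows "analytic_at S x (\<lambda>u. stereo f (g u))"
  unfolding stereo_def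
  by (intro analytic_at_diff analytic_at_scaleR analytic_at_inverse_real analytic_at_norm_squared
      analytic_at_add analytic_at_const g S) (use f in \<open>simp add: eq_neg_iff_add_eq_0\<close>)

lemma analytic_at_stereo_inv:
  assumes g: "analytic_at S x g" and S: "subspace S" and f: "g x \<noteq> - (1 / 2) *\<^sub>R f"
  shows "analytic_at S x (\<lambda>u. stereo_inv f (g u))"
  unfolding stereo_inv_def
  by (intro analytic_at_diff analytic_at_scaleR analytic_at_inverse_real analytic_at_norm_squared
      analytic_at_add analytic_at_const g S) (use f in \<open>simp add: eq_neg_iff_add_eq_0\<close>)

lemma analytic_at_rotation:
  assumes g: "analytic_at S x g" and S: "subspace S" and f: "norm f = 1" "norm (g x) < 1 / 6"
  shows "analytic_at S x (\<lambda>u. rotation f (g u))"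
  unfolding rotation_def
  by (intro analytic_at_cayley analytic_at_bounded_linear[OF bounded_linear_tilt] g S f has_inverse_one_minus)
    (use norm_tilt_le[OF f(1), of "g x"] f(2) in simp)

section \<open>Charts from explicit inverse maps\<close>

text \<open>
  The chart is a map \<open>\<phi>\<close> given together with a formula \<open>\<theta>\<close> for its inverse, and its domain is cut out by
  prescribing the image \<open>\<Omega>\<close>. The submanifold enters only through the parametrisation \<open>\<theta>\<close>.
\<close>

lemma slice_chart_explicit:
  fixes \<phi> \<theta> :: "'a :: banach \<Rightarrow> 'a"
  assumes D: "open D" "\<And>p. p \<in> D \<Longrightarrow> analytic_at UNIV p \<phi>"
    and \<Omega>: "open \<Omega>" "\<And>\<omega>. \<omega> \<in> \<Omega> \<Longrightarrow> analytic_at UNIV \<omega> \<theta>"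
    and left: "\<And>p. p \<in> D \<Longrightarrow> \<phi> p \<in> \<Omega> \<Longrightarrow> \<theta> (\<phi> p) = p"
    and right: "\<And>\<omega>. \<omega> \<in> \<Omega> \<Longrightarrow> \<theta> \<omega> \<in> D" "\<And>\<omega>. \<omega> \<in> \<Omega> \<Longrightarrow> \<phi> (\<theta> \<omega>) = \<omega>"
    and F: "complemented_in UNIV F" and M: "\<And>\<omega>. \<omega> \<in> \<Omega> \<Longrightarrow> \<theta> \<omega> \<in> M \<longleftrightarrow> \<omega> \<in> F"
    and U: "U = {p \<in> D. \<phi> p \<in> \<Omega>}"
  shows "slice_chart r M U \<phi> F" "\<phi> ` U = \<Omega>" "\<And>\<omega>. \<omega> \<in> \<Omega> \<Longrightarrow> inv_into U \<phi> \<omega> = \<theta> \<omega>"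
proof -
  have "continuous_on D \<phi>"
    by (intro continuous_at_imp_continuous_on ballI analytic_at_isCont D)
  then have "open (D \<inter> \<phi> -` \<Omega>)" using D(1) \<Omega>(1) by (intro continuous_open_preimage)
  also have "D \<inter> \<phi> -` \<Omega> = U" unfolding U by auto
  finally have openU: "open U" .
  have inj: "inj_on \<phi> U" by (rule inj_on_inverseI[of _ \<theta>]) (use left U in auto)
  show im: "\<phi> ` U = \<Omega>"
    using right unfolding U by (auto simp: image_iff) metis
  show inv: "inv_into U \<phi> \<omega> = \<theta> \<omega>" if "\<omega> \<in> \<Omega>" for \<omega>
    by (rule inv_into_f_eq[OF inj]) (use right that U in auto)
  have "analytic_at UNIV \<omega> (inv_into U \<phi>)" if "\<omega> \<in> \<Omega>" for \<omega>
  proof -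
    obtain e where "e > 0" "ball \<omega> e \<subseteq> \<Omega>" using \<Omega>(1) \<open>\<omega> \<in> \<Omega>\<close> openE by blast
    then show ?thesis
      by (intro analytic_at_cong[OF \<Omega>(2)[OF that], of e] inv) (auto simp: subset_iff dist_norm)
  qed
  then have "of_class r UNIV (\<phi> ` U) (inv_into U \<phi>)"
    unfolding im using \<Omega>(1) by (intro of_class_analytic) auto
  moreover have "of_class r UNIV U \<phi>"
    using openU D(2) U by (intro of_class_analytic) auto
  moreover have "\<phi> ` (U \<inter> M) = \<phi> ` U \<inter> F"
  proof (intro set_eqI iffI)
    fix \<omega> assume "\<omega> \<in> \<phi> ` (U \<inter> M)"
    then obtain p where p: "p \<in> U" "p \<in> M" "\<omega> = \<phi> p" by blast
    then show "\<omega> \<in> \<phi> ` U \<inter> F" using M[of \<omega>] left[of p] U by auto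
  next
    fix \<omega> assume "\<omega> \<in> \<phi> ` U \<inter> F"
    then have "\<omega> \<in> \<Omega>" "\<omega> \<in> F" using im by auto
    then show "\<omega> \<in> \<phi> ` (U \<inter> M)"
      using M[of \<omega>] right[of \<omega>] U by (intro image_eqI[of _ _ "\<theta> \<omega>"]) auto
  qed
  ultimately show "slice_chart r M U \<phi> F"
    unfolding slice_chart_def using openU \<Omega>(1) im inj F by auto
qed

lemma complemented_range:
  assumes p: "bounded_linear p" "\<And>x. p x \<in> F" "\<And>x. x \<in> F \<Longrightarrow> p x = x"
  shows "subspace F" "closed F" "complemented_in UNIV F"
proof -
  interpret p: bounded_linear p by fact
  have F: "F = {x. p x = x}" using p by (auto, metis)
  show sub: "subspace F" unfolding F subspace_def by (auto simp: p.add p.scale)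
  have cont: "continuous_on UNIV p" using p.continuous_on[OF continuous_on_id] by simp
  show cl: "closed F" unfolding F by (intro closed_Collect_eq cont continuous_on_id)
  let ?G = "{x. p x = 0}"
  have "subspace ?G" by (auto simp: subspace_def p.add p.scale)
  moreover have "closed ?G" by (intro closed_Collect_eq cont continuous_on_const)
  moreover have "F \<inter> ?G = {0}" using sub by (auto simp: F subspace_0)
  moreover have "{x + y | x y. x \<in> F \<and> y \<in> ?G} = UNIV"
  proof -
    have "x = p x + (x - p x) \<and> p x \<in> F \<and> x - p x \<in> ?G" for x
      using p by (simp add: p.diff)
    then show ?thesis by blast
  qed
  ultimately show "complemented_in UNIV F"
    unfolding complemented_in_def using sub cl by blast
qed

text \<open>
  The complement of the kernel of \<open>L\<close> is the range of \<open>s\<close>, which is closed because it is the set of fixed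
  points of the continuous map \<open>s \<circ> L\<close>.
\<close>

lemma right_inverse_surjective_split:
  assumes F: "subspace F" "closed F" and L: "bounded_linear L" and s: "bounded_linear s"
    and LF: "\<And>v. v \<in> F \<Longrightarrow> L v \<in> G" and sG: "\<And>w. w \<in> G \<Longrightarrow> s w \<in> F" "\<And>w. w \<in> G \<Longrightarrow> L (s w) = w"
  shows "L ` F = G" "complemented_in F {v \<in> F. L v = 0}"
proof -
  interpret L: bounded_linear L by fact
  interpret s: bounded_linear s by fact
  have contL: "continuous_on UNIV L" using L.continuous_on[OF continuous_on_id] by simp
  have contsL: "continuous_on UNIV (\<lambda>v. s (L v))" by (rule s.continuous_on[OF contL])
  show "L ` F = G" using LF sG by (force simp: image_iff)
  let ?H = "{v \<in> F. s (L v) = v}" and ?K = "{v \<in> F. L v = 0}"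
  have cl: "closed (F \<inter> {v. s (L v) = v})" "closed (F \<inter> {v. L v = 0})"
    by (intro closed_Int F closed_Collect_eq contL contsL continuous_on_id continuous_on_const)+
  have "subspace ?H" "subspace ?K"
    using F(1) by (auto simp: subspace_def L.add L.scale s.add s.scale)
  moreover have "closed ?H" "closed ?K" using cl by (simp_all add: Int_def)
  moreover have "?K \<inter> ?H = {0}" using subspace_0[OF F(1)] by auto
  moreover have "{x + y | x y. x \<in> ?K \<and> y \<in> ?H} = F"
  proof (intro set_eqI iffI)
    fix v assume "v \<in> {x + y | x y. x \<in> ?K \<and> y \<in> ?H}"
    then show "v \<in> F" using F(1) by (auto intro: subspace_add)
  next
    fix v assume v: "v \<in> F"
    then have "v = (v - s (L v)) + s (L v)" "v - s (L v) \<in> ?K" "s (L v) \<in> ?H"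
      using F(1) LF sG by (auto simp: L.diff intro: subspace_diff)
    then show "v \<in> {x + y | x y. x \<in> ?K \<and> y \<in> ?H}" by blast
  qed
  ultimately show "complemented_in F ?K" unfolding complemented_in_def by blast
qed

lemma has_derivative_within_line:
  assumes f: "(f has_derivative L) (at x within S)" and S: "subspace S" "x \<in> S" "v \<in> S"
  shows "((\<lambda>t. f (x + t *\<^sub>R v)) has_vector_derivative L v) (at 0)"
proof -
  have "((\<lambda>t. x + t *\<^sub>R v) has_derivative (\<lambda>t. t *\<^sub>R v)) (at 0)"
    by (auto intro!: derivative_eq_intros)
  moreover have "(f has_derivative L) (at (x + 0 *\<^sub>R v) within range (\<lambda>t. x + t *\<^sub>R v))"
    using f by (rule_tac has_derivative_subset[of _ _ _ S]) (use S in \<open>auto intro: subspace_add subspace_scale\<close>)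
  ultimately have "((\<lambda>t. f (x + t *\<^sub>R v)) has_derivative (\<lambda>t. L (t *\<^sub>R v))) (at 0)"
    by (rule has_derivative_in_compose)
  then show ?thesis
    unfolding has_vector_derivative_def
    using linear_scale[OF bounded_linear.linear[OF has_derivative_bounded_linear[OF f]]] by simp
qed

section \<open>The chart of the unitary group\<close>

lemma skew_projection:
  shows "bounded_linear (\<lambda>A :: 'a :: complex_hilbert bdd_op. (1 / 2) *\<^sub>R (A - adjoint_op A))"
    and "(1 / 2) *\<^sub>R (A - adjoint_op A) \<in> skew_ops"
    and "A \<in> skew_ops \<Longrightarrow> (1 / 2) *\<^sub>R (A - adjoint_op A) = A"
proof -
  show "bounded_linear (\<lambda>A :: 'a bdd_op. (1 / 2) *\<^sub>R (A - adjoint_op A))"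
    by (intro bounded_linear_const_scaleR bounded_linear_sub bounded_linear_ident bounded_linear_adjoint)
  show "(1 / 2) *\<^sub>R (A - adjoint_op A) \<in> skew_ops"
    by (simp add: skew_ops_def adjoint_simps algebra_simps)
  show "(1 / 2) *\<^sub>R (A - adjoint_op A) = A" if "A \<in> skew_ops"
    using that by (simp add: skew_ops_def flip: scaleR_2)
qed

lemmas complemented_skew = complemented_range[OF skew_projection]

text \<open>
  The image \<open>\<Omega>\<close> is left free so that the domain can be shrunk until a given map sends it into a given
  chart.
\<close>

lemma unitary_chart:
  fixes U0 :: "'a :: complex_hilbert bdd_op"
  assumes U0: "U0 \<in> unitary_ops" and \<Omega>: "open \<Omega>" "\<Omega> \<subseteq> ball 0 1"
    and U: "U = {T. has_inverse (T * adjoint_op U0 + 1) \<and> cayley_coord (T * adjoint_op U0) \<in> \<Omega>}"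
  defines "\<phi> \<equiv> \<lambda>T. cayley_coord (T * adjoint_op U0)"
  shows "slice_chart r unitary_ops U \<phi> skew_ops" "\<phi> ` U = \<Omega>"
    "\<And>A. A \<in> \<Omega> \<Longrightarrow> inv_into U \<phi> A = cayley A * U0"
proof -
  let ?D = "{T. has_inverse (T * adjoint_op U0 + 1)}"
  note U0_simps = unitary_mult_assoc[OF U0] U0[unfolded unitary_ops_iff]
  have inv: "has_inverse (1 - A)" if "A \<in> \<Omega>" for A
    using that \<Omega>(2) by (intro has_inverse_one_minus) auto
  have "open ((\<lambda>T. T * adjoint_op U0 + 1) -` {T. has_inverse T})"
    by (intro open_vimage open_has_inverse continuous_intros)
  then have D: "open ?D" by (simp add: vimage_def)
  have \<phi>: "analytic_at UNIV T \<phi>" if "T \<in> ?D" for T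
    unfolding \<phi>_def using that
    by (intro analytic_at_cayley_coord analytic_at_mult analytic_at_ident analytic_at_const) auto
  have \<theta>: "analytic_at UNIV A (\<lambda>A. cayley A * U0)" if "A \<in> \<Omega>" for A
    by (intro analytic_at_cayley analytic_at_mult analytic_at_ident analytic_at_const inv that subspace_UNIV)
  have left: "cayley (\<phi> T) * U0 = T" if "T \<in> ?D" for T
    using that U0_simps by (simp add: \<phi>_def cayley_cayley_coord mult.assoc)
  have right: "cayley A * U0 \<in> ?D" "\<phi> (cayley A * U0) = A" if "A \<in> \<Omega>" for A
    using cayley_coord_cayley[OF inv[OF that]] U0_simps by (simp_all add: \<phi>_def mult.assoc)
  have M: "cayley A * U0 \<in> unitary_ops \<longleftrightarrow> A \<in> skew_ops" if "A \<in> \<Omega>" for A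
  proof -
    have "cayley A * U0 \<in> unitary_ops \<longleftrightarrow> cayley A \<in> unitary_ops"
    proof
      assume "cayley A * U0 \<in> unitary_ops"
      from unitary_mult[OF this unitary_adjoint[OF U0]] show "cayley A \<in> unitary_ops"
        using U0_simps by (simp add: mult.assoc)
    qed (rule unitary_mult[OF _ U0])
    then show ?thesis using cayley_unitary_iff[of A] that \<Omega>(2) by auto
  qed
  have U': "U = {T \<in> ?D. \<phi> T \<in> \<Omega>}" by (simp add: U \<phi>_def)
  note chart = slice_chart_explicit[OF D \<phi> \<Omega>(1) \<theta> left right complemented_skew(3) M U']
  show "slice_chart r unitary_ops U \<phi> skew_ops" "\<phi> ` U = \<Omega>"
    "\<And>A. A \<in> \<Omega> \<Longrightarrow> inv_into U \<phi> A = cayley A * U0"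
    by (rule chart; assumption)+
qed

section \<open>The chart of the manifold of projections with a unit vector\<close>

text \<open>
  The prefix \<open>pv\<close> abbreviates \<open>proj_vectors\<close>. For \<open>q = (P, f)\<close> this is \<open>V\<^sup>-\<^sup>1 S V S1\<close>, where \<open>V\<close> is the
  rotation that takes \<open>f1\<close> to \<open>f\<close> and \<open>V\<^sup>-\<^sup>1\<close> is the rotation with the opposite parameter. It equals
  \<open>1\<close> at \<open>(P1, f1)\<close>.
\<close>

definition pv_turn :: "'a :: complex_hilbert bdd_op \<Rightarrow> 'a \<Rightarrow> 'a bdd_op \<times> 'a \<Rightarrow> 'a bdd_op"
  where "pv_turn P1 f1 q = rotation f1 (- stereo f1 (snd q)) * reflection (fst q) *
    rotation f1 (stereo f1 (snd q)) * reflection P1"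

definition pv_chart :: "'a :: complex_hilbert bdd_op \<Rightarrow> 'a \<Rightarrow> 'a bdd_op \<times> 'a \<Rightarrow> 'a bdd_op \<times> 'a"
  where "pv_chart P1 f1 q = (cayley_coord (pv_turn P1 f1 q), stereo f1 (snd q))"

definition pv_domain :: "'a :: complex_hilbert bdd_op \<Rightarrow> 'a \<Rightarrow> ('a bdd_op \<times> 'a) set"
  where "pv_domain P1 f1 =
    {q. snd q \<noteq> - f1 \<and> norm (stereo f1 (snd q)) < 1 / 6 \<and> has_inverse (pv_turn P1 f1 q + 1)}"

definition pv_param :: "'a :: complex_hilbert bdd_op \<Rightarrow> 'a \<Rightarrow> 'a bdd_op \<times> 'a \<Rightarrow> 'a bdd_op \<times> 'a"
  where "pv_param P1 f1 \<omega> =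
    (of_reflection (rotation f1 (snd \<omega>) * (cayley (fst \<omega>) * reflection P1) * rotation f1 (- snd \<omega>)),
     stereo_inv f1 (snd \<omega>))"

text \<open>
  The radius \<open>1 / 6\<close> makes the operators \<open>tilt f1 w\<close> strict contractions and keeps \<open>w\<close> away from the centre
  \<open>- f1 / 2\<close> of the inverse inversion; the radius \<open>1 / 2\<close> is the one of \<open>anticommuting_cayley_conjugate\<close>.
\<close>

definition pv_image :: "('a :: complex_hilbert bdd_op \<times> 'a) set"
  where "pv_image = ball 0 (1 / 2) \<times> ball 0 (1 / 6)"

definition pv_nbhd :: "'a :: complex_hilbert bdd_op \<Rightarrow> 'a \<Rightarrow> ('a bdd_op \<times> 'a) set"
  where "pv_nbhd P1 f1 = {q \<in> pv_domain P1 f1. pv_chart P1 f1 q \<in> pv_image}"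

definition pv_model :: "'a :: complex_hilbert bdd_op \<Rightarrow> 'a \<Rightarrow> ('a bdd_op \<times> 'a) set"
  where "pv_model P1 f1 = {(X, w). X \<in> skew_ops \<and> X * reflection P1 = - (reflection P1 * X) \<and>
    X \<cdot> f1 = 0 \<and> Re (cinner f1 w) = 0}"

lemma analytic_at_reflection: "analytic_at S x g \<Longrightarrow> analytic_at S x (\<lambda>u. reflection (g u))"
  unfolding reflection_def
  by (intro analytic_at_diff analytic_at_const analytic_at_bounded_linear[OF bounded_linear_scaleR_right])

lemma analytic_at_of_reflection: "analytic_at S x g \<Longrightarrow> analytic_at S x (\<lambda>u. of_reflection (g u))"
  unfolding of_reflection_def
  by (intro analytic_at_add analytic_at_const analytic_at_bounded_linear[OF bounded_linear_scaleR_right])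

lemma analytic_at_minus: "analytic_at S x g \<Longrightarrow> analytic_at S x (\<lambda>u. - g u)"
  by (intro analytic_at_bounded_linear[OF bounded_linear_minus[OF bounded_linear_ident]])

lemmas analytic_at_fst = analytic_at_bounded_linear[OF bounded_linear_fst]
lemmas analytic_at_snd = analytic_at_bounded_linear[OF bounded_linear_snd]

lemma cayley_fixes_iff:
  assumes inv: "has_inverse (1 - X)"
  shows "cayley X \<cdot> f = f \<longleftrightarrow> X \<cdot> f = 0"
proof
  let ?J = "inv_elt (1 - X)"
  assume "cayley X \<cdot> f = f"
  then have "(cayley X + 1) \<cdot> f = 2 *\<^sub>R f" "(cayley X - 1) \<cdot> f = 0"
    by (simp_all add: op_simps scaleR_2)
  then have "?J \<cdot> f = f" "X \<cdot> ?J \<cdot> f = 0"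
    unfolding cayley_plus_one[OF inv] cayley_minus_one[OF inv] by (simp_all add: op_simps)
  then show "X \<cdot> f = 0" by simp
next
  assume X: "X \<cdot> f = 0"
  then have "(1 - X) \<cdot> f = f" by (simp add: op_simps)
  then have "inv_elt (1 - X) \<cdot> f = f"
    using inv by (metis inv_elt_left op_mult_apply op_one_apply)
  with X show "cayley X \<cdot> f = f" by (simp add: cayley_def op_simps)
qed

text \<open>
  Conjugation by \<open>S\<close> commutes with the Cayley transform, so \<open>S X S = - X\<close> says that \<open>S T S = T\<^sup>-\<^sup>1\<close> for the
  Cayley transform \<open>T\<close> of \<open>X\<close>, that is, that \<open>T S\<close> is an involution; given this, self-adjointness of
  \<open>T S\<close> is unitarity of \<open>T\<close>.
\<close>

lemma cayley_reflection_iff: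
  assumes S: "S * S = 1" "adjoint_op S = S" and X: "norm X < 1"
  shows "(cayley X * S) * (cayley X * S) = 1 \<and> adjoint_op (cayley X * S) = cayley X * S \<longleftrightarrow>
    X \<in> skew_ops \<and> X * S = - (S * X)"
proof -
  have SS: "S * (S * T) = T" for T using S(1) by (simp flip: mult.assoc)
  have inv: "has_inverse (1 - X)" "has_inverse (1 - (- X))"
    using X by (auto intro: has_inverse_one_minus has_inverse_one_plus)
  note conj = cayley_conjugate[OF S(1) inv(1)]
  show ?thesis
  proof
    assume *: "X \<in> skew_ops \<and> X * S = - (S * X)"
    then have "S * X * S = - X" by (simp add: mult.assoc SS)
    then have e: "S * cayley X * S = cayley (- X)" using conj by simp
    have adj: "adjoint_op (cayley X) = cayley (- X)" using cayley_skew(1) * X by blast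
    have "adjoint_op (cayley X * S) = S * (S * cayley X * S)"
      by (simp only: adjoint_mult S adj e)
    also have "\<dots> = cayley X * S" by (simp add: mult.assoc SS)
    finally have "adjoint_op (cayley X * S) = cayley X * S" .
    moreover have "(cayley X * S) * (cayley X * S) = cayley X * (S * cayley X * S)"
      by (simp add: mult.assoc)
    then have "(cayley X * S) * (cayley X * S) = 1"
      using cayley_mult_cayley_minus[of X] inv by (simp add: e)
    ultimately show "(cayley X * S) * (cayley X * S) = 1 \<and> adjoint_op (cayley X * S) = cayley X * S"
      by blast
  next
    assume *: "(cayley X * S) * (cayley X * S) = 1 \<and> adjoint_op (cayley X * S) = cayley X * S"
    then have adjR: "S * adjoint_op (cayley X) = cayley X * S" by (simp add: adjoint_mult S)
    have adj: "adjoint_op (cayley X) = S * cayley X * S"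
      using SS[of "adjoint_op (cayley X)"] by (simp add: adjR mult.assoc)
    have 1: "cayley X * adjoint_op (cayley X) = 1" using * unfolding adj by (simp add: mult.assoc)
    have 2: "adjoint_op (cayley X) * cayley X = 1"
    proof -
      have "adjoint_op (cayley X) * cayley X = S * ((cayley X * S) * (cayley X * S)) * S"
        unfolding adj by (simp add: mult.assoc S)
      then show ?thesis using * by (simp add: S)
    qed
    have skew: "X \<in> skew_ops" using 1 2 X by (simp add: unitary_ops_iff flip: cayley_unitary_iff)
    have "cayley (S * X * S) = cayley (- X)" using cayley_skew(1)[OF skew X] adj conj(2) by metis
    then have "cayley_coord (cayley (S * X * S)) = cayley_coord (cayley (- X))" by (rule arg_cong)
    then have SXS: "S * X * S = - X"
      unfolding cayley_coord_cayley(2)[OF conj(1)] cayley_coord_cayley(2)[OF inv(2)] .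
    have "X * S = S * (S * X * S)" by (simp add: mult.assoc SS)
    also have "\<dots> = - (S * X)" unfolding SXS by simp
    finally have "X * S = - (S * X)" .
    with skew show "X \<in> skew_ops \<and> X * S = - (S * X)" by blast
  qed
qed

context
  fixes P1 :: "'a :: complex_hilbert bdd_op" and f1 :: 'a
  assumes p: "(P1, f1) \<in> proj_vectors"
begin

lemma pv_basepoint: "reflection P1 * reflection P1 = 1" "adjoint_op (reflection P1) = reflection P1"
  "reflection P1 \<cdot> f1 = f1" "norm f1 = 1" "reflection P1 * (reflection P1 * T) = T"
  using p by (auto simp: proj_vectors_iff simp flip: mult.assoc)

lemma analytic_at_pv_turn:
  assumes q: "analytic_at S x q" and S: "subspace S"
    and D: "snd (q x) \<noteq> - f1" "norm (stereo f1 (snd (q x))) < 1 / 6"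
  shows "analytic_at S x (\<lambda>u. pv_turn P1 f1 (q u))"
proof -
  have "analytic_at S x (\<lambda>u. stereo f1 (snd (q u)))"
    by (intro analytic_at_stereo analytic_at_snd q S D)
  then show ?thesis
    unfolding pv_turn_def
    by (intro analytic_at_mult analytic_at_const analytic_at_reflection analytic_at_fst q
        analytic_at_rotation analytic_at_minus S) (use D pv_basepoint in auto)
qed

lemma analytic_at_pv_chart:
  assumes q: "analytic_at S x q" and S: "subspace S" and D: "q x \<in> pv_domain P1 f1"
  shows "analytic_at S x (\<lambda>u. pv_chart P1 f1 (q u))"
  unfolding pv_chart_def using D
  by (intro analytic_at_Pair analytic_at_cayley_coord analytic_at_pv_turn analytic_at_stereo
      analytic_at_snd q S) (auto simp: pv_domain_def)

lemma analytic_at_pv_param: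
  assumes "\<omega> \<in> pv_image"
  shows "analytic_at UNIV \<omega> (pv_param P1 f1)"
proof -
  have \<omega>: "norm (fst \<omega>) < 1 / 2" "norm (snd \<omega>) < 1 / 6" using assms by (auto simp: pv_image_def)
  have "analytic_at UNIV \<omega> (\<lambda>\<omega>.
    (of_reflection (rotation f1 (snd \<omega>) * (cayley (fst \<omega>) * reflection P1) * rotation f1 (- snd \<omega>)),
     stereo_inv f1 (snd \<omega>)))"
    by (intro analytic_at_Pair analytic_at_of_reflection analytic_at_mult analytic_at_rotation
        analytic_at_cayley analytic_at_stereo_inv analytic_at_fst analytic_at_snd analytic_at_minus
        analytic_at_ident analytic_at_const subspace_UNIV has_inverse_one_minus
        small_not_pole pv_basepoint) (use \<omega> in auto)
  then show ?thesis unfolding pv_param_def .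
qed

lemma open_pv_domain: "open (pv_domain P1 f1)"
proof -
  let ?A = "{q :: 'a bdd_op \<times> 'a. snd q \<noteq> - f1}"
  have "open (snd -` (- {- f1}))" by (intro open_vimage continuous_intros)
  then have A: "open ?A" by (simp add: vimage_def)
  have "continuous_on ?A (\<lambda>q. stereo f1 (snd q))"
    by (intro continuous_at_imp_continuous_on ballI analytic_at_isCont analytic_at_stereo analytic_at_snd
        analytic_at_ident subspace_UNIV) auto
  from continuous_open_preimage[OF this A open_ball[of 0 "1 / 6"]]
  have B: "open (?A \<inter> (\<lambda>q. stereo f1 (snd q)) -` ball 0 (1 / 6))" (is "open ?B") .
  have "continuous_on ?B (\<lambda>q. pv_turn P1 f1 q + 1)"
    by (intro continuous_at_imp_continuous_on ballI analytic_at_isCont analytic_at_add analytic_at_const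
        analytic_at_pv_turn analytic_at_ident subspace_UNIV) auto
  from continuous_open_preimage[OF this B open_has_inverse]
  show ?thesis
    by (rule back_subst[of "open"]) (auto simp: pv_domain_def)
qed

lemma pv_param_chart:
  assumes "q \<in> pv_domain P1 f1"
  shows "pv_param P1 f1 (pv_chart P1 f1 q) = q"
proof -
  define w where "w = stereo f1 (snd q)"
  have q: "snd q \<noteq> - f1" "norm w < 1 / 6" "has_inverse (pv_turn P1 f1 q + 1)"
    using assms by (auto simp: pv_domain_def w_def)
  note rot = rotation_unitary(3,4)[OF pv_basepoint(4) q(2)]
  have rot': "rotation f1 w * (rotation f1 (- w) * T) = T" for T using rot by (simp flip: mult.assoc)
  have c: "cayley (cayley_coord (pv_turn P1 f1 q)) =
      rotation f1 (- w) * reflection (fst q) * rotation f1 w * reflection P1"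
    using cayley_cayley_coord(2)[OF q(3)] by (simp add: pv_turn_def w_def)
  have "rotation f1 w * (cayley (cayley_coord (pv_turn P1 f1 q)) * reflection P1) * rotation f1 (- w) = reflection (fst q)"
    unfolding c using rot by (simp add: mult.assoc pv_basepoint rot')
  then show ?thesis
    by (simp add: pv_param_def pv_chart_def w_def[symmetric]) (simp add: w_def stereo_inv_stereo q)
qed

lemma pv_chart_param:
  assumes "\<omega> \<in> pv_image"
  shows "pv_param P1 f1 \<omega> \<in> pv_domain P1 f1" "pv_chart P1 f1 (pv_param P1 f1 \<omega>) = \<omega>"
proof -
  obtain X w where \<omega>: "\<omega> = (X, w)" "norm X < 1 / 2" "norm w < 1 / 6"
    using assms by (cases \<omega>) (auto simp: pv_image_def)
  note rot = rotation_unitary(3,4)[OF pv_basepoint(4) \<omega>(3)]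
  have rot': "rotation f1 (- w) * (rotation f1 w * T) = T" for T using rot by (simp flip: mult.assoc)
  note st = stereo_stereo_inv[OF small_not_pole[OF pv_basepoint(4) \<omega>(3)]]
  have inv: "has_inverse (1 - X)" using \<omega> by (intro has_inverse_one_minus) auto
  have turn: "pv_turn P1 f1 (pv_param P1 f1 \<omega>) = cayley X"
    by (simp add: pv_turn_def pv_param_def \<omega>(1) st mult.assoc rot' pv_basepoint)
  have snd: "snd (pv_param P1 f1 \<omega>) = stereo_inv f1 w" by (simp add: pv_param_def \<omega>(1))
  show "pv_param P1 f1 \<omega> \<in> pv_domain P1 f1"
    using cayley_coord_cayley[OF inv] \<omega>(2,3) st by (simp add: pv_domain_def turn snd)
  show "pv_chart P1 f1 (pv_param P1 f1 \<omega>) = \<omega>"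
    unfolding pv_chart_def turn snd using cayley_coord_cayley[OF inv] st by (simp add: \<omega>(1))
qed

text \<open>
  The norm condition selects the hyperplane of \<open>w\<close>. On that hyperplane the rotation \<open>V\<close> takes \<open>f1\<close> to the
  vector of the pair, so conjugation by \<open>V\<close> reduces the other conditions to conditions on the
  reflection with Cayley coordinate \<open>X\<close> and the fixed vector \<open>f1\<close>.
\<close>

lemma pv_param_mem_iff:
  assumes "\<omega> \<in> pv_image"
  shows "pv_param P1 f1 \<omega> \<in> proj_vectors \<longleftrightarrow> \<omega> \<in> pv_model P1 f1"
proof -
  obtain X w where \<omega>: "\<omega> = (X, w)" "norm X < 1 / 2" "norm w < 1 / 6"
    using assms by (cases \<omega>) (auto simp: pv_image_def)
  define V where "V = rotation f1 w"
  define R where "R = cayley X * reflection P1"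
  have V: "V \<in> unitary_ops" "rotation f1 (- w) = adjoint_op V"
    using rotation_unitary[OF pv_basepoint(4) \<omega>(3)] by (auto simp: V_def)
  have V1: "adjoint_op V * V = 1" "V * adjoint_op V = 1" using V(1) by (auto simp: unitary_ops_iff)
  note VV = unitary_mult_assoc[OF V(1)]
  have inv: "has_inverse (1 - X)" using \<omega> by (intro has_inverse_one_minus) auto
  have cancel: "V * T * adjoint_op V = V * T' * adjoint_op V \<longleftrightarrow> T = T'" for T T'
  proof
    assume "V * T * adjoint_op V = V * T' * adjoint_op V"
    then have "adjoint_op V * (V * T * adjoint_op V) * V = adjoint_op V * (V * T' * adjoint_op V) * V" by simp
    then show "T = T'" by (simp add: mult.assoc VV V1)
  qed simp
  have sq: "(V * R * adjoint_op V) * (V * R * adjoint_op V) = 1 \<longleftrightarrow> R * R = 1"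
    using cancel[of "R * R" 1] by (simp add: mult.assoc VV V1)
  have adj: "adjoint_op (V * R * adjoint_op V) = V * R * adjoint_op V \<longleftrightarrow> adjoint_op R = R"
    using cancel[of "adjoint_op R" R] by (simp add: adjoint_mult mult.assoc)
  have nrm: "norm (stereo_inv f1 w) = 1 \<longleftrightarrow> Re (cinner f1 w) = 0"
    by (rule norm_stereo_inv[OF pv_basepoint(4) small_not_pole[OF pv_basepoint(4) \<omega>(3)]])
  have fixed: "(V * R * adjoint_op V) \<cdot> stereo_inv f1 w = stereo_inv f1 w \<longleftrightarrow> X \<cdot> f1 = 0"
    if "Re (cinner f1 w) = 0"
  proof -
    have st: "stereo_inv f1 w = V \<cdot> f1"
      using rotation_apply[OF pv_basepoint(4) \<omega>(3) that] by (simp add: V_def)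
    have VVf: "adjoint_op V \<cdot> V \<cdot> g = g" for g using V1 by (simp add: op_one_apply flip: op_mult_apply)
    have "(V * R * adjoint_op V) \<cdot> V \<cdot> f1 = V \<cdot> R \<cdot> f1" by (simp add: op_mult_apply VVf)
    moreover have "V \<cdot> R \<cdot> f1 = V \<cdot> f1 \<longleftrightarrow> R \<cdot> f1 = f1" by (metis VVf)
    moreover have "R \<cdot> f1 = cayley X \<cdot> f1" by (simp add: R_def op_mult_apply pv_basepoint)
    ultimately show ?thesis using cayley_fixes_iff[OF inv] st by simp
  qed
  have "pv_param P1 f1 \<omega> = (of_reflection (V * R * adjoint_op V), stereo_inv f1 w)"
    by (simp add: pv_param_def \<omega>(1) V R_def) (simp add: V_def)
  then show ?thesis
    using fixed nrm cayley_reflection_iff[OF pv_basepoint(1,2), of X, folded R_def] \<omega>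
    by (auto simp: proj_vectors_iff sq adj pv_model_def)
qed

lemma pv_param_orbit:
  assumes "\<omega> \<in> pv_image" "\<omega> \<in> pv_model P1 f1"
  shows "\<exists>W\<in>unitary_ops. fst (pv_param P1 f1 \<omega>) = W * P1 * adjoint_op W"
proof -
  obtain X w where \<omega>: "\<omega> = (X, w)" "norm X < 1 / 2" "norm w < 1 / 6"
    using assms(1) by (cases \<omega>) (auto simp: pv_image_def)
  have X: "X \<in> skew_ops" "X * reflection P1 = - (reflection P1 * X)"
    using assms(2) by (auto simp: \<omega>(1) pv_model_def)
  obtain W where W: "W \<in> unitary_ops" "cayley X * reflection P1 = W * reflection P1 * adjoint_op W"
    using anticommuting_cayley_conjugate[OF pv_basepoint(1,2) X] \<omega>(2) by auto
  define V where "V = rotation f1 w"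
  have V: "V \<in> unitary_ops" "rotation f1 (- w) = adjoint_op V"
    using rotation_unitary[OF pv_basepoint(4) \<omega>(3)] by (auto simp: V_def)
  have VW: "V * W \<in> unitary_ops" by (rule unitary_mult[OF V(1) W(1)])
  have "fst (pv_param P1 f1 \<omega>) = of_reflection ((V * W) * reflection P1 * adjoint_op (V * W))"
    by (simp add: pv_param_def \<omega>(1) V(2) W(2) adjoint_mult mult.assoc) (simp add: V_def)
  also have "\<dots> = (V * W) * P1 * adjoint_op (V * W)"
    using VW by (subst of_reflection_conjugate) (auto simp: unitary_ops_iff)
  finally show ?thesis using VW by blast
qed

text \<open>
  A bounded projection onto the model space: compress the skew-adjoint part of \<open>X\<close> to the orthogonal
  complement of \<open>f1\<close>, then average over conjugation by the reflection with the sign of the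
  anticommuting part.
\<close>

lemma complemented_pv_model:
  shows "subspace (pv_model P1 f1)" "closed (pv_model P1 f1)" "complemented_in UNIV (pv_model P1 f1)"
proof -
  let ?S = "reflection P1"
  define Q where "Q = 1 - rank_one f1 f1"
  define c where "c X = Q * ((1 / 2) *\<^sub>R (X - adjoint_op X)) * Q" for X
  define \<pi> where "\<pi> p = ((1 / 2) *\<^sub>R (c (fst p) - ?S * c (fst p) * ?S),
    snd p - Re (cinner f1 (snd p)) *\<^sub>R f1)" for p
  have Qf: "Q \<cdot> f1 = 0"
    by (simp add: Q_def op_simps rank_one_apply cinner_self pv_basepoint scaleC_one)
  have adjQ: "adjoint_op Q = Q" by (simp add: Q_def adjoint_simps adjoint_rank_one)
  have bl: "bounded_linear \<pi>"
    unfolding \<pi>_def c_def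
    by (intro bounded_linear_Pair bounded_linear_const_scaleR bounded_linear_sub bounded_linear_mult_const
        bounded_linear_const_mult bounded_linear_fst bounded_linear_snd bounded_linear_scaleR_const
        bounded_linear_compose[OF bounded_linear_adjoint]
        bounded_linear_compose[OF bounded_linear_Re]
        bounded_linear_compose[OF bounded_bilinear.bounded_linear_right[OF bounded_bilinear_cinner]])
  have mem: "\<pi> p \<in> pv_model P1 f1" for p
  proof -
    have c1: "adjoint_op (c (fst p)) = - c (fst p)"
      by (simp add: c_def adjoint_simps adjQ mult.assoc algebra_simps)
    have c2: "c (fst p) \<cdot> f1 = 0" by (simp add: c_def op_simps Qf op_apply.zero_right)
    have "Re (cinner f1 (snd p - Re (cinner f1 (snd p)) *\<^sub>R f1)) = 0"
      by (simp add: cinner_simps cinner_self pv_basepoint)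
    then show ?thesis
      using c1 c2 pv_basepoint
      by (simp add: \<pi>_def pv_model_def skew_ops_def adjoint_simps op_simps op_apply.zero_right algebra_simps)
  qed
  have "\<pi> p = p" if "p \<in> pv_model P1 f1" for p
  proof -
    obtain X w where pXw: "p = (X, w)" by (cases p)
    then have X: "X \<in> skew_ops" "X * ?S = - (?S * X)" "X \<cdot> f1 = 0" "Re (cinner f1 w) = 0"
      using that unfolding pv_model_def by auto
    have adjX: "adjoint_op X = - X" using X by (simp add: skew_ops_def)
    have "X * rank_one f1 f1 = 0"
      by (rule op_eqI) (simp add: op_simps rank_one_apply X op_apply.zero_left)
    moreover have "rank_one f1 f1 * X = 0"
    proof (rule op_eqI)
      fix x
      have "cinner f1 (X \<cdot> x) = cinner (adjoint_op X \<cdot> f1) x" by (simp add: cinner_adjoint_left)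
      then show "(rank_one f1 f1 * X) \<cdot> x = 0 \<cdot> x"
        by (simp add: op_simps rank_one_apply adjX X op_apply.zero_left)
    qed
    ultimately have "Q * X * Q = X" by (simp add: Q_def algebra_simps)
    then have "c X = X" using skew_projection(3)[OF X(1)] by (simp add: c_def)
    moreover have "?S * X * ?S = - X"
    proof -
      have "?S * X * ?S = - (X * (?S * ?S))" by (simp add: X(2) flip: mult.assoc)
      then show ?thesis by (simp add: pv_basepoint)
    qed
    ultimately show ?thesis using X(4) by (simp add: \<pi>_def pXw flip: scaleR_2)
  qed
  from complemented_range[OF bl mem this]
  show "subspace (pv_model P1 f1)" "closed (pv_model P1 f1)" "complemented_in UNIV (pv_model P1 f1)"
    by auto
qed

text \<open>
  The set \<open>M\<close> may be \<open>proj_vectors\<close> itself or any subset that agrees with it on the image of the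
  parametrisation, such as an orbit.
\<close>

lemma pv_slice_chart:
  assumes M: "\<And>\<omega>. \<omega> \<in> pv_image \<Longrightarrow> pv_param P1 f1 \<omega> \<in> M \<longleftrightarrow> pv_param P1 f1 \<omega> \<in> proj_vectors"
  shows "slice_chart r M (pv_nbhd P1 f1) (pv_chart P1 f1) (pv_model P1 f1)"
proof (rule slice_chart_explicit(1)[OF open_pv_domain _ _ analytic_at_pv_param pv_param_chart
      pv_chart_param complemented_pv_model(3)])
  show "analytic_at UNIV q (pv_chart P1 f1)" if "q \<in> pv_domain P1 f1" for q
    using analytic_at_pv_chart[OF analytic_at_ident subspace_UNIV that] .
  show "open (pv_image :: ('a bdd_op \<times> 'a) set)" unfolding pv_image_def by (intro open_Times open_ball)
qed (auto simp: pv_nbhd_def M pv_param_mem_iff)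

lemma pv_chart_basepoint: "(P1, f1) \<in> pv_nbhd P1 f1" "pv_chart P1 f1 (P1, f1) = 0"
proof -
  have turn: "pv_turn P1 f1 (P1, f1) = 1"
    by (simp add: pv_turn_def stereo_self pv_basepoint)
  have "norm (f1 + f1) = 2" using pv_basepoint(4) by (simp flip: scaleR_2)
  then have "f1 \<noteq> - f1" by (metis add.right_inverse norm_zero zero_neq_numeral)
  then show "(P1, f1) \<in> pv_nbhd P1 f1" "pv_chart P1 f1 (P1, f1) = 0"
    using has_inverse_two by (auto simp: pv_nbhd_def pv_domain_def pv_chart_def turn stereo_self pv_basepoint pv_image_def
        zero_prod_def)
qed

end

lemma open_pv_nbhd:
  assumes p: "(P1, f1) \<in> proj_vectors"
  shows "open (pv_nbhd P1 f1)"
  using pv_slice_chart[OF p, of proj_vectors Smooth] by (simp add: slice_chart_def)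

text \<open>
  By \<open>pv_param_orbit\<close>, every point of \<open>proj_vectors\<close> in the chart domain lies in the orbit.
\<close>

lemma pv_orbit_chart:
  assumes p: "(P1, f1) \<in> proj_vectors_orbit P0"
  shows "slice_chart r (proj_vectors_orbit P0) (pv_nbhd P1 f1) (pv_chart P1 f1) (pv_model P1 f1)"
proof -
  obtain W0 where W0: "W0 \<in> unitary_ops" "P1 = W0 * P0 * adjoint_op W0" and p1: "(P1, f1) \<in> proj_vectors"
    using p by (auto simp: proj_vectors_orbit_iff)
  show ?thesis
  proof (rule pv_slice_chart[OF p1])
    fix \<omega> :: "'a bdd_op \<times> 'a" assume \<omega>: "\<omega> \<in> pv_image"
    have "pv_param P1 f1 \<omega> \<in> proj_vectors_orbit P0" if m: "pv_param P1 f1 \<omega> \<in> proj_vectors"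
    proof -
      obtain W where W: "W \<in> unitary_ops" "fst (pv_param P1 f1 \<omega>) = W * P1 * adjoint_op W"
        using pv_param_orbit[OF p1 \<omega>] m pv_param_mem_iff[OF p1 \<omega>] by blast
      have "W * P1 * adjoint_op W = (W * W0) * P0 * adjoint_op (W * W0)"
        unfolding W0(2) by (simp add: adjoint_mult mult.assoc)
      with W(2) show ?thesis
        using m unitary_mult[OF W(1) W0(1)]
        by (cases "pv_param P1 f1 \<omega>") (auto simp: proj_vectors_orbit_iff)
    qed
    then show "pv_param P1 f1 \<omega> \<in> proj_vectors_orbit P0 \<longleftrightarrow> pv_param P1 f1 \<omega> \<in> proj_vectors"
      by (auto simp: proj_vectors_orbit_def)
  qed
qed

section \<open>The orbit map\<close>

lemma has_vector_derivative_scaleR_zero: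
  fixes c :: "real \<Rightarrow> 'a :: real_normed_vector"
  assumes "isCont c 0"
  shows "((\<lambda>t. t *\<^sub>R c t) has_vector_derivative c 0) (at 0)"
  unfolding has_vector_derivative_def
proof (rule has_derivativeI_sandwich[of 1 _ _ _ _ "\<lambda>t. norm (c t - c 0)"])
  show "((\<lambda>t. norm (c t - c 0)) \<longlongrightarrow> 0) (at 0)"
    using assms by (intro tendsto_norm_zero) (simp add: isCont_def LIM_zero)
  fix t :: real assume "t \<noteq> 0"
  then show "norm (t *\<^sub>R c t - 0 *\<^sub>R c 0 - (t - 0) *\<^sub>R c 0) / norm (t - 0) \<le> norm (c t - c 0)"
    by (simp flip: scaleR_right_diff_distrib)
qed (auto intro: bounded_linear_scaleR_left)

lemma has_vector_derivative_tendsto_quotient: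
  assumes "(f has_vector_derivative d) (at 0)"
  shows "((\<lambda>t. (f t - f 0) /\<^sub>R t) \<longlongrightarrow> d) (at (0 :: real))"
proof -
  have "((\<lambda>t. norm (f t - f 0 - t *\<^sub>R d) / \<bar>t\<bar>) \<longlongrightarrow> 0) (at 0)"
    using assms by (simp add: has_vector_derivative_def has_derivative_iff_norm)
  moreover have "\<forall>\<^sub>F t in at 0. norm (f t - f 0 - t *\<^sub>R d) / \<bar>t\<bar> = norm ((f t - f 0) /\<^sub>R t - d)"
  proof (rule eventually_at_filter[THEN iffD2], intro always_eventually allI impI)
    fix t :: real assume t: "t \<noteq> 0"
    have "(f t - f 0) /\<^sub>R t - d = (f t - f 0 - t *\<^sub>R d) /\<^sub>R t"
      using t by (simp add: scaleR_diff_right)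
    also have "norm \<dots> = norm (f t - f 0 - t *\<^sub>R d) / \<bar>t\<bar>"
      by (simp only: norm_scaleR abs_inverse divide_inverse mult.commute)
    finally show "norm (f t - f 0 - t *\<^sub>R d) / \<bar>t\<bar> = norm ((f t - f 0) /\<^sub>R t - d)" ..
  qed
  ultimately have "((\<lambda>t. norm ((f t - f 0) /\<^sub>R t - d)) \<longlongrightarrow> 0) (at 0)"
    by (rule Lim_transform_eventually)
  then show ?thesis by (rule LIM_zero_cancel[OF tendsto_norm_zero_cancel])
qed

text \<open>
  The orbit map at \<open>(P1, f1)\<close> read in the Cayley chart of the unitary group.
\<close>

definition orbit_path :: "'a :: complex_hilbert bdd_op \<Rightarrow> 'a \<Rightarrow> 'a bdd_op \<Rightarrow> 'a bdd_op \<times> 'a"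
  where "orbit_path P1 f1 A = (cayley A * P1 * adjoint_op (cayley A), cayley A \<cdot> f1)"

lemma analytic_at_orbit_path:
  assumes S: "subspace S" and A: "norm A < 1"
  shows "analytic_at S A (orbit_path P1 f1)"
proof -
  have c: "analytic_at S A cayley"
    by (intro analytic_at_cayley analytic_at_ident S has_inverse_one_minus A)
  have "analytic_at S A (\<lambda>A. (cayley A * P1 * adjoint_op (cayley A), cayley A \<cdot> f1))"
    by (intro analytic_at_Pair analytic_at_mult analytic_at_const c
        analytic_at_bounded_linear[OF bounded_linear_adjoint]
        analytic_at_bilinear[OF bounded_bilinear_op_apply])
  then show ?thesis unfolding orbit_path_def .
qed

context
  fixes P1 :: "'a :: complex_hilbert bdd_op" and f1 :: 'a
  assumes p: "(P1, f1) \<in> proj_vectors"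
begin

lemma chart_orbit_path_tilt:
  assumes w: "Re (cinner f1 w) = 0" "norm w < 1 / 6"
  shows "pv_chart P1 f1 (orbit_path P1 f1 (tilt f1 w)) = (0, w)"
proof -
  note f1 = pv_basepoint(4)[OF p]
  note rot = rotation_unitary[OF f1 w(2)]
  have "of_reflection (rotation f1 w * reflection P1 * rotation f1 (- w)) =
      rotation f1 w * P1 * rotation f1 (- w)"
    using of_reflection_conjugate[OF rot(3), of "reflection P1"] by simp
  then have "orbit_path P1 f1 (tilt f1 w) = pv_param P1 f1 (0, w)"
    using rotation_apply[OF f1 w(2,1)]
    by (simp add: orbit_path_def pv_param_def rot(2) flip: rotation_def)
  moreover have "(0, w) \<in> (pv_image :: ('a bdd_op \<times> 'a) set)" using w(2) by (simp add: pv_image_def)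
  ultimately show ?thesis using pv_chart_param(2)[OF p] by simp
qed

text \<open>
  Here the vector \<open>f1\<close> does not move, and \<open>S1 T\<^sup>-\<^sup>1 S1 = T\<close> for the Cayley transform \<open>T\<close> of \<open>X\<close>; hence the
  conjugated reflection times \<open>S1\<close> is \<open>T\<^sup>2\<close>, and the double angle formula applies.
\<close>

lemma chart_orbit_path_anticommuting:
  assumes X: "(X, 0) \<in> pv_model P1 f1" and small: "norm X < 1"
  shows "pv_chart P1 f1 (orbit_path P1 f1 X) = (2 *\<^sub>R (X * inv_elt (1 + X * X)), 0)"
proof -
  note b = pv_basepoint[OF p]
  let ?S = "reflection P1"
  have X': "X \<in> skew_ops" "X * ?S = - (?S * X)" "X \<cdot> f1 = 0"
    using X by (auto simp: pv_model_def)
  have inv: "has_inverse (1 - X)" using small by (rule has_inverse_one_minus)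
  have "norm X * norm X < 1 * 1" using small by (intro mult_strict_mono') auto
  then have inv2: "has_inverse (1 + X * X)"
    using norm_mult_ineq[of X X] by (intro has_inverse_one_plus) simp
  have u: "cayley X * adjoint_op (cayley X) = 1" using cayley_skew[OF X'(1) small] by (simp add: unitary_ops_iff)
  have SXS: "?S * X * ?S = - X"
  proof -
    have "?S * X * ?S = - (X * (?S * ?S))" by (simp add: X'(2) flip: mult.assoc)
    then show ?thesis by (simp add: b)
  qed
  have conj: "?S * adjoint_op (cayley X) * ?S = cayley X"
  proof -
    have "?S * adjoint_op (cayley X) * ?S = ?S * (?S * cayley X * ?S) * ?S"
      using cayley_conjugate(2)[OF b(1) inv] cayley_skew(1)[OF X'(1) small] by (simp add: SXS)
    then show ?thesis by (simp add: mult.assoc b)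
  qed
  have path: "orbit_path P1 f1 X = (cayley X * P1 * adjoint_op (cayley X), f1)"
    using cayley_fixes_iff[OF inv] X'(3) by (simp add: orbit_path_def)
  have "pv_turn P1 f1 (orbit_path P1 f1 X) = reflection (cayley X * P1 * adjoint_op (cayley X)) * ?S"
    by (simp add: path pv_turn_def stereo_self b)
  also have "\<dots> = cayley X * (?S * adjoint_op (cayley X) * ?S)"
    unfolding reflection_conjugate[OF u] by (simp only: mult.assoc)
  finally have "pv_turn P1 f1 (orbit_path P1 f1 X) = cayley X * cayley X" unfolding conj .
  then show ?thesis
    using cayley_coord_cayley_square(2)[OF inv inv2] by (simp add: pv_chart_def) (simp add: path stereo_self b)
qed

lemma chart_orbit_path_derivative_tilt:
  assumes "Re (cinner f1 w) = 0"
  shows "((\<lambda>t. pv_chart P1 f1 (orbit_path P1 f1 (t *\<^sub>R tilt f1 w))) has_vector_derivative (0, w)) (at 0)"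
proof (rule has_vector_derivative_transform_within_open)
  let ?T = "{t. norm (t *\<^sub>R w) < 1 / 6}"
  show "((\<lambda>t. (0, t *\<^sub>R w)) has_vector_derivative (0, w)) (at 0)"
    by (auto intro!: derivative_eq_intros has_vector_derivative_Pair)
  show "open ?T" by (intro open_Collect_less continuous_intros)
  show "(0 :: real) \<in> ?T" by simp
  fix t assume "t \<in> ?T"
  then have "pv_chart P1 f1 (orbit_path P1 f1 (tilt f1 (t *\<^sub>R w))) = (0, t *\<^sub>R w)"
    using assms by (intro chart_orbit_path_tilt) (simp_all add: cinner_simps)
  then show "(0, t *\<^sub>R w) = pv_chart P1 f1 (orbit_path P1 f1 (t *\<^sub>R tilt f1 w))"
    using linear_scale[OF bounded_linear.linear[OF bounded_linear_tilt[OF pv_basepoint(4)[OF p]]]] by simp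
qed

lemma chart_orbit_path_derivative_anticommuting:
  assumes X: "(X, 0) \<in> pv_model P1 f1"
  shows "((\<lambda>t. pv_chart P1 f1 (orbit_path P1 f1 (t *\<^sub>R X))) has_vector_derivative (2 *\<^sub>R X, 0)) (at 0)"
proof (rule has_vector_derivative_transform_within_open)
  let ?T = "{t. norm (t *\<^sub>R X) < 1}"
  define c where "c t = 2 *\<^sub>R (X * inv_elt (1 + (t *\<^sub>R X) * (t *\<^sub>R X)))" for t :: real
  have "analytic_at UNIV (0 :: real) c"
    unfolding c_def
    by (intro analytic_at_bounded_linear[OF bounded_linear_scaleR_right] analytic_at_mult analytic_at_const
        analytic_at_inv_elt analytic_at_add analytic_at_scaleR analytic_at_ident subspace_UNIV)
      (auto intro: has_inverseI[of 1 1])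
  then have "isCont c 0" by (rule analytic_at_isCont)
  from has_vector_derivative_scaleR_zero[OF this]
  have "((\<lambda>t. t *\<^sub>R c t) has_vector_derivative 2 *\<^sub>R X) (at 0)"
    by (simp add: c_def inv_elt_eq[of 1 1])
  then show "((\<lambda>t. (t *\<^sub>R c t, 0)) has_vector_derivative (2 *\<^sub>R X, 0)) (at 0)"
    by (intro has_vector_derivative_Pair has_vector_derivative_const)
  show "open ?T" by (intro open_Collect_less continuous_intros)
  show "(0 :: real) \<in> ?T" by simp
  fix t assume "t \<in> ?T"
  moreover have "(t *\<^sub>R X, 0) \<in> pv_model P1 f1"
    using X subspace_skew by (auto simp: pv_model_def op_simps intro: subspace_scale)
  ultimately have "pv_chart P1 f1 (orbit_path P1 f1 (t *\<^sub>R X)) =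
      (2 *\<^sub>R ((t *\<^sub>R X) * inv_elt (1 + (t *\<^sub>R X) * (t *\<^sub>R X))), 0)"
    by (intro chart_orbit_path_anticommuting) auto
  then show "(t *\<^sub>R c t, 0) = pv_chart P1 f1 (orbit_path P1 f1 (t *\<^sub>R X))"
    by (simp add: c_def)
qed

end

lemma submanifold_proj_vectors: "submanifold r (proj_vectors :: ('a :: complex_hilbert bdd_op \<times> 'a) set)"
  unfolding submanifold_def
proof
  fix p :: "'a bdd_op \<times> 'a" assume "p \<in> proj_vectors"
  then obtain P1 f1 where p: "p = (P1, f1)" "(P1, f1) \<in> proj_vectors" by (cases p) auto
  then show "\<exists>U \<phi> F. p \<in> U \<and> slice_chart r proj_vectors U \<phi> F"
    using pv_slice_chart[OF p(2), of proj_vectors] pv_chart_basepoint(1)[OF p(2)] by blast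
qed

lemma submanifold_orbit: "submanifold r (proj_vectors_orbit P0)"
  unfolding submanifold_def
proof
  fix p assume "p \<in> proj_vectors_orbit P0"
  then obtain P1 f1 where p: "p = (P1, f1)" "(P1, f1) \<in> proj_vectors_orbit P0" by (cases p) auto
  then have "(P1, f1) \<in> proj_vectors" by (simp add: proj_vectors_orbit_iff)
  then show "\<exists>U \<phi> F. p \<in> U \<and> slice_chart r (proj_vectors_orbit P0) U \<phi> F"
    using pv_orbit_chart[OF p(2)] pv_chart_basepoint(1) p(1) by blast
qed

lemma submanifold_unitary: "submanifold r (unitary_ops :: 'a :: complex_hilbert bdd_op set)"
  unfolding submanifold_def
proof
  fix U0 :: "'a bdd_op" assume U0: "U0 \<in> unitary_ops"
  let ?U = "{T. has_inverse (T * adjoint_op U0 + 1) \<and> cayley_coord (T * adjoint_op U0) \<in> ball 0 1}"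
  have "U0 \<in> ?U" using U0 has_inverse_two by (simp add: unitary_ops_iff)
  moreover have "slice_chart r unitary_ops ?U (\<lambda>T. cayley_coord (T * adjoint_op U0)) skew_ops"
    by (rule unitary_chart(1)[OF U0 open_ball[of 0 1] order_refl refl])
  ultimately show "\<exists>U \<phi> F. U0 \<in> U \<and> slice_chart r unitary_ops U \<phi> F" by (intro exI conjI)
qed

text \<open>
  In the charts at \<open>U0\<close> and at \<open>(P1, f1) = rho (P0, f0) U0\<close> the orbit map is \<open>pv_chart \<circ> orbit_path\<close>.
  Its derivative exists by analyticity and is evaluated on the two families of lines above.
\<close>

lemma orbit_map_charts:
  assumes p0: "(P0, f0) \<in> proj_vectors" and U0: "U0 \<in> unitary_ops"
  shows "\<exists>U \<phi> F V \<psi> G L. adapted_charts r unitary_ops (proj_vectors_orbit P0) (rho (P0, f0)) U0 U \<phi> F V \<psi> G \<and>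
      ((\<psi> \<circ> rho (P0, f0) \<circ> inv_into U \<phi>) has_derivative L) (at (\<phi> U0) within F) \<and>
      L ` F = G \<and> complemented_in F {v \<in> F. L v = 0}"
proof -
  define P1 where "P1 = U0 * P0 * adjoint_op U0"
  define f1 where "f1 = U0 \<cdot> f0"
  have orb: "(P1, f1) \<in> proj_vectors_orbit P0"
    using rho_orbit[OF p0 U0] by (simp add: rho_eq P1_def f1_def)
  then have p1: "(P1, f1) \<in> proj_vectors" by (simp add: proj_vectors_orbit_iff)
  note f1n = pv_basepoint(4)[OF p1]
  let ?V = "pv_nbhd P1 f1" and ?\<psi> = "pv_chart P1 f1" and ?G = "pv_model P1 f1"
  let ?F = "skew_ops :: 'a bdd_op set" and ?h = "orbit_path P1 f1"
  define \<Omega> where "\<Omega> = ball 0 1 \<inter> ?h -` ?V"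
  define \<phi> where "\<phi> T = cayley_coord (T * adjoint_op U0)" for T
  define U where "U = {T. has_inverse (T * adjoint_op U0 + 1) \<and> \<phi> T \<in> \<Omega>}"
  define g where "g = ?\<psi> \<circ> rho (P0, f0) \<circ> inv_into U \<phi>"
  have rho: "rho (P0, f0) (cayley A * U0) = ?h A" for A
    by (simp add: rho_eq orbit_path_def P1_def f1_def adjoint_mult mult.assoc op_mult_apply)
  have "continuous_on (ball 0 1) ?h"
    by (intro continuous_at_imp_continuous_on ballI analytic_at_isCont analytic_at_orbit_path subspace_UNIV) simp
  then have \<Omega>: "open \<Omega>" "\<Omega> \<subseteq> ball 0 1"
    unfolding \<Omega>_def using open_pv_nbhd[OF p1] by (auto intro: continuous_open_preimage)
  note chart = unitary_chart[OF U0 \<Omega>, of U, folded \<phi>_def, OF U_def]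
  have h0: "?h 0 = (P1, f1)" by (simp add: orbit_path_def op_one_apply)
  have \<Omega>0: "0 \<in> \<Omega>" using pv_chart_basepoint(1)[OF p1] by (simp add: \<Omega>_def h0)
  have \<phi>0: "\<phi> U0 = 0" using U0 by (simp add: \<phi>_def unitary_ops_iff)
  have U0U: "U0 \<in> U" using U0 \<Omega>0 has_inverse_two by (simp add: U_def \<phi>0) (simp add: unitary_ops_iff)
  have gh: "g A = ?\<psi> (?h A)" if "A \<in> \<Omega>" for A
    using chart(3)[OF that] by (simp add: g_def rho)
  have g: "analytic_at ?F A g" if A: "A \<in> \<Omega>" for A
  proof -
    obtain e where e: "e > 0" "ball A e \<subseteq> \<Omega>" using \<Omega>(1) A openE by blast
    have "analytic_at ?F A (\<lambda>A. ?\<psi> (?h A))"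
      using A \<Omega> by (intro analytic_at_pv_chart[OF p1 _ subspace_skew] analytic_at_orbit_path subspace_skew)
        (auto simp: \<Omega>_def pv_nbhd_def)
    then show ?thesis
      by (rule analytic_at_cong[OF _ e(1)]) (use e(2) in \<open>auto intro!: gh simp: subset_iff dist_norm\<close>)
  qed
  have im: "\<phi> ` (U \<inter> unitary_ops) = \<Omega> \<inter> ?F"
    using chart(1,2) by (auto simp: slice_chart_def)
  have orbit_chart: "slice_chart r (proj_vectors_orbit P0) ?V ?\<psi> ?G" by (rule pv_orbit_chart[OF orb])
  have adapted: "adapted_charts r unitary_ops (proj_vectors_orbit P0) (rho (P0, f0)) U0 U \<phi> ?F ?V ?\<psi> ?G"
    unfolding adapted_charts_def
  proof (intro conjI chart(1) U0U orbit_chart)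
    show "rho (P0, f0) ` (U \<inter> unitary_ops) \<subseteq> ?V"
    proof (intro image_subsetI)
      fix T assume "T \<in> U \<inter> unitary_ops"
      then have T: "has_inverse (T * adjoint_op U0 + 1)" "\<phi> T \<in> \<Omega>" by (auto simp: U_def)
      have "T = cayley (\<phi> T) * U0"
        using U0 by (simp add: \<phi>_def cayley_cayley_coord(2)[OF T(1)] mult.assoc unitary_ops_iff)
      then have "rho (P0, f0) T = ?h (\<phi> T)" using rho by metis
      then show "rho (P0, f0) T \<in> ?V" using T(2) by (simp add: \<Omega>_def)
    qed
    show "of_class r ?F (\<phi> ` (U \<inter> unitary_ops)) (?\<psi> \<circ> rho (P0, f0) \<circ> inv_into U \<phi>)"
      unfolding im g_def[symmetric] using \<Omega>(1) g
      by (intro of_class_analytic subspace_skew) (auto simp: openin_open)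
  qed
  obtain L where L: "(g has_derivative L) (at 0 within ?F)"
    using analytic_at_has_derivative[OF g[OF \<Omega>0] subspace_skew subspace_0[OF subspace_skew] skew_projection] by blast
  interpret L: bounded_linear L by (rule has_derivative_bounded_linear[OF L])
  have line: "((\<lambda>t. ?\<psi> (?h (t *\<^sub>R v))) has_vector_derivative L v) (at 0)" if v: "v \<in> ?F" for v
  proof (rule has_vector_derivative_transform_within_open)
    show "((\<lambda>t. g (0 + t *\<^sub>R v)) has_vector_derivative L v) (at 0)"
      by (rule has_derivative_within_line[OF L subspace_skew subspace_0[OF subspace_skew] v])
    show "open ((\<lambda>t. t *\<^sub>R v) -` \<Omega>)" by (intro open_vimage \<Omega>(1) continuous_intros)
  qed (use \<Omega>0 gh in auto)
  \<comment> \<open>difference quotients of the chart representation lie in the closed subspace \<open>?G\<close>\<close>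
  have LG: "L v \<in> ?G" if v: "v \<in> ?F" for v
  proof -
    have vF: "t *\<^sub>R v \<in> ?F" for t using subspace_skew v by (rule subspace_scale)
    have g0: "?\<psi> (?h 0) = 0" using pv_chart_basepoint(2)[OF p1] by (simp add: h0)
    have "((\<lambda>t. ?\<psi> (?h (t *\<^sub>R v)) /\<^sub>R t) \<longlongrightarrow> L v) (at 0)"
      using has_vector_derivative_tendsto_quotient[OF line[OF v]] g0 by simp
    moreover have "\<forall>\<^sub>F t in at 0. ?\<psi> (?h (t *\<^sub>R v)) /\<^sub>R t \<in> ?G"
    proof -
      have "open ((\<lambda>t. t *\<^sub>R v) -` \<Omega>)" by (intro open_vimage \<Omega>(1) continuous_intros)
      then have "\<forall>\<^sub>F t in at 0. t \<in> (\<lambda>t. t *\<^sub>R v) -` \<Omega>"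
        using \<Omega>0 by (intro eventually_at_in_open') auto
      then show ?thesis
      proof eventually_elim
        case (elim t)
        then have "t *\<^sub>R v \<in> \<phi> ` (U \<inter> unitary_ops)" unfolding im using vF by simp
        then obtain T where T: "T \<in> U" "T \<in> unitary_ops" "t *\<^sub>R v = \<phi> T" by blast
        have "T = cayley (\<phi> T) * U0"
          using U0 T(1) by (simp add: U_def \<phi>_def cayley_cayley_coord(2) mult.assoc unitary_ops_iff)
        then have "?h (t *\<^sub>R v) = rho (P0, f0) T" unfolding T(3) using rho by metis
        then have "?h (t *\<^sub>R v) \<in> proj_vectors_orbit P0 \<inter> ?V"
          using rho_orbit[OF p0 T(2)] elim by (auto simp: \<Omega>_def)
        then have "?\<psi> (?h (t *\<^sub>R v)) \<in> ?G" using orbit_chart unfolding slice_chart_def by blast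
        then show ?case using complemented_pv_model(1)[OF p1] by (simp add: subspace_scale)
      qed
    qed
    ultimately show ?thesis
      by (intro Lim_in_closed_set[OF complemented_pv_model(2)[OF p1]]) auto
  qed
  \<comment> \<open>the factor \<open>1 / 2\<close> compensates the double angle in the derivative along \<open>X\<close>\<close>
  define s where "s q = (1 / 2) *\<^sub>R fst q + tilt f1 (snd q)" for q
  have s: "bounded_linear s"
    unfolding s_def
    by (intro bounded_linear_add bounded_linear_const_scaleR bounded_linear_fst
        bounded_linear_compose[OF bounded_linear_tilt[OF f1n]] bounded_linear_snd)
  have sF: "s q \<in> ?F" if "q \<in> ?G" for q
    unfolding s_def using that subspace_skew
    by (intro subspace_add subspace_scale tilt_skew) (auto simp: pv_model_def)
  have Ls: "L (s q) = q" if q: "q \<in> ?G" for q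
  proof -
    obtain X w where qXw: "q = (X, w)" by (cases q)
    then have X: "(X, 0) \<in> ?G" "X \<in> ?F" "Re (cinner f1 w) = 0" using q by (auto simp: pv_model_def)
    have "L X = (2 *\<^sub>R X, 0)"
      using vector_derivative_unique_at[OF line[OF X(2)] chart_orbit_path_derivative_anticommuting[OF p1 X(1)]] .
    moreover have "L (tilt f1 w) = (0, w)"
      using vector_derivative_unique_at[OF line[OF tilt_skew] chart_orbit_path_derivative_tilt[OF p1 X(3)]] .
    ultimately show ?thesis by (simp add: s_def qXw L.add L.scaleR)
  qed
  have split: "L ` ?F = ?G" "complemented_in ?F {v \<in> ?F. L v = 0}"
    by (rule right_inverse_surjective_split[OF subspace_skew complemented_skew(2) L.bounded_linear_axioms s LG sF Ls];
        assumption)+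
  show ?thesis
    using adapted L split by (intro exI conjI) (auto simp: \<phi>0 g_def)
qed

lemma submersion_orbit_map:
  assumes p0: "(P0, f0) \<in> proj_vectors"
  shows "submersion r unitary_ops (proj_vectors_orbit P0) (rho (P0, f0))"
  unfolding submersion_def manifold_map_def
  using submanifold_unitary submanifold_orbit rho_orbit[OF p0] orbit_map_charts[OF p0]
  by (intro conjI ballI) (blast+)

theorem proposition3p2:
  shows "submanifold Smooth (proj_vectors :: ('a :: complex_hilbert bdd_op \<times> 'a) set) \<and>
    submanifold Analytic (proj_vectors :: ('a bdd_op \<times> 'a) set) \<and>
    submanifold Analytic (unitary_ops :: 'a bdd_op set) \<and>
    (\<forall>(P0, f0) \<in> (proj_vectors :: ('a bdd_op \<times> 'a) set).
      submanifold Analytic (proj_vectors_orbit P0) \<and>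
      submersion Smooth unitary_ops (proj_vectors_orbit P0) (rho (P0, f0)) \<and>
      submersion Analytic unitary_ops (proj_vectors_orbit P0) (rho (P0, f0)))"
  using submanifold_proj_vectors submanifold_unitary submanifold_orbit submersion_orbit_map by blast

end
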